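(* The path $P_5$ on $5$ vertices is $4$-Tur\'an-good.
   Context: All graphs are finite and simple. $P_r$ is the path on $r$ vertices (with $r-1$ edges) and $K_r$ is the complete graph on $r$ vertices. $\mathcal{N}(H,G)$ denotes the number of copies of $H$ in $G$, i.e. the number of (not necessarily induced) subgraphs of $G$ isomorphic to $H$. A graph is $F$-free if it contains no copy of $F$ as a (not necessarily induced) subgraph. $ex(n,H,F)=\max\{\mathcal{N}(H,G): G \text{ is an } n\text{-vertex } F\text{-free graph}\}$. The Tur\'an graph $T_{k-1}(n)$ is the complete $(k-1)$-partite graph on $n$ vertices in which each class has size $\lceil n/(k-1)\rceil$ or $\lfloor n/(k-1)\rfloor$. A graph $H$ that does not contain $K_k$ as a subgraph is called $k$-Tur\'an-good if $ex(n,H,K_k)=\mathcal{N}(H,T_{k-1}(n))$ for every sufficiently large $n$. *)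

theory Defs
  imports Complex_Main
begin

record 'a ugraph =
  verts :: "'a set"
  edges :: "'a set set"

definition simple_graph :: "'a ugraph \<Rightarrow> bool" where
  "simple_graph G \<longleftrightarrow>
     finite (verts G) \<and> (\<forall>e\<in>edges G. e \<subseteq> verts G \<and> card e = 2)"

definition subgraph :: "'a ugraph \<Rightarrow> 'a ugraph \<Rightarrow> bool" where
  "subgraph S G \<longleftrightarrow>
     simple_graph S \<and> verts S \<subseteq> verts G \<and> edges S \<subseteq> edges G"

definition isomorphic :: "'a ugraph \<Rightarrow> 'b ugraph \<Rightarrow> bool" where
  "isomorphic G H \<longleftrightarrow>
     (\<exists>f. bij_betw f (verts G) (verts H) \<and>
          (\<forall>u\<in>verts G. \<forall>v\<in>verts G. {u, v} \<in> edges G \<longleftrightarrow> {f u, f v} \<in> edges H))"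

definition copies :: "'a ugraph \<Rightarrow> 'b ugraph \<Rightarrow> 'b ugraph set" where
  "copies H G = {S. subgraph S G \<and> isomorphic S H}"

text \<open>\<open>num_copies H G\<close> is $\mathcal{N}(H,G)$: subgraphs are counted, not embeddings of \<open>H\<close>.\<close>

definition num_copies :: "'a ugraph \<Rightarrow> 'b ugraph \<Rightarrow> nat" where
  "num_copies H G = card (copies H G)"

definition graph_free :: "'a ugraph \<Rightarrow> 'b ugraph \<Rightarrow> bool" where
  "graph_free F G \<longleftrightarrow> copies F G = {}"

text \<open>Up to isomorphism, every finite graph has its vertices among the natural numbers, so
  letting \<open>G\<close> range over graphs on \<open>nat\<close> loses nothing.\<close>

definition ex_number :: "nat \<Rightarrow> 'a ugraph \<Rightarrow> 'b ugraph \<Rightarrow> nat" where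
  "ex_number n H F =
     Max {num_copies H G | G :: nat ugraph.
            simple_graph G \<and> card (verts G) = n \<and> graph_free F G}"

definition path_graph :: "nat \<Rightarrow> nat ugraph" where
  "path_graph r = \<lparr>verts = {..<r}, edges = {{i, Suc i} | i. Suc i < r}\<rparr>"

definition complete_graph :: "nat \<Rightarrow> nat ugraph" where
  "complete_graph r = \<lparr>verts = {..<r}, edges = {{i, j} | i j. i < r \<and> j < r \<and> i \<noteq> j}\<rparr>"

text \<open>\<open>turan_graph r n\<close> is $T_r(n)$ for \<open>r > 0\<close>: its classes are the residue classes modulo \<open>r\<close>
  in \<open>{..<n}\<close>, which have the prescribed sizes by \<open>turan_class_size\<close> below.\<close>

definition turan_class :: "nat \<Rightarrow> nat \<Rightarrow> nat \<Rightarrow> nat set" where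
  "turan_class r n i = {v. v < n \<and> v mod r = i}"

definition turan_graph :: "nat \<Rightarrow> nat \<Rightarrow> nat ugraph" where
  "turan_graph r n =
     \<lparr>verts = {..<n},
      edges = {{u, v} | u v i j. i < r \<and> j < r \<and> i \<noteq> j \<and>
                 u \<in> turan_class r n i \<and> v \<in> turan_class r n j}\<rparr>"

definition turan_good :: "nat \<Rightarrow> 'a ugraph \<Rightarrow> bool" where
  "turan_good k H \<longleftrightarrow>
     graph_free (complete_graph k) H \<and>
     (\<exists>n0. \<forall>n\<ge>n0. ex_number n H (complete_graph k) = num_copies H (turan_graph (k - 1) n))"

lemma turan_class_size:
  assumes "i < r"
  shows "int (card (turan_class r n i)) \<in> {\<lfloor>real n / real r\<rfloor>, \<lceil>real n / real r\<rceil>}"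
proof -
  have r: "r > 0" using assms by simp
  have card: "card (turan_class r n i) = n div r + (if i < n mod r then 1 else 0)"
  proof (induction n)
    case 0
    then show ?case by (simp add: turan_class_def)
  next
    case (Suc n)
    have fin: "finite (turan_class r n i)" "n \<notin> turan_class r n i"
      by (simp_all add: turan_class_def)
    have "turan_class r (Suc n) i =
        (if n mod r = i then insert n (turan_class r n i) else turan_class r n i)"
      by (auto simp: turan_class_def less_Suc_eq)
    then have "card (turan_class r (Suc n) i) =
        card (turan_class r n i) + (if n mod r = i then 1 else 0)"
      using fin by simp
    then show ?case
      using Suc assms r mod_less_divisor[OF r, of n] by (auto simp: div_Suc mod_Suc)
  qed
  have fl: "\<lfloor>real n / real r\<rfloor> = int (n div r)"
    by (simp add: floor_divide_of_nat_eq)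
  show ?thesis
  proof (cases "i < n mod r")
    case False
    then show ?thesis using card fl by simp
  next
    case True
    then have "n mod r > 0" by simp
    have "real n = real r * real (n div r) + real (n mod r)"
      by (metis mult_div_mod_eq of_nat_add of_nat_mult)
    then have eq: "real n / real r = real (n div r) + real (n mod r) / real r"
      using r by (simp add: field_simps)
    have "0 < real (n mod r) / real r" "real (n mod r) / real r \<le> 1"
      using \<open>n mod r > 0\<close> mod_less_divisor[OF r, of n] r by simp_all
    then have "\<lceil>real n / real r\<rceil> = int (n div r) + 1"
      unfolding eq by (intro ceiling_unique) auto
    then show ?thesis using card True by simp
  qed
qed

text \<open>The maximum in \<open>ex_number\<close> is over a finite set of numbers, so \<open>Max\<close> is meaningful.\<close>

lemma finite_ex_number_set:
  "finite {num_copies H G | G :: nat ugraph.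
            simple_graph G \<and> card (verts G) = n \<and> graph_free F G}"
proof (rule finite_subset)
  show "finite {..2 ^ n * 2 ^ 2 ^ n :: nat}" by simp
  show "{num_copies H G | G :: nat ugraph.
            simple_graph G \<and> card (verts G) = n \<and> graph_free F G} \<subseteq> {..2 ^ n * 2 ^ 2 ^ n}"
  proof
    fix x assume "x \<in> {num_copies H G | G :: nat ugraph.
            simple_graph G \<and> card (verts G) = n \<and> graph_free F G}"
    then obtain G :: "nat ugraph"
      where G: "simple_graph G" and n: "card (verts G) = n" and x: "x = num_copies H G"
      by blast
    let ?A = "Pow (verts G) \<times> Pow (Pow (verts G))"
    have fin: "finite ?A" using G by (simp add: simple_graph_def)
    have sub: "copies H G \<subseteq> (\<lambda>(V, E). \<lparr>verts = V, edges = E\<rparr>) ` ?A"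
    proof
      fix S assume "S \<in> copies H G"
      then have "(verts S, edges S) \<in> ?A"
        by (auto simp: copies_def subgraph_def simple_graph_def)
      moreover have "S = (\<lambda>(V, E). \<lparr>verts = V, edges = E\<rparr>) (verts S, edges S)"
        by simp
      ultimately show "S \<in> (\<lambda>(V, E). \<lparr>verts = V, edges = E\<rparr>) ` ?A" by (rule rev_image_eqI)
    qed
    have "card (copies H G) \<le> card ?A"
      using card_mono[OF finite_imageI[OF fin] sub] card_image_le[OF fin] le_trans by blast
    also have "\<dots> = 2 ^ n * 2 ^ 2 ^ n"
      using G n by (simp add: card_cartesian_product card_Pow simple_graph_def)
    finally show "x \<in> {..2 ^ n * 2 ^ 2 ^ n}"
      by (simp add: x num_copies_def)
  qed
qed

end

theory Submission
  imports Defs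
begin

text \<open>
  Remove from a \<open>K\<^sub>4\<close>-free graph a triangle \<open>T\<close> (or, lacking one, an edge and a third vertex) and
  sort the ordered 5-vertex paths by the positions they occupy in \<open>T\<close>. Every remaining vertex has at
  most two neighbours in \<open>T\<close> and adjacent vertices have at most one common neighbour there. This
  bounds the number of paths meeting \<open>T\<close> by a nonnegative combination of the numbers of edges,
  triangles and paths on 3 and 4 vertices of the rest, with equality for the Turan graph, provided
  all degrees in the rest are at least 6. The smaller counts are maximised by the Turan graph by the
  same removal argument.

  A vertex of degree at most 7 lies on \<open>O(n\<^sup>3)\<close> paths, whereas adding a vertex to the Turan graph
  creates \<open>\<Omega>(n\<^sup>4)\<close>. Hence, for large \<open>n\<close>, the excess of a graph over the Turan graph drops when such a
  vertex or else \<open>T\<close> is removed, unless the rest has as many edges as the Turan graph and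
  therefore has the same counts. As the excess is bounded for small \<open>n\<close>, it is not positive for large
  \<open>n\<close>.
\<close>

subsection \<open>Sums over tuples of distinct elements\<close>

text \<open>The obstacle is that the Turan graph does not maximise every pattern separately.
  Nonadjacent vertices \<open>x\<close>, \<open>y\<close> with neighbours \<open>t1\<close>,
  \<open>t2\<close> and \<open>t1\<close>, \<open>t3\<close> in a triangle \<open>T\<close> admit
  three routes \<open>x s t y\<close> through \<open>T\<close>, whereas two vertices of one Turan
  class admit only two. Such pairs need a positive correction, called \<open>bad\<close> below. It
  is paid for by the pattern with just the middle vertex in \<open>T\<close>: there a bad pair loses
  at least one of its two connecting vertices, for every choice of the two outer vertices. The loss
  is about the product of the two degrees, while the gains are linear in the number of common
  neighbours; hence the demand for a minimum degree in the rest.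

  Vertices of small degree are removed one at a time, but the comparison with the growth of the
  Turan graph then holds only for large \<open>n\<close>. An induction on the inequality itself
  would have no base case. This is why the excess is followed instead, and why it must drop
  strictly: the number of arcs provides the drop unless it equals that of the Turan graph, and the
  latter case calls for a uniqueness statement.\<close>

definition dsum2 :: "'a set \<Rightarrow> ('a \<Rightarrow> 'a \<Rightarrow> int) \<Rightarrow> int" where
  "dsum2 V f = (\<Sum>x\<in>V. sum (f x) (V - {x}))"

definition dsum3 :: "'a set \<Rightarrow> ('a \<Rightarrow> 'a \<Rightarrow> 'a \<Rightarrow> int) \<Rightarrow> int" where
  "dsum3 V f = (\<Sum>x\<in>V. dsum2 (V - {x}) (f x))"

definition dsum4 :: "'a set \<Rightarrow> ('a \<Rightarrow> 'a \<Rightarrow> 'a \<Rightarrow> 'a \<Rightarrow> int) \<Rightarrow> int" where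
  "dsum4 V f = (\<Sum>x\<in>V. dsum3 (V - {x}) (f x))"

definition dsum5 :: "'a set \<Rightarrow> ('a \<Rightarrow> 'a \<Rightarrow> 'a \<Rightarrow> 'a \<Rightarrow> 'a \<Rightarrow> int) \<Rightarrow> int" where
  "dsum5 V f = (\<Sum>x\<in>V. dsum4 (V - {x}) (f x))"

lemmas dsum_defs = dsum2_def dsum3_def dsum4_def dsum5_def

lemma dsum2_add: "dsum2 V (\<lambda>x y. f x y + g x y) = dsum2 V f + dsum2 V g"
  by (simp add: dsum2_def sum.distrib)

lemma dsum3_add: "dsum3 V (\<lambda>x y z. f x y z + g x y z) = dsum3 V f + dsum3 V g"
  by (simp add: dsum3_def sum.distrib dsum2_add)

lemma dsum4_add: "dsum4 V (\<lambda>x y z w. f x y z w + g x y z w) = dsum4 V f + dsum4 V g"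
  by (simp add: dsum4_def sum.distrib dsum3_add)

lemma dsum2_diff: "dsum2 V (\<lambda>x y. f x y - g x y) = dsum2 V f - dsum2 V g"
  by (simp add: dsum2_def sum_subtractf)

lemma dsum3_diff: "dsum3 V (\<lambda>x y z. f x y z - g x y z) = dsum3 V f - dsum3 V g"
  by (simp add: dsum3_def sum_subtractf dsum2_diff)

lemma dsum4_diff: "dsum4 V (\<lambda>x y z w. f x y z w - g x y z w) = dsum4 V f - dsum4 V g"
  by (simp add: dsum4_def sum_subtractf dsum3_diff)

lemma dsum2_cmult: "dsum2 V (\<lambda>x y. c * f x y) = c * dsum2 V f"
  by (simp add: dsum2_def sum_distrib_left)

lemma dsum3_cmult: "dsum3 V (\<lambda>x y z. c * f x y z) = c * dsum3 V f"
  by (simp add: dsum3_def sum_distrib_left dsum2_cmult)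

lemma dsum4_cmult: "dsum4 V (\<lambda>x y z w. c * f x y z w) = c * dsum4 V f"
  by (simp add: dsum4_def sum_distrib_left dsum3_cmult)

lemmas dsum_linear = dsum2_add dsum3_add dsum4_add dsum2_diff dsum3_diff dsum4_diff
  dsum2_cmult dsum3_cmult dsum4_cmult

lemma dsum2_mono:
  "(\<And>x y. x \<in> V \<Longrightarrow> y \<in> V \<Longrightarrow> f x y \<le> g x y) \<Longrightarrow> dsum2 V f \<le> dsum2 V g"
  unfolding dsum2_def by (intro sum_mono) auto

lemma dsum3_mono:
  "(\<And>x y z. x \<in> V \<Longrightarrow> y \<in> V \<Longrightarrow> z \<in> V \<Longrightarrow> f x y z \<le> g x y z) \<Longrightarrow> dsum3 V f \<le> dsum3 V g"
  unfolding dsum3_def by (intro sum_mono dsum2_mono) auto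

lemma dsum4_mono:
  "(\<And>x y z w. x \<in> V \<Longrightarrow> y \<in> V \<Longrightarrow> z \<in> V \<Longrightarrow> w \<in> V \<Longrightarrow> f x y z w \<le> g x y z w)
    \<Longrightarrow> dsum4 V f \<le> dsum4 V g"
  unfolding dsum4_def by (intro sum_mono dsum3_mono) auto

lemma dsum5_mono:
  "(\<And>x y z w u. x \<in> V \<Longrightarrow> y \<in> V \<Longrightarrow> z \<in> V \<Longrightarrow> w \<in> V \<Longrightarrow> u \<in> V \<Longrightarrow> f x y z w u \<le> g x y z w u)
    \<Longrightarrow> dsum5 V f \<le> dsum5 V g"
  unfolding dsum5_def by (intro sum_mono dsum4_mono) auto

lemma dsum2_cong:
  "(\<And>x y. x \<in> V \<Longrightarrow> y \<in> V \<Longrightarrow> f x y = g x y) \<Longrightarrow> dsum2 V f = dsum2 V g"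
  unfolding dsum2_def by (intro sum.cong refl) auto

lemma dsum3_cong:
  "(\<And>x y z. x \<in> V \<Longrightarrow> y \<in> V \<Longrightarrow> z \<in> V \<Longrightarrow> f x y z = g x y z) \<Longrightarrow> dsum3 V f = dsum3 V g"
  unfolding dsum3_def by (intro sum.cong refl dsum2_cong) auto

lemma dsum4_cong:
  "(\<And>x y z w. x \<in> V \<Longrightarrow> y \<in> V \<Longrightarrow> z \<in> V \<Longrightarrow> w \<in> V \<Longrightarrow> f x y z w = g x y z w)
    \<Longrightarrow> dsum4 V f = dsum4 V g"
  unfolding dsum4_def by (intro sum.cong refl dsum3_cong) auto

lemma dsum2_sum: "(\<Sum>t\<in>T. dsum2 V (f t)) = dsum2 V (\<lambda>x y. \<Sum>t\<in>T. f t x y)"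
  unfolding dsum2_def by (subst sum.swap, rule sum.cong[OF refl], rule sum.swap)

lemma dsum3_sum: "(\<Sum>t\<in>T. dsum3 V (f t)) = dsum3 V (\<lambda>x y z. \<Sum>t\<in>T. f t x y z)"
  unfolding dsum3_def by (subst sum.swap) (simp add: dsum2_sum)

lemma dsum4_sum: "(\<Sum>t\<in>T. dsum4 V (f t)) = dsum4 V (\<lambda>x y z w. \<Sum>t\<in>T. f t x y z w)"
  unfolding dsum4_def by (subst sum.swap) (simp add: dsum3_sum)

lemma sum_sum: "(\<Sum>t\<in>T. sum (f t) V) = (\<Sum>x\<in>V. \<Sum>t\<in>T. f t x)" for f :: "'a \<Rightarrow> 'b \<Rightarrow> int"
  by (rule sum.swap)

text \<open>The inner range depends on the outer variable, so both sums are first extended to all of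
  \<open>V\<close> with an indicator of \<open>x \<noteq> y\<close>; then they can be
  exchanged.\<close>

lemma sum_distinct_swap:
  fixes g :: "'a \<Rightarrow> 'a \<Rightarrow> int"
  assumes "finite V"
  shows "(\<Sum>x\<in>V. \<Sum>y\<in>V-{x}. g x y) = (\<Sum>x\<in>V. \<Sum>y\<in>V-{x}. g y x)"
proof -
  have *: "(\<Sum>y\<in>V-{x}. h y) = (\<Sum>y\<in>V. if x \<noteq> y then h y else 0)" for x and h :: "'a \<Rightarrow> int"
    using assms by (intro sum.mono_neutral_cong_left) auto
  show ?thesis unfolding * by (subst sum.swap) (auto intro!: sum.cong)
qed

lemma dsum2_swap: "finite V \<Longrightarrow> dsum2 V (\<lambda>x y. f y x) = dsum2 V f"
  unfolding dsum2_def using sum_distinct_swap[of V "\<lambda>x y. f y x"] by simp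

lemma dsum3_swap12: "finite V \<Longrightarrow> dsum3 V (\<lambda>x y z. f y x z) = dsum3 V f"
  unfolding dsum3_def dsum2_def using sum_distinct_swap[of V "\<lambda>x y. sum (f y x) (V-{x}-{y})"]
  by (simp add: Diff_insert2[symmetric] insert_commute)

lemma dsum3_swap23: "finite V \<Longrightarrow> dsum3 V (\<lambda>x y z. f x z y) = dsum3 V f"
  unfolding dsum3_def by (intro sum.cong refl dsum2_swap finite_Diff)

lemma dsum4_swap12: "finite V \<Longrightarrow> dsum4 V (\<lambda>x y z w. f y x z w) = dsum4 V f"
  unfolding dsum4_def dsum3_def using sum_distinct_swap[of V "\<lambda>x y. dsum2 (V-{x}-{y}) (f y x)"]
  by (simp add: Diff_insert2[symmetric] insert_commute)

lemma dsum4_swap23: "finite V \<Longrightarrow> dsum4 V (\<lambda>x y z w. f x z y w) = dsum4 V f"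
  unfolding dsum4_def by (intro sum.cong refl dsum3_swap12 finite_Diff)

lemma int_card_Diff: "finite V \<Longrightarrow> x \<in> V \<Longrightarrow> int (card (V - {x})) = int (card V) - 1"
  by (metis card_Suc_Diff1 of_nat_Suc add_diff_cancel_left')

text \<open>A position on which the summand does not depend contributes the number of vertices still
  available. These rules turn a pattern with a free end into a factor linear in the number of
  vertices times a smaller count.\<close>

lemma dsum2_free_last: "finite V \<Longrightarrow> dsum2 V (\<lambda>x y. f x) = (int (card V) - 1) * sum f V"
  unfolding dsum2_def sum_distrib_left by (intro sum.cong refl) (simp add: int_card_Diff del: card_Diff_insert)

lemma dsum3_free_last: "finite V \<Longrightarrow> dsum3 V (\<lambda>x y z. f x y) = (int (card V) - 2) * dsum2 V f"
  unfolding dsum3_def dsum2_def[of V] sum_distrib_left[of _ _ V]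
  by (intro sum.cong refl) (simp only: dsum2_free_last finite_Diff int_card_Diff, simp)

lemma dsum4_free_last: "finite V \<Longrightarrow> dsum4 V (\<lambda>x y z w. f x y z) = (int (card V) - 3) * dsum3 V f"
  unfolding dsum4_def dsum3_def[of V] sum_distrib_left[of _ _ V]
  by (intro sum.cong refl) (simp only: dsum3_free_last finite_Diff int_card_Diff, simp)

lemma dsum2_free_first: "finite V \<Longrightarrow> dsum2 V (\<lambda>x y. f y) = (int (card V) - 1) * sum f V"
  using dsum2_swap[of V "\<lambda>x y. f x"] dsum2_free_last[of V f] by simp

lemma dsum3_free_first: "finite V \<Longrightarrow> dsum3 V (\<lambda>x y z. f y z) = (int (card V) - 2) * dsum2 V f"
  unfolding dsum3_swap12[of V "\<lambda>x y z. f x z"]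
  unfolding dsum3_def dsum2_def[of V] sum_distrib_left[of _ _ V]
  by (intro sum.cong refl) (simp only: dsum2_free_first finite_Diff int_card_Diff, simp)

lemma dsum4_free_first: "finite V \<Longrightarrow> dsum4 V (\<lambda>x y z w. f y z w) = (int (card V) - 3) * dsum3 V f"
  unfolding dsum4_swap12[of V "\<lambda>x y z w. f x z w"]
  unfolding dsum4_def dsum3_def[of V] sum_distrib_left[of _ _ V]
  by (intro sum.cong refl) (simp only: dsum3_free_first finite_Diff int_card_Diff, simp)

lemma dsum2_const: "finite V \<Longrightarrow> dsum2 V (\<lambda>x y. c) = c * int (card V) * (int (card V) - 1)"
  using dsum2_free_last[of V "\<lambda>_. c"] by simp

lemma dsum3_const: "finite V \<Longrightarrow> dsum3 V (\<lambda>x y z. c) = c * int (card V) * (int (card V) - 1) * (int (card V) - 2)"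
  using dsum3_free_last[of V "\<lambda>_ _. c"] by (simp add: dsum2_const)

section \<open>Splitting sums over a disjoint union\<close>

lemma Un_Diff_disjoint:
  "V \<inter> T = {} \<Longrightarrow> x \<in> V \<Longrightarrow> (V \<union> T) - {x} = (V - {x}) \<union> T"
  "V \<inter> T = {} \<Longrightarrow> x \<in> T \<Longrightarrow> (V \<union> T) - {x} = V \<union> (T - {x})"
  by auto

lemma sum_Un_int: "finite V \<Longrightarrow> finite T \<Longrightarrow> V \<inter> T = {} \<Longrightarrow> sum f (V \<union> T) = sum f V + sum f T"
  for f :: "'a \<Rightarrow> int" by (rule sum.union_disjoint)

lemma dsum2_Un:
  assumes "finite V" "finite T" "V \<inter> T = {}"
  shows "dsum2 (V \<union> T) f = dsum2 V f + (\<Sum>x\<in>V. \<Sum>t\<in>T. f x t) + (\<Sum>x\<in>V. \<Sum>t\<in>T. f t x) + dsum2 T f"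
proof -
  have "dsum2 (V \<union> T) f = (\<Sum>x\<in>V. sum (f x) ((V - {x}) \<union> T)) + (\<Sum>t\<in>T. sum (f t) (V \<union> (T - {t})))"
    unfolding dsum2_def using assms by (simp add: sum_Un_int Un_Diff_disjoint)
  also have "\<dots> = (\<Sum>x\<in>V. sum (f x) (V - {x}) + sum (f x) T) + (\<Sum>t\<in>T. sum (f t) V + sum (f t) (T - {t}))"
    using assms by (intro arg_cong2[where f="(+)"] sum.cong refl sum_Un_int) auto
  finally show ?thesis
    by (simp add: dsum2_def sum.distrib sum_sum[where T=T and V=V])
qed

lemma dsum3_Un:
  assumes "finite V" "finite T" "V \<inter> T = {}"
  shows "dsum3 (V \<union> T) f = dsum3 V f
    + dsum2 V (\<lambda>x y. \<Sum>t\<in>T. f t x y) + dsum2 V (\<lambda>x y. \<Sum>t\<in>T. f x t y) + dsum2 V (\<lambda>x y. \<Sum>t\<in>T. f x y t)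
    + (\<Sum>x\<in>V. dsum2 T (\<lambda>s t. f s t x)) + (\<Sum>x\<in>V. dsum2 T (\<lambda>s t. f s x t)) + (\<Sum>x\<in>V. dsum2 T (\<lambda>s t. f x s t))
    + dsum3 T f"
proof -
  have "dsum3 (V \<union> T) f = (\<Sum>x\<in>V. dsum2 ((V - {x}) \<union> T) (f x)) + (\<Sum>t\<in>T. dsum2 (V \<union> (T - {t})) (f t))"
    unfolding dsum3_def using assms by (simp add: sum_Un_int Un_Diff_disjoint)
  also have "(\<Sum>x\<in>V. dsum2 ((V - {x}) \<union> T) (f x)) = (\<Sum>x\<in>V. dsum2 (V - {x}) (f x)
     + (\<Sum>y\<in>V - {x}. \<Sum>t\<in>T. f x y t) + (\<Sum>y\<in>V - {x}. \<Sum>t\<in>T. f x t y) + dsum2 T (f x))"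
    using assms by (intro sum.cong refl dsum2_Un) auto
  also have "(\<Sum>t\<in>T. dsum2 (V \<union> (T - {t})) (f t)) = (\<Sum>t\<in>T. dsum2 V (f t)
     + (\<Sum>y\<in>V. \<Sum>s\<in>T - {t}. f t y s) + (\<Sum>y\<in>V. \<Sum>s\<in>T - {t}. f t s y) + dsum2 (T - {t}) (f t))"
    using assms by (intro sum.cong refl dsum2_Un) auto
  finally show ?thesis
    by (simp only: sum.distrib sum_sum[where T=T and V=V] dsum2_sum[where T=T and V=V]
      sum_sum[where T=T and V="V-{x}" for x] dsum2_def[of V] dsum3_def[of V] dsum2_def[of T]
       dsum3_def[of T] ac_simps)
qed

lemma dsum4_Un:
  assumes "finite V" "finite T" "V \<inter> T = {}"
  shows "dsum4 (V \<union> T) f = dsum4 V f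
    + dsum3 V (\<lambda>x y z. \<Sum>t\<in>T. f t x y z) + dsum3 V (\<lambda>x y z. \<Sum>t\<in>T. f x t y z)
    + dsum3 V (\<lambda>x y z. \<Sum>t\<in>T. f x y t z) + dsum3 V (\<lambda>x y z. \<Sum>t\<in>T. f x y z t)
    + dsum2 V (\<lambda>x y. dsum2 T (\<lambda>s t. f s t x y)) + dsum2 V (\<lambda>x y. dsum2 T (\<lambda>s t. f s x t y))
    + dsum2 V (\<lambda>x y. dsum2 T (\<lambda>s t. f s x y t)) + dsum2 V (\<lambda>x y. dsum2 T (\<lambda>s t. f x s t y))
    + dsum2 V (\<lambda>x y. dsum2 T (\<lambda>s t. f x s y t)) + dsum2 V (\<lambda>x y. dsum2 T (\<lambda>s t. f x y s t))
    + (\<Sum>x\<in>V. dsum3 T (\<lambda>s t u. f s t u x)) + (\<Sum>x\<in>V. dsum3 T (\<lambda>s t u. f s t x u))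
    + (\<Sum>x\<in>V. dsum3 T (\<lambda>s t u. f s x t u)) + (\<Sum>x\<in>V. dsum3 T (\<lambda>s t u. f x s t u))
    + dsum4 T f"
proof -
  have "dsum4 (V \<union> T) f = (\<Sum>x\<in>V. dsum3 ((V - {x}) \<union> T) (f x)) + (\<Sum>t\<in>T. dsum3 (V \<union> (T - {t})) (f t))"
    unfolding dsum4_def using assms by (simp add: sum_Un_int Un_Diff_disjoint)
  also have "(\<Sum>x\<in>V. dsum3 ((V - {x}) \<union> T) (f x)) = (\<Sum>x\<in>V. dsum3 (V - {x}) (f x)
    + dsum2 (V - {x}) (\<lambda>y z. \<Sum>t\<in>T. f x t y z) + dsum2 (V - {x}) (\<lambda>y z. \<Sum>t\<in>T. f x y t z)
    + dsum2 (V - {x}) (\<lambda>y z. \<Sum>t\<in>T. f x y z t)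
    + (\<Sum>y\<in>V - {x}. dsum2 T (\<lambda>s t. f x s t y)) + (\<Sum>y\<in>V - {x}. dsum2 T (\<lambda>s t. f x s y t))
    + (\<Sum>y\<in>V - {x}. dsum2 T (\<lambda>s t. f x y s t)) + dsum3 T (f x))"
    using assms by (intro sum.cong refl dsum3_Un) auto
  also have "(\<Sum>t\<in>T. dsum3 (V \<union> (T - {t})) (f t)) = (\<Sum>t\<in>T. dsum3 V (f t)
    + dsum2 V (\<lambda>x y. \<Sum>u\<in>T - {t}. f t u x y) + dsum2 V (\<lambda>x y. \<Sum>u\<in>T - {t}. f t x u y)
    + dsum2 V (\<lambda>x y. \<Sum>u\<in>T - {t}. f t x y u)
    + (\<Sum>x\<in>V. dsum2 (T - {t}) (\<lambda>u v. f t u v x)) + (\<Sum>x\<in>V. dsum2 (T - {t}) (\<lambda>u v. f t u x v))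
    + (\<Sum>x\<in>V. dsum2 (T - {t}) (\<lambda>u v. f t x u v)) + dsum3 (T - {t}) (f t))"
    using assms by (intro sum.cong refl dsum3_Un) auto
  finally show ?thesis
    by (simp only: sum.distrib sum_sum[where T=T and V=V] dsum2_sum[where T=T and V=V]
      dsum3_sum[where T=T and V=V] sum_sum[where T=T and V="V-{x}" for x]
      dsum2_sum[where T=T and V="V-{x}" for x]
     dsum3_def[of V] dsum2_def[of V] dsum2_def[of T] dsum3_def[of T] dsum4_def[of T] dsum4_def[of V])
qed

text \<open>The 32 summands correspond to the sets of positions that lie in \<open>T\<close>. As in
  the lower cases, the first vertex is fixed, the rule for one vertex fewer is applied to
  \<open>(V - {p}) \<union> T\<close> or to \<open>V \<union> (T - {t})\<close>, and sums over
  \<open>T\<close> are moved inside those over \<open>V\<close>.\<close>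

lemma dsum5_Un:
  assumes "finite V" "finite T" "V \<inter> T = {}"
  shows "dsum5 (V \<union> T) f = dsum5 V f
    + dsum4 V (\<lambda>x y z w. (\<Sum>s\<in>T. f s x y z w))
    + dsum4 V (\<lambda>x y z w. (\<Sum>s\<in>T. f x s y z w))
    + dsum4 V (\<lambda>x y z w. (\<Sum>s\<in>T. f x y s z w))
    + dsum4 V (\<lambda>x y z w. (\<Sum>s\<in>T. f x y z s w))
    + dsum4 V (\<lambda>x y z w. (\<Sum>s\<in>T. f x y z w s))
    + dsum3 V (\<lambda>x y z. dsum2 T (\<lambda>s t. f s t x y z))
    + dsum3 V (\<lambda>x y z. dsum2 T (\<lambda>s t. f s x t y z))
    + dsum3 V (\<lambda>x y z. dsum2 T (\<lambda>s t. f s x y t z))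
    + dsum3 V (\<lambda>x y z. dsum2 T (\<lambda>s t. f s x y z t))
    + dsum3 V (\<lambda>x y z. dsum2 T (\<lambda>s t. f x s t y z))
    + dsum3 V (\<lambda>x y z. dsum2 T (\<lambda>s t. f x s y t z))
    + dsum3 V (\<lambda>x y z. dsum2 T (\<lambda>s t. f x s y z t))
    + dsum3 V (\<lambda>x y z. dsum2 T (\<lambda>s t. f x y s t z))
    + dsum3 V (\<lambda>x y z. dsum2 T (\<lambda>s t. f x y s z t))
    + dsum3 V (\<lambda>x y z. dsum2 T (\<lambda>s t. f x y z s t))
    + dsum2 V (\<lambda>x y. dsum3 T (\<lambda>s t u. f s t u x y))
    + dsum2 V (\<lambda>x y. dsum3 T (\<lambda>s t u. f s t x u y))
    + dsum2 V (\<lambda>x y. dsum3 T (\<lambda>s t u. f s t x y u))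
    + dsum2 V (\<lambda>x y. dsum3 T (\<lambda>s t u. f s x t u y))
    + dsum2 V (\<lambda>x y. dsum3 T (\<lambda>s t u. f s x t y u))
    + dsum2 V (\<lambda>x y. dsum3 T (\<lambda>s t u. f s x y t u))
    + dsum2 V (\<lambda>x y. dsum3 T (\<lambda>s t u. f x s t u y))
    + dsum2 V (\<lambda>x y. dsum3 T (\<lambda>s t u. f x s t y u))
    + dsum2 V (\<lambda>x y. dsum3 T (\<lambda>s t u. f x s y t u))
    + dsum2 V (\<lambda>x y. dsum3 T (\<lambda>s t u. f x y s t u))
    + (\<Sum>x\<in>V. dsum4 T (\<lambda>s t u r. f s t u r x))
    + (\<Sum>x\<in>V. dsum4 T (\<lambda>s t u r. f s t u x r))
    + (\<Sum>x\<in>V. dsum4 T (\<lambda>s t u r. f s t x u r))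
    + (\<Sum>x\<in>V. dsum4 T (\<lambda>s t u r. f s x t u r))
    + (\<Sum>x\<in>V. dsum4 T (\<lambda>s t u r. f x s t u r))
    + dsum5 T f"
proof -
  have "dsum5 (V \<union> T) f = (\<Sum>p\<in>V. dsum4 ((V - {p}) \<union> T) (f p)) + (\<Sum>t\<in>T. dsum4 (V \<union> (T - {t})) (f t))"
    unfolding dsum5_def using assms by (simp add: sum_Un_int Un_Diff_disjoint)
  also have "(\<Sum>p\<in>V. dsum4 ((V - {p}) \<union> T) (f p)) = (\<Sum>p\<in>V.
    dsum4 (V - {p}) (f p)
    + dsum3 (V - {p}) (\<lambda>x y z. (\<Sum>s\<in>T. f p s x y z))
    + dsum3 (V - {p}) (\<lambda>x y z. (\<Sum>s\<in>T. f p x s y z))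
    + dsum3 (V - {p}) (\<lambda>x y z. (\<Sum>s\<in>T. f p x y s z))
    + dsum3 (V - {p}) (\<lambda>x y z. (\<Sum>s\<in>T. f p x y z s))
    + dsum2 (V - {p}) (\<lambda>x y. dsum2 T (\<lambda>s t. f p s t x y))
    + dsum2 (V - {p}) (\<lambda>x y. dsum2 T (\<lambda>s t. f p s x t y))
    + dsum2 (V - {p}) (\<lambda>x y. dsum2 T (\<lambda>s t. f p s x y t))
    + dsum2 (V - {p}) (\<lambda>x y. dsum2 T (\<lambda>s t. f p x s t y))
    + dsum2 (V - {p}) (\<lambda>x y. dsum2 T (\<lambda>s t. f p x s y t))
    + dsum2 (V - {p}) (\<lambda>x y. dsum2 T (\<lambda>s t. f p x y s t))
    + (\<Sum>x\<in>(V - {p}). dsum3 T (\<lambda>s t u. f p s t u x))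
    + (\<Sum>x\<in>(V - {p}). dsum3 T (\<lambda>s t u. f p s t x u))
    + (\<Sum>x\<in>(V - {p}). dsum3 T (\<lambda>s t u. f p s x t u))
    + (\<Sum>x\<in>(V - {p}). dsum3 T (\<lambda>s t u. f p x s t u))
    + dsum4 T (f p))"
    using assms by (intro sum.cong refl dsum4_Un) auto
  also have "(\<Sum>t\<in>T. dsum4 (V \<union> (T - {t})) (f t)) = (\<Sum>p\<in>T.
    dsum4 V (f p)
    + dsum3 V (\<lambda>x y z. (\<Sum>s\<in>(T - {p}). f p s x y z))
    + dsum3 V (\<lambda>x y z. (\<Sum>s\<in>(T - {p}). f p x s y z))
    + dsum3 V (\<lambda>x y z. (\<Sum>s\<in>(T - {p}). f p x y s z))
    + dsum3 V (\<lambda>x y z. (\<Sum>s\<in>(T - {p}). f p x y z s))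
    + dsum2 V (\<lambda>x y. dsum2 (T - {p}) (\<lambda>s t. f p s t x y))
    + dsum2 V (\<lambda>x y. dsum2 (T - {p}) (\<lambda>s t. f p s x t y))
    + dsum2 V (\<lambda>x y. dsum2 (T - {p}) (\<lambda>s t. f p s x y t))
    + dsum2 V (\<lambda>x y. dsum2 (T - {p}) (\<lambda>s t. f p x s t y))
    + dsum2 V (\<lambda>x y. dsum2 (T - {p}) (\<lambda>s t. f p x s y t))
    + dsum2 V (\<lambda>x y. dsum2 (T - {p}) (\<lambda>s t. f p x y s t))
    + (\<Sum>x\<in>V. dsum3 (T - {p}) (\<lambda>s t u. f p s t u x))
    + (\<Sum>x\<in>V. dsum3 (T - {p}) (\<lambda>s t u. f p s t x u))
    + (\<Sum>x\<in>V. dsum3 (T - {p}) (\<lambda>s t u. f p s x t u))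
    + (\<Sum>x\<in>V. dsum3 (T - {p}) (\<lambda>s t u. f p x s t u))
    + dsum4 (T - {p}) (f p))"
    using assms by (intro sum.cong refl dsum4_Un) auto
  finally show ?thesis
    by (simp only: sum.distrib sum_sum[where T=T and V=V] dsum2_sum[where T=T and V=V]
      dsum3_sum[where T=T and V=V] dsum4_sum[where T=T and V=V]
      sum_sum[where T=T and V="V-{x}" for x] dsum2_sum[where T=T and V="V-{x}" for x]
      dsum3_sum[where T=T and V="V-{x}" for x]
      dsum2_def[of V] dsum3_def[of V] dsum4_def[of V] dsum5_def[of V]
      dsum2_def[of T] dsum3_def[of T] dsum4_def[of T] dsum5_def[of T] ac_simps)
qed

lemma dsum2_small: "finite V \<Longrightarrow> card V < 2 \<Longrightarrow> dsum2 V f = 0"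
  by (auto simp: dsum2_def less_2_cases_iff card_1_singleton_iff)

lemma dsum3_small: "finite V \<Longrightarrow> card V < 3 \<Longrightarrow> dsum3 V f = 0"
  unfolding dsum3_def by (intro sum.neutral ballI dsum2_small) auto

lemma dsum4_small: "finite V \<Longrightarrow> card V < 4 \<Longrightarrow> dsum4 V f = 0"
  unfolding dsum4_def by (intro sum.neutral ballI dsum3_small) auto

lemma dsum5_small: "finite V \<Longrightarrow> card V < 5 \<Longrightarrow> dsum5 V f = 0"
  unfolding dsum5_def by (intro sum.neutral ballI dsum4_small) auto

declare sum_of_bool_eq [simp del] sum_mult_of_bool_eq [simp del] sum_of_bool_mult_eq [simp del]

subsection \<open>Ordered counts\<close>

locale sgraph =
  fixes adj :: "'a \<Rightarrow> 'a \<Rightarrow> bool"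
  assumes adj_sym: "adj x y \<longleftrightarrow> adj y x"
    and adj_irrefl: "\<not> adj x x"
begin

abbreviation e :: "'a \<Rightarrow> 'a \<Rightarrow> int" where "e x y \<equiv> of_bool (adj x y)"

end

lemma dsum2_prod:
  assumes "finite W"
  shows "dsum2 W (\<lambda>x y. f x * g y) = sum f W * sum g W - (\<Sum>x\<in>W. f x * g x)"
proof -
  have "sum g (W - {x}) = sum g W - g x" if "x \<in> W" for x
    using assms that by (simp add: sum_diff1)
  then show ?thesis
    by (simp add: dsum2_def sum_distrib_left[symmetric] sum_distrib_right right_diff_distrib sum_subtractf)
qed

context sgraph
begin

text \<open>All counts are of ordered tuples: edges and paths are counted twice, triangles six times.\<close>

definition arcs :: "'a set \<Rightarrow> int" where
  "arcs V = dsum2 V (\<lambda>x y. e x y)"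

definition paths3 :: "'a set \<Rightarrow> int" where
  "paths3 V = dsum3 V (\<lambda>x y z. e x y * e y z)"

definition triangles :: "'a set \<Rightarrow> int" where
  "triangles V = dsum3 V (\<lambda>x y z. e x y * e y z * e x z)"

definition paths4 :: "'a set \<Rightarrow> int" where
  "paths4 V = dsum4 V (\<lambda>x y z w. e x y * e y z * e z w)"

definition paths5 :: "'a set \<Rightarrow> int" where
  "paths5 V = dsum5 V (\<lambda>x y z w v. e x y * e y z * e z w * e w v)"

definition deg :: "'a set \<Rightarrow> 'a \<Rightarrow> int" where
  "deg V x = (\<Sum>y\<in>V. e x y)"

section \<open>Degrees and pairs of disjoint edges\<close>

lemma e_sym: "e x y = e y x"
  using adj_sym by simp

lemma e_idem: "e x y * e x y = e x y"
  by simp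

lemma deg_Diff:
  assumes "finite V" "x \<in> V" "y \<in> V"
  shows "(\<Sum>z\<in>V - {x} - {y}. e x z) = deg V x - e x y" "(\<Sum>z\<in>V - {y} - {x}. e x z) = deg V x - e x y"
  using assms adj_irrefl by (auto simp: deg_def sum_diff1)

text \<open>Deleting a vertex destroys its incident arcs in both directions; those between
  \<open>x\<close> and \<open>y\<close> are subtracted twice, hence the last term.\<close>

lemma arcs_Diff:
  assumes "finite V" "x \<in> V" "y \<in> V" "x \<noteq> y"
  shows "arcs (V - {x} - {y}) = arcs V - 2 * deg V x - 2 * deg V y + 2 * e x y"
proof -
  let ?W = "V - {x} - {y}"
  have "V = ?W \<union> {x, y}" using assms by auto
  then have "arcs V = arcs (?W \<union> {x, y})" by (rule arg_cong)
  also have "\<dots> = arcs ?W + 2 * (\<Sum>z\<in>?W. e x z) + 2 * (\<Sum>z\<in>?W. e y z) + 2 * e x y"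
    unfolding arcs_def using assms
    by (subst dsum2_Un) (auto simp: dsum2_def insert_Diff_if sum.distrib adj_sym)
  also have "\<dots> = arcs ?W + 2 * (deg V x - e x y) + 2 * (deg V y - e x y) + 2 * e x y"
    using deg_Diff(1)[of V x y] deg_Diff(2)[of V y x] assms e_sym[of x y] by simp
  finally show ?thesis by simp
qed

text \<open>An arc \<open>x y\<close> continued by any arc out of \<open>y\<close> is a 3-vertex
  path unless it returns to \<open>x\<close>; the returning ones make up
  \<open>arcs V\<close>.\<close>

lemma sum_arcs_deg:
  assumes "finite V"
  shows "(\<Sum>x\<in>V. \<Sum>y\<in>V - {x}. e x y * deg V y) = paths3 V + arcs V"
proof -
  have "paths3 V = (\<Sum>x\<in>V. \<Sum>y\<in>V - {x}. e x y * (\<Sum>z\<in>V - {x} - {y}. e y z))"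
    by (simp only: paths3_def dsum3_def dsum2_def sum_distrib_left)
  also have "\<dots> = (\<Sum>x\<in>V. \<Sum>y\<in>V - {x}. e x y * (deg V y - e x y))"
  proof (intro sum.cong refl)
    fix x y assume "x \<in> V" "y \<in> V - {x}"
    then show "e x y * (\<Sum>z\<in>V - {x} - {y}. e y z) = e x y * (deg V y - e x y)"
      using deg_Diff(2)[of V y x] assms e_sym[of x y] by simp
  qed
  also have "\<dots> = (\<Sum>x\<in>V. \<Sum>y\<in>V - {x}. e x y * deg V y) - arcs V"
    by (simp add: right_diff_distrib sum_subtractf arcs_def dsum2_def e_idem)
  finally show ?thesis by simp
qed

text \<open>When only the middle vertex of a 5-vertex path lies in \<open>T\<close>, two disjoint
  edges remain. Their number is expressed by other counts so that it can be compared with the Turan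
  graph; the negative multiple of \<open>paths3 V\<close> is outweighed later, in
  \<open>ext_paths5_eval\<close>.\<close>

lemma disjoint_edges:
  assumes "finite V"
  shows "dsum4 V (\<lambda>x y z w. e x y * e z w) = arcs V * arcs V - 2 * arcs V - 4 * paths3 V"
proof -
  have "dsum4 V (\<lambda>x y z w. e x y * e z w) = (\<Sum>x\<in>V. \<Sum>y\<in>V - {x}. e x y * arcs (V - {x} - {y}))"
    unfolding dsum4_def dsum3_def arcs_def by (simp only: dsum2_cmult)
  also have "\<dots> = (\<Sum>x\<in>V. \<Sum>y\<in>V - {x}. arcs V * e x y - 2 * (e y x * deg V x) - 2 * (e x y * deg V y) + 2 * e x y)"
    using assms by (intro sum.cong refl) (auto simp: arcs_Diff adj_sym)
  also have "\<dots> = arcs V * arcs V - 2 * (\<Sum>x\<in>V. \<Sum>y\<in>V - {x}. e y x * deg V x)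
      - 2 * (\<Sum>x\<in>V. \<Sum>y\<in>V - {x}. e x y * deg V y) + 2 * arcs V"
    by (simp add: arcs_def dsum2_def sum.distrib sum_subtractf sum_distrib_left)
  also have "(\<Sum>x\<in>V. \<Sum>y\<in>V - {x}. e y x * deg V x) = (\<Sum>x\<in>V. \<Sum>y\<in>V - {x}. e x y * deg V y)"
    by (rule sum_distinct_swap[OF assms])
  finally show ?thesis
    by (simp add: sum_arcs_deg[OF assms])
qed

text \<open>A pair counted by \<open>b\<close> gains at most \<open>4\<kappa> + 4\<close>, where \<open>\<kappa>\<close> is its number of common neighbours,
  and loses \<open>deg x * deg y - \<kappa>\<close>.\<close>

lemma bad_pairs_absorbed:
  assumes "finite V" and deg: "\<And>x. x \<in> V \<Longrightarrow> deg V x \<ge> 6"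
    and b: "\<And>x y. b x y \<ge> 0" "\<And>x y. adj x y \<Longrightarrow> b x y = 0"
  shows "4 * dsum3 V (\<lambda>x y z. e x y * e y z * b x z) + 4 * dsum2 V b
    \<le> dsum4 V (\<lambda>x y z w. e x y * e z w * b y z)"
proof -
  let ?k = "\<lambda>x y. \<Sum>z\<in>V - {x} - {y}. e x z * e y z"
  let ?g = "\<lambda>y z x w. b y z * (e y x * e z w)"
  \<comment> \<open>The coordinates are permuted so that the pair weighted by \<open>b\<close> comes
    first; the inner sum then chooses a neighbour of each of the two.\<close>
  have "dsum4 V (\<lambda>x y z w. e x y * e z w * b y z) = dsum4 V (\<lambda>x y z w. ?g y z x w)"
    by (intro dsum4_cong) (simp add: adj_sym)
  also have "\<dots> = dsum4 V (\<lambda>x y z w. ?g x z y w)"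
    using dsum4_swap12[OF assms(1), of "\<lambda>x y z w. ?g x z y w"] by simp
  also have "\<dots> = dsum4 V ?g"
    using dsum4_swap23[OF assms(1), of ?g] by simp
  also have "\<dots> = (\<Sum>x\<in>V. \<Sum>y\<in>V - {x}. b x y * dsum2 (V - {x} - {y}) (\<lambda>z w. e x z * e y w))"
    unfolding dsum4_def dsum3_def by (simp only: dsum2_cmult)
  finally have 4: "dsum4 V (\<lambda>x y z w. e x y * e z w * b y z) = \<dots>" .
  have "dsum3 V (\<lambda>x y z. e x y * e y z * b x z) = dsum3 V (\<lambda>x y z. b x z * (e x y * e z y))"
    by (intro dsum3_cong) (simp add: adj_sym)
  also have "\<dots> = dsum3 V (\<lambda>x y z. b x y * (e x z * e y z))"
    using dsum3_swap23[OF assms(1), of "\<lambda>x y z. b x y * (e x z * e y z)"] by simp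
  finally have 3: "dsum3 V (\<lambda>x y z. e x y * e y z * b x z) = (\<Sum>x\<in>V. \<Sum>y\<in>V - {x}. b x y * ?k x y)"
    by (simp only: dsum3_def dsum2_def sum_distrib_left)
  have "4 * (b x y * ?k x y) + 4 * b x y \<le> b x y * dsum2 (V - {x} - {y}) (\<lambda>z w. e x z * e y w)"
    if "x \<in> V" "y \<in> V - {x}" for x y
  proof (cases "adj x y")
    case False
    have "dsum2 (V - {x} - {y}) (\<lambda>z w. e x z * e y w) = deg V x * deg V y - ?k x y"
      using that assms(1) deg_Diff(1)[of V x y] deg_Diff(2)[of V y x] False adj_sym[of x y]
      by (simp add: dsum2_prod)
    moreover have "?k x y \<le> (\<Sum>z\<in>V - {x} - {y}. e x z)"
      by (intro sum_mono) auto
    then have "?k x y \<le> deg V x"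
      using that assms(1) deg_Diff(1)[of V x y] False by simp
    \<comment> \<open>Writing \<open>d\<close> for \<open>deg V x\<close> and \<open>k\<close> for
      the number of common neighbours, the loss is at least \<open>6 * d - k\<close>. As
      \<open>k \<le> d\<close> and \<open>d \<ge> 6\<close>, it exceeds \<open>4 * k + 4\<close>.
      This is where the degree condition is used.\<close>
    moreover have "deg V x * 6 \<le> deg V x * deg V y"
      using deg[of x] deg[of y] that by (intro mult_left_mono) auto
    ultimately have "4 * ?k x y + 4 \<le> dsum2 (V - {x} - {y}) (\<lambda>z w. e x z * e y w)"
      using deg[of x] that by linarith
    then have "b x y * (4 * ?k x y + 4) \<le> b x y * dsum2 (V - {x} - {y}) (\<lambda>z w. e x z * e y w)"
      by (rule mult_left_mono[OF _ b(1)])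
    then show ?thesis
      by (simp only: distrib_left mult.commute mult.left_commute)
  qed (simp add: b)
  then have "(\<Sum>x\<in>V. \<Sum>y\<in>V - {x}. 4 * (b x y * ?k x y) + 4 * b x y)
    \<le> (\<Sum>x\<in>V. \<Sum>y\<in>V - {x}. b x y * dsum2 (V - {x} - {y}) (\<lambda>z w. e x z * e y w))"
    by (intro sum_mono) auto
  then show ?thesis
    unfolding 3 4 by (simp add: dsum2_def sum.distrib sum_distrib_left)
qed

end

subsection \<open>Adding a triple of vertices\<close>

text \<open>For a triangle \<open>T\<close>, the conditions \<open>lim\<close> and
  \<open>cmn\<close> follow from the absence of K_4. They are assumed in its place because
  \<open>T\<close> is not always a triangle; no adjacency inside \<open>T\<close> is
  prescribed.\<close>

locale triple_ext = sgraph adj for adj :: "'a \<Rightarrow> 'a \<Rightarrow> bool" +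
  fixes V :: "'a set" and t1 t2 t3 :: 'a
  assumes finV: "finite V" and distinct_T: "t1 \<noteq> t2" "t1 \<noteq> t3" "t2 \<noteq> t3"
    and notin_V: "t1 \<notin> V" "t2 \<notin> V" "t3 \<notin> V"
    and lim: "x \<in> V \<Longrightarrow> \<not> (adj x t1 \<and> adj x t2 \<and> adj x t3)"
    and cmn: "x \<in> V \<Longrightarrow> y \<in> V \<Longrightarrow>
      \<not> (adj x y \<and> adj x t1 \<and> adj x t2 \<and> adj y t1 \<and> adj y t2) \<and>
      \<not> (adj x y \<and> adj x t1 \<and> adj x t3 \<and> adj y t1 \<and> adj y t3) \<and>
      \<not> (adj x y \<and> adj x t2 \<and> adj x t3 \<and> adj y t2 \<and> adj y t3)"
begin

abbreviation T :: "'a set" where "T \<equiv> {t1, t2, t3}"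

text \<open>For nonadjacent \<open>x\<close> and \<open>y\<close> the counts below are compared with the case of two common
  neighbours in \<open>T\<close>, as in the Turan graph; \<open>bad\<close> marks the other nonadjacent pairs.\<close>

definition bad :: "'a \<Rightarrow> 'a \<Rightarrow> int" where
  "bad x y = of_bool (\<not> adj x y \<and>
      \<not> (adj x t1 \<and> adj x t2 \<and> adj y t1 \<and> adj y t2) \<and>
      \<not> (adj x t1 \<and> adj x t3 \<and> adj y t1 \<and> adj y t3) \<and>
      \<not> (adj x t2 \<and> adj x t3 \<and> adj y t2 \<and> adj y t3))"

lemma T_sums:
  "sum f T = f t1 + f t2 + f t3"
  "dsum2 T g = g t1 t2 + g t1 t3 + (g t2 t1 + g t2 t3) + (g t3 t1 + g t3 t2)"
  "dsum3 T h = h t1 t2 t3 + h t1 t3 t2 + (h t2 t1 t3 + h t2 t3 t1) + (h t3 t1 t2 + h t3 t2 t1)"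
  "dsum4 T k = 0"
  "dsum5 T l = 0"
  for f :: "'a \<Rightarrow> int"
  using distinct_T by (simp_all add: dsum_defs insert_Diff_if)

lemma T_sym:
  "x \<in> V \<Longrightarrow> adj t1 x = adj x t1" "x \<in> V \<Longrightarrow> adj t2 x = adj x t2" "x \<in> V \<Longrightarrow> adj t3 x = adj x t3"
  "adj t2 t1 = adj t1 t2" "adj t3 t1 = adj t1 t3" "adj t3 t2 = adj t2 t3"
  by (rule adj_sym)+

lemma nbr_cases: "x \<in> V \<Longrightarrow>
   adj x t1 \<and> adj x t2 \<and> \<not> adj x t3 \<or> adj x t1 \<and> \<not> adj x t2 \<and> adj x t3 \<or> \<not> adj x t1 \<and> adj x t2 \<and> adj x t3 \<or>
   adj x t1 \<and> \<not> adj x t2 \<and> \<not> adj x t3 \<or> \<not> adj x t1 \<and> adj x t2 \<and> \<not> adj x t3 \<or> \<not> adj x t1 \<and> \<not> adj x t2 \<and> adj x t3 \<or>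
   \<not> adj x t1 \<and> \<not> adj x t2 \<and> \<not> adj x t3"
 using lim[of x] by auto
text \<open>\<open>fill_p5_I\<close> concerns ordered 5-vertex paths whose positions \<open>I\<close> (counted from 0) lie in \<open>T\<close>: it
  bounds the number of choices for these positions once the remaining vertices \<open>x\<close>, \<open>y\<close>, \<open>\<dots>\<close> of the path
  are fixed in order. Likewise for \<open>p4\<close>, \<open>p3\<close>, \<open>p2\<close>, and for ordered triangles (\<open>k3\<close>).\<close>

lemma fill_p5_0:
  assumes "x \<in> V" "y \<in> V" "z \<in> V" "w \<in> V"
  shows "(\<Sum>s\<in>T. e s x * e x y * e y z * e z w) \<le> 2 * (e x y * e y z * e z w)"
  using nbr_cases[OF assms(1)]
  apply (elim disjE)
  using assms cmn[OF assms(1) assms(2)] cmn[OF assms(2) assms(3)] cmn[OF assms(3) assms(4)]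
  by (simp_all add: T_sums T_sym bad_def split: split_of_bool)

lemma fill_p5_1:
  assumes "x \<in> V" "y \<in> V" "z \<in> V" "w \<in> V"
  shows "(\<Sum>s\<in>T. e x s * e s y * e y z * e z w) \<le> 2 * (e y z * e z w) - e x y * e y z * e z w"
  using nbr_cases[OF assms(1)]
  apply (elim disjE; use nbr_cases[OF assms(2)] in \<open>elim disjE\<close>)
  using assms cmn[OF assms(1) assms(2)] cmn[OF assms(2) assms(3)] cmn[OF assms(3) assms(4)]
  by (simp_all add: T_sums T_sym bad_def split: split_of_bool)

text \<open>Adjacent vertices share at most one neighbour in \<open>T\<close>, bad pairs likewise,
  all others at most two. The \<open>bad\<close> term of this pattern pays for all gains: each bad
  pair is charged once for every choice of the outer vertices \<open>x\<close> and
  \<open>w\<close>.\<close>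

lemma fill_p5_2:
  assumes "x \<in> V" "y \<in> V" "z \<in> V" "w \<in> V"
  shows "(\<Sum>s\<in>T. e x y * e y s * e s z * e z w) \<le> 2 * (e x y * e z w) - e x y * e y z * e z w - e x y * e z w * bad y z"
  using nbr_cases[OF assms(2)]
  apply (elim disjE; use nbr_cases[OF assms(3)] in \<open>elim disjE\<close>)
  using assms cmn[OF assms(1) assms(2)] cmn[OF assms(2) assms(3)] cmn[OF assms(3) assms(4)]
  by (simp_all add: T_sums T_sym bad_def split: split_of_bool)

lemma fill_p5_3:
  assumes "x \<in> V" "y \<in> V" "z \<in> V" "w \<in> V"
  shows "(\<Sum>s\<in>T. e x y * e y z * e z s * e s w) \<le> 2 * (e x y * e y z) - e x y * e y z * e z w"
  using nbr_cases[OF assms(3)]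
  apply (elim disjE; use nbr_cases[OF assms(4)] in \<open>elim disjE\<close>)
  using assms cmn[OF assms(1) assms(2)] cmn[OF assms(2) assms(3)] cmn[OF assms(3) assms(4)]
  by (simp_all add: T_sums T_sym bad_def split: split_of_bool)

lemma fill_p5_4:
  assumes "x \<in> V" "y \<in> V" "z \<in> V" "w \<in> V"
  shows "(\<Sum>s\<in>T. e x y * e y z * e z w * e w s) \<le> 2 * (e x y * e y z * e z w)"
  using nbr_cases[OF assms(4)]
  apply (elim disjE)
  using assms cmn[OF assms(1) assms(2)] cmn[OF assms(2) assms(3)] cmn[OF assms(3) assms(4)]
  by (simp_all add: T_sums T_sym bad_def split: split_of_bool)

lemma fill_p5_01:
  assumes "x \<in> V" "y \<in> V" "z \<in> V"
  shows "dsum2 T (\<lambda>s t. e s t * e t x * e x y * e y z) \<le> 4 * (e x y * e y z)"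
  using nbr_cases[OF assms(1)]
  apply (elim disjE)
  using assms cmn[OF assms(1) assms(2)] cmn[OF assms(2) assms(3)]
  by (simp_all add: T_sums T_sym bad_def split: split_of_bool)

lemma fill_p5_02:
  assumes "x \<in> V" "y \<in> V" "z \<in> V"
  shows "dsum2 T (\<lambda>s t. e s x * e x t * e t y * e y z) \<le> 2 * e y z - e x y * e y z - e y z * bad x y"
  using nbr_cases[OF assms(1)]
  apply (elim disjE; use nbr_cases[OF assms(2)] in \<open>elim disjE\<close>)
  using assms cmn[OF assms(1) assms(2)] cmn[OF assms(2) assms(3)]
  by (simp_all add: T_sums T_sym bad_def split: split_of_bool)

text \<open>The values in the Turan graph, for an edge \<open>x y\<close>, explain the formula. If
  \<open>z\<close> is in the class of \<open>y\<close>, the four choices less the case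
  \<open>s = t\<close> give 3. If \<open>z\<close> is in the class of \<open>x\<close>, the only
  \<open>t\<close> is also adjacent to \<open>x\<close> and 1 choice remains. If
  \<open>x y z\<close> is a triangle, the only \<open>t\<close> is not adjacent to \<open>x\<close>
  and 2 remain. The \<open>bad\<close> term allows for a \<open>z\<close> that is nonadjacent to
  \<open>x\<close> but has other neighbours in \<open>T\<close>.\<close>

lemma fill_p5_03:
  assumes "x \<in> V" "y \<in> V" "z \<in> V"
  shows "dsum2 T (\<lambda>s t. e s x * e x y * e y t * e t z) \<le> 3 * e x y - 2 * (e x y * e y z) + e x y * e y z * e x z + e x y * e y z * bad x z"
  using nbr_cases[OF assms(1)]
  apply (elim disjE; use nbr_cases[OF assms(2)] in \<open>elim disjE\<close>; use nbr_cases[OF assms(3)] in \<open>elim disjE\<close>)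
  using assms cmn[OF assms(1) assms(2)] cmn[OF assms(1) assms(3)] cmn[OF assms(2) assms(3)]
  by (simp_all add: T_sums T_sym bad_def split: split_of_bool)

lemma fill_p5_04:
  assumes "x \<in> V" "y \<in> V" "z \<in> V"
  shows "dsum2 T (\<lambda>s t. e s x * e x y * e y z * e z t) \<le> 2 * (e x y * e y z) + e x y * e y z * e x z + e x y * e y z * bad x z"
  using nbr_cases[OF assms(1)]
  apply (elim disjE; use nbr_cases[OF assms(3)] in \<open>elim disjE\<close>)
  using assms cmn[OF assms(1) assms(2)] cmn[OF assms(1) assms(3)] cmn[OF assms(2) assms(3)]
  by (simp_all add: T_sums T_sym bad_def split: split_of_bool)

text \<open>The gain of a bad pair cancels in the total against the loss in
  \<open>fill_p5_02\<close>, just as \<open>fill_p5_23\<close> cancels against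
  \<open>fill_p5_24\<close>. Only bad pairs that are the ends of a path \<open>x y z\<close>, or
  that stand alone, remain to be paid for.\<close>

lemma fill_p5_12:
  assumes "x \<in> V" "y \<in> V" "z \<in> V"
  shows "dsum2 T (\<lambda>s t. e x s * e s t * e t y * e y z) \<le> 2 * e y z + e x y * e y z + e y z * bad x y"
  using nbr_cases[OF assms(1)]
  apply (elim disjE; use nbr_cases[OF assms(2)] in \<open>elim disjE\<close>)
  using assms cmn[OF assms(1) assms(2)] cmn[OF assms(2) assms(3)]
  by (simp_all add: T_sums T_sym bad_def split: split_of_bool)

lemma fill_p5_13:
  assumes "x \<in> V" "y \<in> V" "z \<in> V"
  shows "dsum2 T (\<lambda>s t. e x s * e s y * e y t * e t z) \<le> 2 - e x y - e y z + e x y * e y z * e x z + e x y * e y z * bad x z"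
  using nbr_cases[OF assms(1)]
  apply (elim disjE; use nbr_cases[OF assms(2)] in \<open>elim disjE\<close>; use nbr_cases[OF assms(3)] in \<open>elim disjE\<close>)
  using assms cmn[OF assms(1) assms(2)] cmn[OF assms(1) assms(3)] cmn[OF assms(2) assms(3)]
  by (simp_all add: T_sums T_sym bad_def split: split_of_bool)

lemma fill_p5_14:
  assumes "x \<in> V" "y \<in> V" "z \<in> V"
  shows "dsum2 T (\<lambda>s t. e x s * e s y * e y z * e z t) \<le> 3 * e y z - 2 * (e x y * e y z) + e x y * e y z * e x z + e x y * e y z * bad x z"
  using nbr_cases[OF assms(1)]
  apply (elim disjE; use nbr_cases[OF assms(2)] in \<open>elim disjE\<close>; use nbr_cases[OF assms(3)] in \<open>elim disjE\<close>)
  using assms cmn[OF assms(1) assms(2)] cmn[OF assms(1) assms(3)] cmn[OF assms(2) assms(3)]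
  by (simp_all add: T_sums T_sym bad_def split: split_of_bool)

lemma fill_p5_23:
  assumes "x \<in> V" "y \<in> V" "z \<in> V"
  shows "dsum2 T (\<lambda>s t. e x y * e y s * e s t * e t z) \<le> 2 * e x y + e x y * e y z + e x y * bad y z"
  using nbr_cases[OF assms(2)]
  apply (elim disjE; use nbr_cases[OF assms(3)] in \<open>elim disjE\<close>)
  using assms cmn[OF assms(1) assms(2)] cmn[OF assms(2) assms(3)]
  by (simp_all add: T_sums T_sym bad_def split: split_of_bool)

lemma fill_p5_24:
  assumes "x \<in> V" "y \<in> V" "z \<in> V"
  shows "dsum2 T (\<lambda>s t. e x y * e y s * e s z * e z t) \<le> 2 * e x y - e x y * e y z - e x y * bad y z"
  using nbr_cases[OF assms(2)]
  apply (elim disjE; use nbr_cases[OF assms(3)] in \<open>elim disjE\<close>)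
  using assms cmn[OF assms(1) assms(2)] cmn[OF assms(2) assms(3)]
  by (simp_all add: T_sums T_sym bad_def split: split_of_bool)

lemma fill_p5_34:
  assumes "x \<in> V" "y \<in> V" "z \<in> V"
  shows "dsum2 T (\<lambda>s t. e x y * e y z * e z s * e s t) \<le> 4 * (e x y * e y z)"
  using nbr_cases[OF assms(3)]
  apply (elim disjE)
  using assms cmn[OF assms(1) assms(2)] cmn[OF assms(2) assms(3)]
  by (simp_all add: T_sums T_sym bad_def split: split_of_bool)

lemma fill_p5_012:
  assumes "x \<in> V" "y \<in> V"
  shows "dsum3 T (\<lambda>s t u. e s t * e t u * e u x * e x y) \<le> 4 * e x y"
  using nbr_cases[OF assms(1)]
  apply (elim disjE)
  using assms cmn[OF assms(1) assms(2)]
  by (simp_all add: T_sums T_sym bad_def split: split_of_bool)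

lemma fill_p5_013:
  assumes "x \<in> V" "y \<in> V"
  shows "dsum3 T (\<lambda>s t u. e s t * e t x * e x u * e u y) \<le> 2 - e x y - bad x y"
  using nbr_cases[OF assms(1)]
  apply (elim disjE; use nbr_cases[OF assms(2)] in \<open>elim disjE\<close>)
  using assms cmn[OF assms(1) assms(2)]
  by (simp_all add: T_sums T_sym bad_def split: split_of_bool)

lemma fill_p5_014:
  assumes "x \<in> V" "y \<in> V"
  shows "dsum3 T (\<lambda>s t u. e s t * e t x * e x y * e y u) \<le> 3 * e x y"
  using nbr_cases[OF assms(1)]
  apply (elim disjE; use nbr_cases[OF assms(2)] in \<open>elim disjE\<close>)
  using assms cmn[OF assms(1) assms(2)]
  by (simp_all add: T_sums T_sym bad_def split: split_of_bool)

text \<open>All of \<open>T\<close> is used, so \<open>u\<close> is the vertex other than the two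
  neighbours \<open>s\<close>, \<open>t\<close> of \<open>x\<close>. Vertices of one Turan class
  both miss \<open>u\<close>, whereas a \<open>y\<close> that is bad for \<open>x\<close> may be
  adjacent to it, and then both orders of \<open>s\<close> and \<open>t\<close> count.\<close>

lemma fill_p5_023:
  assumes "x \<in> V" "y \<in> V"
  shows "dsum3 T (\<lambda>s t u. e s x * e x t * e t u * e u y) \<le> 2 * e x y + 2 * bad x y"
  using nbr_cases[OF assms(1)]
  apply (elim disjE; use nbr_cases[OF assms(2)] in \<open>elim disjE\<close>)
  using assms cmn[OF assms(1) assms(2)]
  by (simp_all add: T_sums T_sym bad_def split: split_of_bool)

lemma fill_p5_024:
  assumes "x \<in> V" "y \<in> V"
  shows "dsum3 T (\<lambda>s t u. e s x * e x t * e t y * e y u) \<le> e x y + bad x y"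
  using nbr_cases[OF assms(1)]
  apply (elim disjE; use nbr_cases[OF assms(2)] in \<open>elim disjE\<close>)
  using assms cmn[OF assms(1) assms(2)]
  by (simp_all add: T_sums T_sym bad_def split: split_of_bool)

lemma fill_p5_034:
  assumes "x \<in> V" "y \<in> V"
  shows "dsum3 T (\<lambda>s t u. e s x * e x y * e y t * e t u) \<le> 3 * e x y"
  using nbr_cases[OF assms(1)]
  apply (elim disjE; use nbr_cases[OF assms(2)] in \<open>elim disjE\<close>)
  using assms cmn[OF assms(1) assms(2)]
  by (simp_all add: T_sums T_sym bad_def split: split_of_bool)

lemma fill_p5_123:
  assumes "x \<in> V" "y \<in> V"
  shows "dsum3 T (\<lambda>s t u. e x s * e s t * e t u * e u y) \<le> 2 + e x y + bad x y"
  using nbr_cases[OF assms(1)]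
  apply (elim disjE; use nbr_cases[OF assms(2)] in \<open>elim disjE\<close>)
  using assms cmn[OF assms(1) assms(2)]
  by (simp_all add: T_sums T_sym bad_def split: split_of_bool)

lemma fill_p5_124:
  assumes "x \<in> V" "y \<in> V"
  shows "dsum3 T (\<lambda>s t u. e x s * e s t * e t y * e y u) \<le> 2 * e x y + 2 * bad x y"
  using nbr_cases[OF assms(1)]
  apply (elim disjE; use nbr_cases[OF assms(2)] in \<open>elim disjE\<close>)
  using assms cmn[OF assms(1) assms(2)]
  by (simp_all add: T_sums T_sym bad_def split: split_of_bool)

lemma fill_p5_134:
  assumes "x \<in> V" "y \<in> V"
  shows "dsum3 T (\<lambda>s t u. e x s * e s y * e y t * e t u) \<le> 2 - e x y - bad x y"
  using nbr_cases[OF assms(1)]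
  apply (elim disjE; use nbr_cases[OF assms(2)] in \<open>elim disjE\<close>)
  using assms cmn[OF assms(1) assms(2)]
  by (simp_all add: T_sums T_sym bad_def split: split_of_bool)

lemma fill_p5_234:
  assumes "x \<in> V" "y \<in> V"
  shows "dsum3 T (\<lambda>s t u. e x y * e y s * e s t * e t u) \<le> 4 * e x y"
  using nbr_cases[OF assms(2)]
  apply (elim disjE)
  using assms cmn[OF assms(1) assms(2)]
  by (simp_all add: T_sums T_sym bad_def split: split_of_bool)

lemma fill_p4_0:
  assumes "x \<in> V" "y \<in> V" "z \<in> V"
  shows "(\<Sum>s\<in>T. e s x * e x y * e y z) \<le> 2 * (e x y * e y z)"
  using nbr_cases[OF assms(1)]
  apply (elim disjE)
  using assms cmn[OF assms(1) assms(2)] cmn[OF assms(2) assms(3)]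
  by (simp_all add: T_sums T_sym bad_def split: split_of_bool)

lemma fill_p4_1:
  assumes "x \<in> V" "y \<in> V" "z \<in> V"
  shows "(\<Sum>s\<in>T. e x s * e s y * e y z) \<le> 2 * e y z - e x y * e y z - e y z * bad x y"
  using nbr_cases[OF assms(1)]
  apply (elim disjE; use nbr_cases[OF assms(2)] in \<open>elim disjE\<close>)
  using assms cmn[OF assms(1) assms(2)] cmn[OF assms(2) assms(3)]
  by (simp_all add: T_sums T_sym bad_def split: split_of_bool)

lemma fill_p4_2:
  assumes "x \<in> V" "y \<in> V" "z \<in> V"
  shows "(\<Sum>s\<in>T. e x y * e y s * e s z) \<le> 2 * e x y - e x y * e y z - e x y * bad y z"
  using nbr_cases[OF assms(2)]
  apply (elim disjE; use nbr_cases[OF assms(3)] in \<open>elim disjE\<close>)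
  using assms cmn[OF assms(1) assms(2)] cmn[OF assms(2) assms(3)]
  by (simp_all add: T_sums T_sym bad_def split: split_of_bool)

lemma fill_p4_3:
  assumes "x \<in> V" "y \<in> V" "z \<in> V"
  shows "(\<Sum>s\<in>T. e x y * e y z * e z s) \<le> 2 * (e x y * e y z)"
  using nbr_cases[OF assms(3)]
  apply (elim disjE)
  using assms cmn[OF assms(1) assms(2)] cmn[OF assms(2) assms(3)]
  by (simp_all add: T_sums T_sym bad_def split: split_of_bool)

lemma fill_p4_01:
  assumes "x \<in> V" "y \<in> V"
  shows "dsum2 T (\<lambda>s t. e s t * e t x * e x y) \<le> 4 * e x y"
  using nbr_cases[OF assms(1)]
  apply (elim disjE)
  using assms cmn[OF assms(1) assms(2)]
  by (simp_all add: T_sums T_sym bad_def split: split_of_bool)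

lemma fill_p4_02:
  assumes "x \<in> V" "y \<in> V"
  shows "dsum2 T (\<lambda>s t. e s x * e x t * e t y) \<le> 2 - e x y - bad x y"
  using nbr_cases[OF assms(1)]
  apply (elim disjE; use nbr_cases[OF assms(2)] in \<open>elim disjE\<close>)
  using assms cmn[OF assms(1) assms(2)]
  by (simp_all add: T_sums T_sym bad_def split: split_of_bool)

lemma fill_p4_03:
  assumes "x \<in> V" "y \<in> V"
  shows "dsum2 T (\<lambda>s t. e s x * e x y * e y t) \<le> 3 * e x y"
  using nbr_cases[OF assms(1)]
  apply (elim disjE; use nbr_cases[OF assms(2)] in \<open>elim disjE\<close>)
  using assms cmn[OF assms(1) assms(2)]
  by (simp_all add: T_sums T_sym bad_def split: split_of_bool)

lemma fill_p4_12:
  assumes "x \<in> V" "y \<in> V"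
  shows "dsum2 T (\<lambda>s t. e x s * e s t * e t y) \<le> 2 + e x y + bad x y"
  using nbr_cases[OF assms(1)]
  apply (elim disjE; use nbr_cases[OF assms(2)] in \<open>elim disjE\<close>)
  using assms cmn[OF assms(1) assms(2)]
  by (simp_all add: T_sums T_sym bad_def split: split_of_bool)

lemma fill_p4_13:
  assumes "x \<in> V" "y \<in> V"
  shows "dsum2 T (\<lambda>s t. e x s * e s y * e y t) \<le> 2 - e x y - bad x y"
  using nbr_cases[OF assms(1)]
  apply (elim disjE; use nbr_cases[OF assms(2)] in \<open>elim disjE\<close>)
  using assms cmn[OF assms(1) assms(2)]
  by (simp_all add: T_sums T_sym bad_def split: split_of_bool)

lemma fill_p4_23:
  assumes "x \<in> V" "y \<in> V"
  shows "dsum2 T (\<lambda>s t. e x y * e y s * e s t) \<le> 4 * e x y"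
  using nbr_cases[OF assms(2)]
  apply (elim disjE)
  using assms cmn[OF assms(1) assms(2)]
  by (simp_all add: T_sums T_sym bad_def split: split_of_bool)

lemma fill_p4_012:
  assumes "x \<in> V"
  shows "dsum3 T (\<lambda>s t u. e s t * e t u * e u x) \<le> 4"
  using nbr_cases[OF assms(1)]
  apply (elim disjE)
  using assms
  by (simp_all add: T_sums T_sym bad_def split: split_of_bool)

lemma fill_p4_013:
  assumes "x \<in> V"
  shows "dsum3 T (\<lambda>s t u. e s t * e t x * e x u) \<le> 2"
  using nbr_cases[OF assms(1)]
  apply (elim disjE)
  using assms
  by (simp_all add: T_sums T_sym bad_def split: split_of_bool)

lemma fill_p4_023:
  assumes "x \<in> V"
  shows "dsum3 T (\<lambda>s t u. e s x * e x t * e t u) \<le> 2"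
  using nbr_cases[OF assms(1)]
  apply (elim disjE)
  using assms
  by (simp_all add: T_sums T_sym bad_def split: split_of_bool)

lemma fill_p4_123:
  assumes "x \<in> V"
  shows "dsum3 T (\<lambda>s t u. e x s * e s t * e t u) \<le> 4"
  using nbr_cases[OF assms(1)]
  apply (elim disjE)
  using assms
  by (simp_all add: T_sums T_sym bad_def split: split_of_bool)

lemma fill_p3_0:
  assumes "x \<in> V" "y \<in> V"
  shows "(\<Sum>s\<in>T. e s x * e x y) \<le> 2 * e x y"
  using nbr_cases[OF assms(1)]
  apply (elim disjE)
  using assms cmn[OF assms(1) assms(2)]
  by (simp_all add: T_sums T_sym bad_def split: split_of_bool)

lemma fill_p3_1:
  assumes "x \<in> V" "y \<in> V"
  shows "(\<Sum>s\<in>T. e x s * e s y) \<le> 2 - e x y"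
  using nbr_cases[OF assms(1)]
  apply (elim disjE; use nbr_cases[OF assms(2)] in \<open>elim disjE\<close>)
  using assms cmn[OF assms(1) assms(2)]
  by (simp_all add: T_sums T_sym bad_def split: split_of_bool)

lemma fill_p3_2:
  assumes "x \<in> V" "y \<in> V"
  shows "(\<Sum>s\<in>T. e x y * e y s) \<le> 2 * e x y"
  using nbr_cases[OF assms(2)]
  apply (elim disjE)
  using assms cmn[OF assms(1) assms(2)]
  by (simp_all add: T_sums T_sym bad_def split: split_of_bool)

lemma fill_p3_01:
  assumes "x \<in> V"
  shows "dsum2 T (\<lambda>s t. e s t * e t x) \<le> 4"
  using nbr_cases[OF assms(1)]
  apply (elim disjE)
  using assms
  by (simp_all add: T_sums T_sym bad_def split: split_of_bool)

lemma fill_p3_02: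
  assumes "x \<in> V"
  shows "dsum2 T (\<lambda>s t. e s x * e x t) \<le> 2"
  using nbr_cases[OF assms(1)]
  apply (elim disjE)
  using assms
  by (simp_all add: T_sums T_sym bad_def split: split_of_bool)

lemma fill_p3_12:
  assumes "x \<in> V"
  shows "dsum2 T (\<lambda>s t. e x s * e s t) \<le> 4"
  using nbr_cases[OF assms(1)]
  apply (elim disjE)
  using assms
  by (simp_all add: T_sums T_sym bad_def split: split_of_bool)

lemma fill_p3_012:
  shows "dsum3 T (\<lambda>s t u. e s t * e t u) \<le> 6"
  by (simp_all add: T_sums T_sym bad_def split: split_of_bool)

lemma fill_k3_0:
  assumes "x \<in> V" "y \<in> V"
  shows "(\<Sum>s\<in>T. e s x * e x y * e s y) \<le> e x y"
  using nbr_cases[OF assms(1)]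
  apply (elim disjE; use nbr_cases[OF assms(2)] in \<open>elim disjE\<close>)
  using assms cmn[OF assms(1) assms(2)]
  by (simp_all add: T_sums T_sym bad_def split: split_of_bool)

lemma fill_k3_1:
  assumes "x \<in> V" "y \<in> V"
  shows "(\<Sum>s\<in>T. e x s * e s y * e x y) \<le> e x y"
  using nbr_cases[OF assms(1)]
  apply (elim disjE; use nbr_cases[OF assms(2)] in \<open>elim disjE\<close>)
  using assms cmn[OF assms(1) assms(2)]
  by (simp_all add: T_sums T_sym bad_def split: split_of_bool)

lemma fill_k3_2:
  assumes "x \<in> V" "y \<in> V"
  shows "(\<Sum>s\<in>T. e x y * e y s * e x s) \<le> e x y"
  using nbr_cases[OF assms(1)]
  apply (elim disjE; use nbr_cases[OF assms(2)] in \<open>elim disjE\<close>)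
  using assms cmn[OF assms(1) assms(2)]
  by (simp_all add: T_sums T_sym bad_def split: split_of_bool)

lemma fill_k3_01:
  assumes "x \<in> V"
  shows "dsum2 T (\<lambda>s t. e s t * e t x * e s x) \<le> 2"
  using nbr_cases[OF assms(1)]
  apply (elim disjE)
  using assms
  by (simp_all add: T_sums T_sym bad_def split: split_of_bool)

lemma fill_k3_02:
  assumes "x \<in> V"
  shows "dsum2 T (\<lambda>s t. e s x * e x t * e s t) \<le> 2"
  using nbr_cases[OF assms(1)]
  apply (elim disjE)
  using assms
  by (simp_all add: T_sums T_sym bad_def split: split_of_bool)

lemma fill_k3_12:
  assumes "x \<in> V"
  shows "dsum2 T (\<lambda>s t. e x s * e s t * e x t) \<le> 2"
  using nbr_cases[OF assms(1)]
  apply (elim disjE)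
  using assms
  by (simp_all add: T_sums T_sym bad_def split: split_of_bool)

lemma fill_k3_012:
  shows "dsum3 T (\<lambda>s t u. e s t * e t u * e s u) \<le> 6"
  by (simp_all add: T_sums T_sym bad_def split: split_of_bool)

lemma fill_p2_0:
  assumes "x \<in> V"
  shows "(\<Sum>s\<in>T. e s x) \<le> 2"
  using nbr_cases[OF assms(1)]
  apply (elim disjE)
  using assms
  by (simp_all add: T_sums T_sym bad_def split: split_of_bool)

lemma fill_p2_1:
  assumes "x \<in> V"
  shows "(\<Sum>s\<in>T. e x s) \<le> 2"
  using nbr_cases[OF assms(1)]
  apply (elim disjE)
  using assms
  by (simp_all add: T_sums T_sym bad_def split: split_of_bool)

lemma fill_p2_01:
  shows "dsum2 T (\<lambda>s t. e s t) \<le> 6"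
  by (simp_all add: T_sums T_sym bad_def split: split_of_bool)

section \<open>The bounds summed over all patterns\<close>

lemma finT: "finite T" and disjT: "V \<inter> T = {}"
  using notin_V by auto

lemmas Un_rules = dsum2_Un[OF finV finT disjT] dsum3_Un[OF finV finT disjT]
  dsum4_Un[OF finV finT disjT] dsum5_Un[OF finV finT disjT]

lemmas free_rules = dsum3_const[OF finV] dsum2_const[OF finV] dsum3_free_last[OF finV]
  dsum3_free_first[OF finV] dsum4_free_last[OF finV] dsum4_free_first[OF finV]

abbreviation m :: int where "m \<equiv> int (card V)"

text \<open>Left unsimplified and in the order of \<open>dsum5_Un\<close>, so that the inequality in
  general and the equality for the Turan graph can both be proved summand by summand. The six
  patterns with four or five vertices in \<open>T\<close> are absent because \<open>T\<close> has
  only three.\<close>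

definition ext_paths5 :: int where
  "ext_paths5 = paths5 V
    + dsum4 V (\<lambda>x y z w. 2 * (e x y * e y z * e z w))
    + dsum4 V (\<lambda>x y z w. 2 * (e y z * e z w) - e x y * e y z * e z w)
    + dsum4 V (\<lambda>x y z w. 2 * (e x y * e z w) - e x y * e y z * e z w - e x y * e z w * bad y z)
    + dsum4 V (\<lambda>x y z w. 2 * (e x y * e y z) - e x y * e y z * e z w)
    + dsum4 V (\<lambda>x y z w. 2 * (e x y * e y z * e z w))
    + dsum3 V (\<lambda>x y z. 4 * (e x y * e y z))
    + dsum3 V (\<lambda>x y z. 2 * e y z - e x y * e y z - e y z * bad x y)
    + dsum3 V (\<lambda>x y z. 3 * e x y - 2 * (e x y * e y z) + e x y * e y z * e x z + e x y * e y z * bad x z)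
    + dsum3 V (\<lambda>x y z. 2 * (e x y * e y z) + e x y * e y z * e x z + e x y * e y z * bad x z)
    + dsum3 V (\<lambda>x y z. 2 * e y z + e x y * e y z + e y z * bad x y)
    + dsum3 V (\<lambda>x y z. 2 - e x y - e y z + e x y * e y z * e x z + e x y * e y z * bad x z)
    + dsum3 V (\<lambda>x y z. 3 * e y z - 2 * (e x y * e y z) + e x y * e y z * e x z + e x y * e y z * bad x z)
    + dsum3 V (\<lambda>x y z. 2 * e x y + e x y * e y z + e x y * bad y z)
    + dsum3 V (\<lambda>x y z. 2 * e x y - e x y * e y z - e x y * bad y z)
    + dsum3 V (\<lambda>x y z. 4 * (e x y * e y z))
    + dsum2 V (\<lambda>x y. 4 * e x y)
    + dsum2 V (\<lambda>x y. 2 - e x y - bad x y)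
    + dsum2 V (\<lambda>x y. 3 * e x y)
    + dsum2 V (\<lambda>x y. 2 * e x y + 2 * bad x y)
    + dsum2 V (\<lambda>x y. e x y + bad x y)
    + dsum2 V (\<lambda>x y. 3 * e x y)
    + dsum2 V (\<lambda>x y. 2 + e x y + bad x y)
    + dsum2 V (\<lambda>x y. 2 * e x y + 2 * bad x y)
    + dsum2 V (\<lambda>x y. 2 - e x y - bad x y)
    + dsum2 V (\<lambda>x y. 4 * e x y)"

lemma paths5_ext_le: "paths5 (V \<union> T) \<le> ext_paths5"
  unfolding paths5_def Un_rules T_sums(4,5) ext_paths5_def sum.neutral_const add_0_right
  by (intro add_mono order_refl sum_mono dsum2_mono dsum3_mono dsum4_mono
    fill_p5_0 fill_p5_1 fill_p5_2 fill_p5_3 fill_p5_4 fill_p5_01 fill_p5_02 fill_p5_03 fill_p5_04 fill_p5_12 fill_p5_13 fill_p5_14 fill_p5_23 fill_p5_24 fill_p5_34 fill_p5_012 fill_p5_013 fill_p5_014 fill_p5_023 fill_p5_024 fill_p5_034 fill_p5_123 fill_p5_124 fill_p5_134 fill_p5_234)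

definition ext_paths4 :: int where
  "ext_paths4 = paths4 V
    + dsum3 V (\<lambda>x y z. 2 * (e x y * e y z))
    + dsum3 V (\<lambda>x y z. 2 * e y z - e x y * e y z - e y z * bad x y)
    + dsum3 V (\<lambda>x y z. 2 * e x y - e x y * e y z - e x y * bad y z)
    + dsum3 V (\<lambda>x y z. 2 * (e x y * e y z))
    + dsum2 V (\<lambda>x y. 4 * e x y)
    + dsum2 V (\<lambda>x y. 2 - e x y - bad x y)
    + dsum2 V (\<lambda>x y. 3 * e x y)
    + dsum2 V (\<lambda>x y. 2 + e x y + bad x y)
    + dsum2 V (\<lambda>x y. 2 - e x y - bad x y)
    + dsum2 V (\<lambda>x y. 4 * e x y)
    + (\<Sum>x\<in>V. 4)
    + (\<Sum>x\<in>V. 2)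
    + (\<Sum>x\<in>V. 2)
    + (\<Sum>x\<in>V. 4)"

lemma paths4_ext_le: "paths4 (V \<union> T) \<le> ext_paths4"
  unfolding paths4_def Un_rules T_sums(4,5) ext_paths4_def sum.neutral_const add_0_right
  by (intro add_mono order_refl sum_mono dsum2_mono dsum3_mono dsum4_mono
    fill_p4_0 fill_p4_1 fill_p4_2 fill_p4_3 fill_p4_01 fill_p4_02 fill_p4_03 fill_p4_12 fill_p4_13 fill_p4_23 fill_p4_012 fill_p4_013 fill_p4_023 fill_p4_123)

definition ext_paths3 :: int where
  "ext_paths3 = paths3 V
    + dsum2 V (\<lambda>x y. 2 * e x y)
    + dsum2 V (\<lambda>x y. 2 - e x y)
    + dsum2 V (\<lambda>x y. 2 * e x y)
    + (\<Sum>x\<in>V. 4)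
    + (\<Sum>x\<in>V. 2)
    + (\<Sum>x\<in>V. 4)
    + 6"

lemma paths3_ext_le: "paths3 (V \<union> T) \<le> ext_paths3"
  unfolding paths3_def Un_rules T_sums(4,5) ext_paths3_def sum.neutral_const add_0_right
  by (intro add_mono order_refl sum_mono dsum2_mono dsum3_mono dsum4_mono
    fill_p3_0 fill_p3_1 fill_p3_2 fill_p3_01 fill_p3_02 fill_p3_12 fill_p3_012)

definition ext_triangles :: int where
  "ext_triangles = triangles V
    + dsum2 V (\<lambda>x y. e x y)
    + dsum2 V (\<lambda>x y. e x y)
    + dsum2 V (\<lambda>x y. e x y)
    + (\<Sum>x\<in>V. 2)
    + (\<Sum>x\<in>V. 2)
    + (\<Sum>x\<in>V. 2)
    + 6"

lemma triangles_ext_le: "triangles (V \<union> T) \<le> ext_triangles"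
  unfolding triangles_def Un_rules T_sums(4,5) ext_triangles_def sum.neutral_const add_0_right
  by (intro add_mono order_refl sum_mono dsum2_mono dsum3_mono dsum4_mono
    fill_k3_0 fill_k3_1 fill_k3_2 fill_k3_01 fill_k3_02 fill_k3_12 fill_k3_012)

definition ext_arcs :: int where
  "ext_arcs = arcs V
    + (\<Sum>x\<in>V. 2)
    + (\<Sum>x\<in>V. 2)
    + 6"

lemma arcs_ext_le: "arcs (V \<union> T) \<le> ext_arcs"
  unfolding arcs_def Un_rules T_sums(4,5) ext_arcs_def sum.neutral_const add_0_right
  by (intro add_mono order_refl sum_mono dsum2_mono dsum3_mono dsum4_mono
    fill_p2_0 fill_p2_1 fill_p2_01)

lemma ext_arcs_eval: "ext_arcs = arcs V + 4 * m + 6"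
  by (simp add: ext_arcs_def)

lemma ext_triangles_eval: "ext_triangles = triangles V + 3 * arcs V + 6 * m + 6"
  by (simp add: ext_triangles_def arcs_def)

lemma ext_paths3_eval: "ext_paths3 = paths3 V + 3 * arcs V + 2 * m * (m - 1) + 10 * m + 6"
  unfolding ext_paths3_def dsum_linear free_rules
  by (simp add: arcs_def)

lemma ext_paths4_eval: "ext_paths4 = paths4 V + 2 * paths3 V + 4 * (m - 2) * arcs V + 10 * arcs V
    + 6 * m * (m - 1) + 12 * m
    - dsum3 V (\<lambda>x y z. e y z * bad x y) - dsum3 V (\<lambda>x y z. e x y * bad y z) - dsum2 V bad"
  unfolding ext_paths4_def dsum_linear free_rules
  by (simp add: arcs_def paths3_def algebra_simps)

text \<open>The coefficient of \<open>paths3 V\<close> collects \<open>4 * (m - 3)\<close> from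
  positions 1 and 3, whose patterns leave one end of the path free, \<open>-8\<close> from the
  disjoint edges, and \<open>6\<close> from the patterns with two vertices in \<open>T\<close>. It
  is nonnegative once \<open>m \<ge> 4\<close>, which makes the bound monotone in all counts. The
  last bracket is the quantity that \<open>bad_pairs_absorbed\<close> shows to be at most 0.\<close>

lemma ext_paths5_eval: "ext_paths5 = paths5 V + paths4 V + (4 * m - 14) * paths3 V
    + 2 * arcs V * arcs V - 4 * arcs V + 12 * (m - 2) * arcs V + 18 * arcs V + 4 * triangles V
    + 2 * m * (m - 1) * (m - 2) + 6 * m * (m - 1)
    + (4 * dsum3 V (\<lambda>x y z. e x y * e y z * bad x z) + 4 * dsum2 V bad
       - dsum4 V (\<lambda>x y z w. e x y * e z w * bad y z))"
  unfolding ext_paths5_def dsum_linear free_rules disjoint_edges[OF finV]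
  by (simp add: arcs_def paths3_def triangles_def paths4_def algebra_simps)

lemma card_ext: "card (V \<union> T) = card V + 3"
  using finV distinct_T notin_V by (subst card_Un_disjoint) auto

lemma bad_nonneg: "bad x y \<ge> 0" and bad_adj: "adj x y \<Longrightarrow> bad x y = 0"
  by (simp_all add: bad_def)

lemma ext_paths4_le: "ext_paths4 \<le> paths4 V + 2 * paths3 V + (4 * m + 2) * arcs V + 6 * m * (m - 1) + 12 * m"
proof -
  have "0 \<le> dsum3 V (\<lambda>x y z. e y z * bad x y)" "0 \<le> dsum3 V (\<lambda>x y z. e x y * bad y z)" "0 \<le> dsum2 V bad"
    unfolding dsum3_def dsum2_def by (intro sum_nonneg mult_nonneg_nonneg bad_nonneg; simp)+
  then show ?thesis
    unfolding ext_paths4_eval by (simp add: algebra_simps)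
qed

lemma ext_paths5_le:
  assumes "\<And>x. x \<in> V \<Longrightarrow> deg V x \<ge> 6"
  shows "ext_paths5 \<le> paths5 V + paths4 V + (4 * m - 14) * paths3 V
    + arcs V * (2 * arcs V + 12 * m - 10) + 4 * triangles V
    + 2 * m * (m - 1) * (m - 2) + 6 * m * (m - 1)"
  using bad_pairs_absorbed[OF finV assms bad_nonneg bad_adj]
  unfolding ext_paths5_eval by (simp add: algebra_simps)

end

section \<open>The equality case: complete 3-partite graphs\<close>

text \<open>Together with \<open>lim\<close>, every vertex of \<open>V\<close> misses exactly one
  vertex of \<open>T\<close>, and two of them are adjacent exactly when they miss different ones. So
  \<open>V\<close> and \<open>T\<close> form a complete 3-partite graph with \<open>T\<close> as a
  transversal. The same rules serve the Turan graph and any graph with as many edges.\<close>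

locale perfect_ext = triple_ext adj V t1 t2 t3 for adj :: "'a \<Rightarrow> 'a \<Rightarrow> bool" and V t1 t2 t3 +
  assumes triangle: "adj t1 t2" "adj t1 t3" "adj t2 t3"
    and full: "x \<in> V \<Longrightarrow> adj x t1 \<and> adj x t2 \<or> adj x t1 \<and> adj x t3 \<or> adj x t2 \<and> adj x t3"
    and sep: "x \<in> V \<Longrightarrow> y \<in> V \<Longrightarrow>
      adj x y \<longleftrightarrow> \<not> ((adj x t1 \<longleftrightarrow> adj y t1) \<and> (adj x t2 \<longleftrightarrow> adj y t2) \<and> (adj x t3 \<longleftrightarrow> adj y t3))"
begin

lemma full_cases: "x \<in> V \<Longrightarrow>
   adj x t1 \<and> adj x t2 \<and> \<not> adj x t3 \<or> adj x t1 \<and> \<not> adj x t2 \<and> adj x t3 \<or>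
   \<not> adj x t1 \<and> adj x t2 \<and> adj x t3"
  using lim[of x] full[of x] by auto

lemma bad_eq_0: "x \<in> V \<Longrightarrow> y \<in> V \<Longrightarrow> bad x y = 0"
  using sep[of x y] full_cases[of x] by (auto simp: bad_def)

text \<open>In this and the following lemmas the bounds are attained because two vertices of
  \<open>V\<close> either miss the same vertex of \<open>T\<close> and share two neighbours there,
  or miss different ones and share exactly one.\<close>

lemma fill_eq_p5_0:
  assumes "x \<in> V" "y \<in> V" "z \<in> V" "w \<in> V"
  shows "(\<Sum>s\<in>T. e s x * e x y * e y z * e z w) = 2 * (e x y * e y z * e z w)"
  using full_cases[OF assms(1)]
  apply (elim disjE)
  using assms sep[OF assms(1) assms(2)] sep[OF assms(2) assms(3)] sep[OF assms(3) assms(4)]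
  by (simp_all add: T_sums T_sym bad_def triangle split: split_of_bool)

lemma fill_eq_p5_1:
  assumes "x \<in> V" "y \<in> V" "z \<in> V" "w \<in> V"
  shows "(\<Sum>s\<in>T. e x s * e s y * e y z * e z w) = 2 * (e y z * e z w) - e x y * e y z * e z w"
  using full_cases[OF assms(1)]
  apply (elim disjE; use full_cases[OF assms(2)] in \<open>elim disjE\<close>)
  using assms sep[OF assms(1) assms(2)] sep[OF assms(2) assms(3)] sep[OF assms(3) assms(4)]
  by (simp_all add: T_sums T_sym bad_def triangle split: split_of_bool)

lemma fill_eq_p5_2:
  assumes "x \<in> V" "y \<in> V" "z \<in> V" "w \<in> V"
  shows "(\<Sum>s\<in>T. e x y * e y s * e s z * e z w) = 2 * (e x y * e z w) - e x y * e y z * e z w - e x y * e z w * bad y z"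
  using full_cases[OF assms(2)]
  apply (elim disjE; use full_cases[OF assms(3)] in \<open>elim disjE\<close>)
  using assms sep[OF assms(1) assms(2)] sep[OF assms(2) assms(3)] sep[OF assms(3) assms(4)]
  by (simp_all add: T_sums T_sym bad_def triangle split: split_of_bool)

lemma fill_eq_p5_3:
  assumes "x \<in> V" "y \<in> V" "z \<in> V" "w \<in> V"
  shows "(\<Sum>s\<in>T. e x y * e y z * e z s * e s w) = 2 * (e x y * e y z) - e x y * e y z * e z w"
  using full_cases[OF assms(3)]
  apply (elim disjE; use full_cases[OF assms(4)] in \<open>elim disjE\<close>)
  using assms sep[OF assms(1) assms(2)] sep[OF assms(2) assms(3)] sep[OF assms(3) assms(4)]
  by (simp_all add: T_sums T_sym bad_def triangle split: split_of_bool)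

lemma fill_eq_p5_4:
  assumes "x \<in> V" "y \<in> V" "z \<in> V" "w \<in> V"
  shows "(\<Sum>s\<in>T. e x y * e y z * e z w * e w s) = 2 * (e x y * e y z * e z w)"
  using full_cases[OF assms(4)]
  apply (elim disjE)
  using assms sep[OF assms(1) assms(2)] sep[OF assms(2) assms(3)] sep[OF assms(3) assms(4)]
  by (simp_all add: T_sums T_sym bad_def triangle split: split_of_bool)

lemma fill_eq_p5_01:
  assumes "x \<in> V" "y \<in> V" "z \<in> V"
  shows "dsum2 T (\<lambda>s t. e s t * e t x * e x y * e y z) = 4 * (e x y * e y z)"
  using full_cases[OF assms(1)]
  apply (elim disjE)
  using assms sep[OF assms(1) assms(2)] sep[OF assms(2) assms(3)]
  by (simp_all add: T_sums T_sym bad_def triangle split: split_of_bool)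

lemma fill_eq_p5_02:
  assumes "x \<in> V" "y \<in> V" "z \<in> V"
  shows "dsum2 T (\<lambda>s t. e s x * e x t * e t y * e y z) = 2 * e y z - e x y * e y z - e y z * bad x y"
  using full_cases[OF assms(1)]
  apply (elim disjE; use full_cases[OF assms(2)] in \<open>elim disjE\<close>)
  using assms sep[OF assms(1) assms(2)] sep[OF assms(2) assms(3)]
  by (simp_all add: T_sums T_sym bad_def triangle split: split_of_bool)

lemma fill_eq_p5_03:
  assumes "x \<in> V" "y \<in> V" "z \<in> V"
  shows "dsum2 T (\<lambda>s t. e s x * e x y * e y t * e t z) = 3 * e x y - 2 * (e x y * e y z) + e x y * e y z * e x z + e x y * e y z * bad x z"
  using full_cases[OF assms(1)]
  apply (elim disjE; use full_cases[OF assms(2)] in \<open>elim disjE\<close>; use full_cases[OF assms(3)] in \<open>elim disjE\<close>)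
  using assms sep[OF assms(1) assms(2)] sep[OF assms(1) assms(3)] sep[OF assms(2) assms(3)]
  by (simp_all add: T_sums T_sym bad_def triangle split: split_of_bool)

lemma fill_eq_p5_04:
  assumes "x \<in> V" "y \<in> V" "z \<in> V"
  shows "dsum2 T (\<lambda>s t. e s x * e x y * e y z * e z t) = 2 * (e x y * e y z) + e x y * e y z * e x z + e x y * e y z * bad x z"
  using full_cases[OF assms(1)]
  apply (elim disjE; use full_cases[OF assms(3)] in \<open>elim disjE\<close>)
  using assms sep[OF assms(1) assms(2)] sep[OF assms(1) assms(3)] sep[OF assms(2) assms(3)]
  by (simp_all add: T_sums T_sym bad_def triangle split: split_of_bool)

lemma fill_eq_p5_12:
  assumes "x \<in> V" "y \<in> V" "z \<in> V"
  shows "dsum2 T (\<lambda>s t. e x s * e s t * e t y * e y z) = 2 * e y z + e x y * e y z + e y z * bad x y"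
  using full_cases[OF assms(1)]
  apply (elim disjE; use full_cases[OF assms(2)] in \<open>elim disjE\<close>)
  using assms sep[OF assms(1) assms(2)] sep[OF assms(2) assms(3)]
  by (simp_all add: T_sums T_sym bad_def triangle split: split_of_bool)

lemma fill_eq_p5_13:
  assumes "x \<in> V" "y \<in> V" "z \<in> V"
  shows "dsum2 T (\<lambda>s t. e x s * e s y * e y t * e t z) = 2 - e x y - e y z + e x y * e y z * e x z + e x y * e y z * bad x z"
  using full_cases[OF assms(1)]
  apply (elim disjE; use full_cases[OF assms(2)] in \<open>elim disjE\<close>; use full_cases[OF assms(3)] in \<open>elim disjE\<close>)
  using assms sep[OF assms(1) assms(2)] sep[OF assms(1) assms(3)] sep[OF assms(2) assms(3)]
  by (simp_all add: T_sums T_sym bad_def triangle split: split_of_bool)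

lemma fill_eq_p5_14:
  assumes "x \<in> V" "y \<in> V" "z \<in> V"
  shows "dsum2 T (\<lambda>s t. e x s * e s y * e y z * e z t) = 3 * e y z - 2 * (e x y * e y z) + e x y * e y z * e x z + e x y * e y z * bad x z"
  using full_cases[OF assms(1)]
  apply (elim disjE; use full_cases[OF assms(2)] in \<open>elim disjE\<close>; use full_cases[OF assms(3)] in \<open>elim disjE\<close>)
  using assms sep[OF assms(1) assms(2)] sep[OF assms(1) assms(3)] sep[OF assms(2) assms(3)]
  by (simp_all add: T_sums T_sym bad_def triangle split: split_of_bool)

lemma fill_eq_p5_23:
  assumes "x \<in> V" "y \<in> V" "z \<in> V"
  shows "dsum2 T (\<lambda>s t. e x y * e y s * e s t * e t z) = 2 * e x y + e x y * e y z + e x y * bad y z"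
  using full_cases[OF assms(2)]
  apply (elim disjE; use full_cases[OF assms(3)] in \<open>elim disjE\<close>)
  using assms sep[OF assms(1) assms(2)] sep[OF assms(2) assms(3)]
  by (simp_all add: T_sums T_sym bad_def triangle split: split_of_bool)

lemma fill_eq_p5_24:
  assumes "x \<in> V" "y \<in> V" "z \<in> V"
  shows "dsum2 T (\<lambda>s t. e x y * e y s * e s z * e z t) = 2 * e x y - e x y * e y z - e x y * bad y z"
  using full_cases[OF assms(2)]
  apply (elim disjE; use full_cases[OF assms(3)] in \<open>elim disjE\<close>)
  using assms sep[OF assms(1) assms(2)] sep[OF assms(2) assms(3)]
  by (simp_all add: T_sums T_sym bad_def triangle split: split_of_bool)

lemma fill_eq_p5_34:
  assumes "x \<in> V" "y \<in> V" "z \<in> V"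
  shows "dsum2 T (\<lambda>s t. e x y * e y z * e z s * e s t) = 4 * (e x y * e y z)"
  using full_cases[OF assms(3)]
  apply (elim disjE)
  using assms sep[OF assms(1) assms(2)] sep[OF assms(2) assms(3)]
  by (simp_all add: T_sums T_sym bad_def triangle split: split_of_bool)

lemma fill_eq_p5_012:
  assumes "x \<in> V" "y \<in> V"
  shows "dsum3 T (\<lambda>s t u. e s t * e t u * e u x * e x y) = 4 * e x y"
  using full_cases[OF assms(1)]
  apply (elim disjE)
  using assms sep[OF assms(1) assms(2)]
  by (simp_all add: T_sums T_sym bad_def triangle split: split_of_bool)

lemma fill_eq_p5_013:
  assumes "x \<in> V" "y \<in> V"
  shows "dsum3 T (\<lambda>s t u. e s t * e t x * e x u * e u y) = 2 - e x y - bad x y"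
  using full_cases[OF assms(1)]
  apply (elim disjE; use full_cases[OF assms(2)] in \<open>elim disjE\<close>)
  using assms sep[OF assms(1) assms(2)]
  by (simp_all add: T_sums T_sym bad_def triangle split: split_of_bool)

lemma fill_eq_p5_014:
  assumes "x \<in> V" "y \<in> V"
  shows "dsum3 T (\<lambda>s t u. e s t * e t x * e x y * e y u) = 3 * e x y"
  using full_cases[OF assms(1)]
  apply (elim disjE; use full_cases[OF assms(2)] in \<open>elim disjE\<close>)
  using assms sep[OF assms(1) assms(2)]
  by (simp_all add: T_sums T_sym bad_def triangle split: split_of_bool)

lemma fill_eq_p5_023:
  assumes "x \<in> V" "y \<in> V"
  shows "dsum3 T (\<lambda>s t u. e s x * e x t * e t u * e u y) = 2 * e x y + 2 * bad x y"
  using full_cases[OF assms(1)]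
  apply (elim disjE; use full_cases[OF assms(2)] in \<open>elim disjE\<close>)
  using assms sep[OF assms(1) assms(2)]
  by (simp_all add: T_sums T_sym bad_def triangle split: split_of_bool)

lemma fill_eq_p5_024:
  assumes "x \<in> V" "y \<in> V"
  shows "dsum3 T (\<lambda>s t u. e s x * e x t * e t y * e y u) = e x y + bad x y"
  using full_cases[OF assms(1)]
  apply (elim disjE; use full_cases[OF assms(2)] in \<open>elim disjE\<close>)
  using assms sep[OF assms(1) assms(2)]
  by (simp_all add: T_sums T_sym bad_def triangle split: split_of_bool)

lemma fill_eq_p5_034:
  assumes "x \<in> V" "y \<in> V"
  shows "dsum3 T (\<lambda>s t u. e s x * e x y * e y t * e t u) = 3 * e x y"
  using full_cases[OF assms(1)]
  apply (elim disjE; use full_cases[OF assms(2)] in \<open>elim disjE\<close>)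
  using assms sep[OF assms(1) assms(2)]
  by (simp_all add: T_sums T_sym bad_def triangle split: split_of_bool)

lemma fill_eq_p5_123:
  assumes "x \<in> V" "y \<in> V"
  shows "dsum3 T (\<lambda>s t u. e x s * e s t * e t u * e u y) = 2 + e x y + bad x y"
  using full_cases[OF assms(1)]
  apply (elim disjE; use full_cases[OF assms(2)] in \<open>elim disjE\<close>)
  using assms sep[OF assms(1) assms(2)]
  by (simp_all add: T_sums T_sym bad_def triangle split: split_of_bool)

lemma fill_eq_p5_124:
  assumes "x \<in> V" "y \<in> V"
  shows "dsum3 T (\<lambda>s t u. e x s * e s t * e t y * e y u) = 2 * e x y + 2 * bad x y"
  using full_cases[OF assms(1)]
  apply (elim disjE; use full_cases[OF assms(2)] in \<open>elim disjE\<close>)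
  using assms sep[OF assms(1) assms(2)]
  by (simp_all add: T_sums T_sym bad_def triangle split: split_of_bool)

lemma fill_eq_p5_134:
  assumes "x \<in> V" "y \<in> V"
  shows "dsum3 T (\<lambda>s t u. e x s * e s y * e y t * e t u) = 2 - e x y - bad x y"
  using full_cases[OF assms(1)]
  apply (elim disjE; use full_cases[OF assms(2)] in \<open>elim disjE\<close>)
  using assms sep[OF assms(1) assms(2)]
  by (simp_all add: T_sums T_sym bad_def triangle split: split_of_bool)

lemma fill_eq_p5_234:
  assumes "x \<in> V" "y \<in> V"
  shows "dsum3 T (\<lambda>s t u. e x y * e y s * e s t * e t u) = 4 * e x y"
  using full_cases[OF assms(2)]
  apply (elim disjE)
  using assms sep[OF assms(1) assms(2)]
  by (simp_all add: T_sums T_sym bad_def triangle split: split_of_bool)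

lemma fill_eq_p4_0:
  assumes "x \<in> V" "y \<in> V" "z \<in> V"
  shows "(\<Sum>s\<in>T. e s x * e x y * e y z) = 2 * (e x y * e y z)"
  using full_cases[OF assms(1)]
  apply (elim disjE)
  using assms sep[OF assms(1) assms(2)] sep[OF assms(2) assms(3)]
  by (simp_all add: T_sums T_sym bad_def triangle split: split_of_bool)

lemma fill_eq_p4_1:
  assumes "x \<in> V" "y \<in> V" "z \<in> V"
  shows "(\<Sum>s\<in>T. e x s * e s y * e y z) = 2 * e y z - e x y * e y z - e y z * bad x y"
  using full_cases[OF assms(1)]
  apply (elim disjE; use full_cases[OF assms(2)] in \<open>elim disjE\<close>)
  using assms sep[OF assms(1) assms(2)] sep[OF assms(2) assms(3)]
  by (simp_all add: T_sums T_sym bad_def triangle split: split_of_bool)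

lemma fill_eq_p4_2:
  assumes "x \<in> V" "y \<in> V" "z \<in> V"
  shows "(\<Sum>s\<in>T. e x y * e y s * e s z) = 2 * e x y - e x y * e y z - e x y * bad y z"
  using full_cases[OF assms(2)]
  apply (elim disjE; use full_cases[OF assms(3)] in \<open>elim disjE\<close>)
  using assms sep[OF assms(1) assms(2)] sep[OF assms(2) assms(3)]
  by (simp_all add: T_sums T_sym bad_def triangle split: split_of_bool)

lemma fill_eq_p4_3:
  assumes "x \<in> V" "y \<in> V" "z \<in> V"
  shows "(\<Sum>s\<in>T. e x y * e y z * e z s) = 2 * (e x y * e y z)"
  using full_cases[OF assms(3)]
  apply (elim disjE)
  using assms sep[OF assms(1) assms(2)] sep[OF assms(2) assms(3)]
  by (simp_all add: T_sums T_sym bad_def triangle split: split_of_bool)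

lemma fill_eq_p4_01:
  assumes "x \<in> V" "y \<in> V"
  shows "dsum2 T (\<lambda>s t. e s t * e t x * e x y) = 4 * e x y"
  using full_cases[OF assms(1)]
  apply (elim disjE)
  using assms sep[OF assms(1) assms(2)]
  by (simp_all add: T_sums T_sym bad_def triangle split: split_of_bool)

lemma fill_eq_p4_02:
  assumes "x \<in> V" "y \<in> V"
  shows "dsum2 T (\<lambda>s t. e s x * e x t * e t y) = 2 - e x y - bad x y"
  using full_cases[OF assms(1)]
  apply (elim disjE; use full_cases[OF assms(2)] in \<open>elim disjE\<close>)
  using assms sep[OF assms(1) assms(2)]
  by (simp_all add: T_sums T_sym bad_def triangle split: split_of_bool)

lemma fill_eq_p4_03:
  assumes "x \<in> V" "y \<in> V"
  shows "dsum2 T (\<lambda>s t. e s x * e x y * e y t) = 3 * e x y"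
  using full_cases[OF assms(1)]
  apply (elim disjE; use full_cases[OF assms(2)] in \<open>elim disjE\<close>)
  using assms sep[OF assms(1) assms(2)]
  by (simp_all add: T_sums T_sym bad_def triangle split: split_of_bool)

lemma fill_eq_p4_12:
  assumes "x \<in> V" "y \<in> V"
  shows "dsum2 T (\<lambda>s t. e x s * e s t * e t y) = 2 + e x y + bad x y"
  using full_cases[OF assms(1)]
  apply (elim disjE; use full_cases[OF assms(2)] in \<open>elim disjE\<close>)
  using assms sep[OF assms(1) assms(2)]
  by (simp_all add: T_sums T_sym bad_def triangle split: split_of_bool)

lemma fill_eq_p4_13:
  assumes "x \<in> V" "y \<in> V"
  shows "dsum2 T (\<lambda>s t. e x s * e s y * e y t) = 2 - e x y - bad x y"
  using full_cases[OF assms(1)]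
  apply (elim disjE; use full_cases[OF assms(2)] in \<open>elim disjE\<close>)
  using assms sep[OF assms(1) assms(2)]
  by (simp_all add: T_sums T_sym bad_def triangle split: split_of_bool)

lemma fill_eq_p4_23:
  assumes "x \<in> V" "y \<in> V"
  shows "dsum2 T (\<lambda>s t. e x y * e y s * e s t) = 4 * e x y"
  using full_cases[OF assms(2)]
  apply (elim disjE)
  using assms sep[OF assms(1) assms(2)]
  by (simp_all add: T_sums T_sym bad_def triangle split: split_of_bool)

lemma fill_eq_p4_012:
  assumes "x \<in> V"
  shows "dsum3 T (\<lambda>s t u. e s t * e t u * e u x) = 4"
  using full_cases[OF assms(1)]
  apply (elim disjE)
  using assms
  by (simp_all add: T_sums T_sym bad_def triangle split: split_of_bool)

lemma fill_eq_p4_013: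
  assumes "x \<in> V"
  shows "dsum3 T (\<lambda>s t u. e s t * e t x * e x u) = 2"
  using full_cases[OF assms(1)]
  apply (elim disjE)
  using assms
  by (simp_all add: T_sums T_sym bad_def triangle split: split_of_bool)

lemma fill_eq_p4_023:
  assumes "x \<in> V"
  shows "dsum3 T (\<lambda>s t u. e s x * e x t * e t u) = 2"
  using full_cases[OF assms(1)]
  apply (elim disjE)
  using assms
  by (simp_all add: T_sums T_sym bad_def triangle split: split_of_bool)

lemma fill_eq_p4_123:
  assumes "x \<in> V"
  shows "dsum3 T (\<lambda>s t u. e x s * e s t * e t u) = 4"
  using full_cases[OF assms(1)]
  apply (elim disjE)
  using assms
  by (simp_all add: T_sums T_sym bad_def triangle split: split_of_bool)

lemma fill_eq_p3_0:
  assumes "x \<in> V" "y \<in> V"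
  shows "(\<Sum>s\<in>T. e s x * e x y) = 2 * e x y"
  using full_cases[OF assms(1)]
  apply (elim disjE)
  using assms sep[OF assms(1) assms(2)]
  by (simp_all add: T_sums T_sym bad_def triangle split: split_of_bool)

lemma fill_eq_p3_1:
  assumes "x \<in> V" "y \<in> V"
  shows "(\<Sum>s\<in>T. e x s * e s y) = 2 - e x y"
  using full_cases[OF assms(1)]
  apply (elim disjE; use full_cases[OF assms(2)] in \<open>elim disjE\<close>)
  using assms sep[OF assms(1) assms(2)]
  by (simp_all add: T_sums T_sym bad_def triangle split: split_of_bool)

lemma fill_eq_p3_2:
  assumes "x \<in> V" "y \<in> V"
  shows "(\<Sum>s\<in>T. e x y * e y s) = 2 * e x y"
  using full_cases[OF assms(2)]
  apply (elim disjE)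
  using assms sep[OF assms(1) assms(2)]
  by (simp_all add: T_sums T_sym bad_def triangle split: split_of_bool)

lemma fill_eq_p3_01:
  assumes "x \<in> V"
  shows "dsum2 T (\<lambda>s t. e s t * e t x) = 4"
  using full_cases[OF assms(1)]
  apply (elim disjE)
  using assms
  by (simp_all add: T_sums T_sym bad_def triangle split: split_of_bool)

lemma fill_eq_p3_02:
  assumes "x \<in> V"
  shows "dsum2 T (\<lambda>s t. e s x * e x t) = 2"
  using full_cases[OF assms(1)]
  apply (elim disjE)
  using assms
  by (simp_all add: T_sums T_sym bad_def triangle split: split_of_bool)

lemma fill_eq_p3_12:
  assumes "x \<in> V"
  shows "dsum2 T (\<lambda>s t. e x s * e s t) = 4"
  using full_cases[OF assms(1)]
  apply (elim disjE)
  using assms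
  by (simp_all add: T_sums T_sym bad_def triangle split: split_of_bool)

lemma fill_eq_p3_012:
  shows "dsum3 T (\<lambda>s t u. e s t * e t u) = 6"
  by (simp_all add: T_sums T_sym bad_def triangle split: split_of_bool)

lemma fill_eq_k3_0:
  assumes "x \<in> V" "y \<in> V"
  shows "(\<Sum>s\<in>T. e s x * e x y * e s y) = e x y"
  using full_cases[OF assms(1)]
  apply (elim disjE; use full_cases[OF assms(2)] in \<open>elim disjE\<close>)
  using assms sep[OF assms(1) assms(2)]
  by (simp_all add: T_sums T_sym bad_def triangle split: split_of_bool)

lemma fill_eq_k3_1:
  assumes "x \<in> V" "y \<in> V"
  shows "(\<Sum>s\<in>T. e x s * e s y * e x y) = e x y"
  using full_cases[OF assms(1)]
  apply (elim disjE; use full_cases[OF assms(2)] in \<open>elim disjE\<close>)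
  using assms sep[OF assms(1) assms(2)]
  by (simp_all add: T_sums T_sym bad_def triangle split: split_of_bool)

lemma fill_eq_k3_2:
  assumes "x \<in> V" "y \<in> V"
  shows "(\<Sum>s\<in>T. e x y * e y s * e x s) = e x y"
  using full_cases[OF assms(1)]
  apply (elim disjE; use full_cases[OF assms(2)] in \<open>elim disjE\<close>)
  using assms sep[OF assms(1) assms(2)]
  by (simp_all add: T_sums T_sym bad_def triangle split: split_of_bool)

lemma fill_eq_k3_01:
  assumes "x \<in> V"
  shows "dsum2 T (\<lambda>s t. e s t * e t x * e s x) = 2"
  using full_cases[OF assms(1)]
  apply (elim disjE)
  using assms
  by (simp_all add: T_sums T_sym bad_def triangle split: split_of_bool)

lemma fill_eq_k3_02:
  assumes "x \<in> V"
  shows "dsum2 T (\<lambda>s t. e s x * e x t * e s t) = 2"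
  using full_cases[OF assms(1)]
  apply (elim disjE)
  using assms
  by (simp_all add: T_sums T_sym bad_def triangle split: split_of_bool)

lemma fill_eq_k3_12:
  assumes "x \<in> V"
  shows "dsum2 T (\<lambda>s t. e x s * e s t * e x t) = 2"
  using full_cases[OF assms(1)]
  apply (elim disjE)
  using assms
  by (simp_all add: T_sums T_sym bad_def triangle split: split_of_bool)

lemma fill_eq_k3_012:
  shows "dsum3 T (\<lambda>s t u. e s t * e t u * e s u) = 6"
  by (simp_all add: T_sums T_sym bad_def triangle split: split_of_bool)

lemma fill_eq_p2_0:
  assumes "x \<in> V"
  shows "(\<Sum>s\<in>T. e s x) = 2"
  using full_cases[OF assms(1)]
  apply (elim disjE)
  using assms
  by (simp_all add: T_sums T_sym bad_def triangle split: split_of_bool)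

lemma fill_eq_p2_1:
  assumes "x \<in> V"
  shows "(\<Sum>s\<in>T. e x s) = 2"
  using full_cases[OF assms(1)]
  apply (elim disjE)
  using assms
  by (simp_all add: T_sums T_sym bad_def triangle split: split_of_bool)

lemma fill_eq_p2_01:
  shows "dsum2 T (\<lambda>s t. e s t) = 6"
  by (simp_all add: T_sums T_sym bad_def triangle split: split_of_bool)

lemma paths5_ext_eq: "paths5 (V \<union> T) = ext_paths5"
  unfolding paths5_def Un_rules T_sums(4,5) ext_paths5_def sum.neutral_const add_0_right
  by (intro arg_cong2[where f="(+)"] refl sum.cong dsum2_cong dsum3_cong dsum4_cong
    fill_eq_p5_0 fill_eq_p5_1 fill_eq_p5_2 fill_eq_p5_3 fill_eq_p5_4 fill_eq_p5_01 fill_eq_p5_02 fill_eq_p5_03 fill_eq_p5_04 fill_eq_p5_12 fill_eq_p5_13 fill_eq_p5_14 fill_eq_p5_23 fill_eq_p5_24 fill_eq_p5_34 fill_eq_p5_012 fill_eq_p5_013 fill_eq_p5_014 fill_eq_p5_023 fill_eq_p5_024 fill_eq_p5_034 fill_eq_p5_123 fill_eq_p5_124 fill_eq_p5_134 fill_eq_p5_234)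

lemma paths4_ext_eq: "paths4 (V \<union> T) = ext_paths4"
  unfolding paths4_def Un_rules T_sums(4,5) ext_paths4_def sum.neutral_const add_0_right
  by (intro arg_cong2[where f="(+)"] refl sum.cong dsum2_cong dsum3_cong dsum4_cong
    fill_eq_p4_0 fill_eq_p4_1 fill_eq_p4_2 fill_eq_p4_3 fill_eq_p4_01 fill_eq_p4_02 fill_eq_p4_03 fill_eq_p4_12 fill_eq_p4_13 fill_eq_p4_23 fill_eq_p4_012 fill_eq_p4_013 fill_eq_p4_023 fill_eq_p4_123)

lemma paths3_ext_eq: "paths3 (V \<union> T) = ext_paths3"
  unfolding paths3_def Un_rules T_sums(4,5) ext_paths3_def sum.neutral_const add_0_right
  by (intro arg_cong2[where f="(+)"] refl sum.cong dsum2_cong dsum3_cong dsum4_cong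
    fill_eq_p3_0 fill_eq_p3_1 fill_eq_p3_2 fill_eq_p3_01 fill_eq_p3_02 fill_eq_p3_12 fill_eq_p3_012)

lemma triangles_ext_eq: "triangles (V \<union> T) = ext_triangles"
  unfolding triangles_def Un_rules T_sums(4,5) ext_triangles_def sum.neutral_const add_0_right
  by (intro arg_cong2[where f="(+)"] refl sum.cong dsum2_cong dsum3_cong dsum4_cong
    fill_eq_k3_0 fill_eq_k3_1 fill_eq_k3_2 fill_eq_k3_01 fill_eq_k3_02 fill_eq_k3_12 fill_eq_k3_012)

lemma arcs_ext_eq: "arcs (V \<union> T) = ext_arcs"
  unfolding arcs_def Un_rules T_sums(4,5) ext_arcs_def sum.neutral_const add_0_right
  by (intro arg_cong2[where f="(+)"] refl sum.cong dsum2_cong dsum3_cong dsum4_cong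
    fill_eq_p2_0 fill_eq_p2_1 fill_eq_p2_01)

lemma bad_sums_0:
  "dsum2 V bad = 0" "dsum3 V (\<lambda>x y z. f x y z * bad x y) = 0"
  "dsum3 V (\<lambda>x y z. f x y z * bad y z) = 0" "dsum3 V (\<lambda>x y z. f x y z * bad x z) = 0"
  "dsum4 V (\<lambda>x y z w. g x y z w * bad y z) = 0"
  unfolding dsum4_def dsum3_def dsum2_def by (simp_all add: bad_eq_0)

lemma counts_ext:
  "arcs (V \<union> T) = arcs V + 4 * m + 6"
  "triangles (V \<union> T) = triangles V + 3 * arcs V + 6 * m + 6"
  "paths3 (V \<union> T) = paths3 V + 3 * arcs V + 2 * m * (m - 1) + 10 * m + 6"
  "paths4 (V \<union> T) = paths4 V + 2 * paths3 V + (4 * m + 2) * arcs V + 6 * m * (m - 1) + 12 * m"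
  "paths5 (V \<union> T) = paths5 V + paths4 V + (4 * m - 14) * paths3 V
    + arcs V * (2 * arcs V + 12 * m - 10) + 4 * triangles V
    + 2 * m * (m - 1) * (m - 2) + 6 * m * (m - 1)"
proof -
  show "arcs (V \<union> T) = arcs V + 4 * m + 6"
    by (simp only: arcs_ext_eq ext_arcs_eval)
  show "triangles (V \<union> T) = triangles V + 3 * arcs V + 6 * m + 6"
    by (simp only: triangles_ext_eq ext_triangles_eval)
  show "paths3 (V \<union> T) = paths3 V + 3 * arcs V + 2 * m * (m - 1) + 10 * m + 6"
    by (simp only: paths3_ext_eq ext_paths3_eval)
  show "paths4 (V \<union> T) = paths4 V + 2 * paths3 V + (4 * m + 2) * arcs V + 6 * m * (m - 1) + 12 * m"
    unfolding paths4_ext_eq ext_paths4_eval bad_sums_0 by (simp add: algebra_simps)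
  show "paths5 (V \<union> T) = paths5 V + paths4 V + (4 * m - 14) * paths3 V
    + arcs V * (2 * arcs V + 12 * m - 10) + 4 * triangles V
    + 2 * m * (m - 1) * (m - 2) + 6 * m * (m - 1)"
    unfolding paths5_ext_eq ext_paths5_eval bad_sums_0 by (simp add: algebra_simps)
qed

end

section \<open>Choosing the triple to remove\<close>

context sgraph
begin

text \<open>Distinctness of the four vertices is not stated, since \<open>adj_irrefl\<close>
  enforces it.\<close>

definition K4_free :: "'a set \<Rightarrow> bool" where
  "K4_free V \<longleftrightarrow> (\<forall>a\<in>V. \<forall>b\<in>V. \<forall>c\<in>V. \<forall>d\<in>V.
     \<not> (adj a b \<and> adj a c \<and> adj a d \<and> adj b c \<and> adj b d \<and> adj c d))"

lemma K4_freeD: "K4_free V \<Longrightarrow> a \<in> V \<Longrightarrow> b \<in> V \<Longrightarrow> c \<in> V \<Longrightarrow> d \<in> V \<Longrightarrow>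
    adj a b \<Longrightarrow> adj a c \<Longrightarrow> adj a d \<Longrightarrow> adj b c \<Longrightarrow> adj b d \<Longrightarrow> adj c d \<Longrightarrow> False"
  unfolding K4_free_def by blast

lemma K4_free_subset: "K4_free V \<Longrightarrow> W \<subseteq> V \<Longrightarrow> K4_free W"
  unfolding K4_free_def by (meson subsetD)

text \<open>The removed triple is a triangle if there is one; otherwise an edge with any third vertex
  will do.\<close>

lemma triple_exists:
  assumes "finite V" "K4_free V" "card V \<ge> 3"
  obtains W t1 t2 t3 where "V = W \<union> {t1, t2, t3}" "triple_ext adj W t1 t2 t3"
proof -
  note obtained = that
  have ext: thesis
    if t: "a \<in> V" "b \<in> V" "c \<in> V" "a \<noteq> b" "a \<noteq> c" "b \<noteq> c"
      and lim: "\<And>x. x \<in> V \<Longrightarrow> \<not> (adj x a \<and> adj x b \<and> adj x c)"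
      and cmn: "\<And>x y. x \<in> V \<Longrightarrow> y \<in> V \<Longrightarrow> adj x y \<Longrightarrow> \<not> (adj x a \<and> adj x b \<and> adj y a \<and> adj y b)"
        "\<And>x y. x \<in> V \<Longrightarrow> y \<in> V \<Longrightarrow> adj x y \<Longrightarrow> \<not> (adj x a \<and> adj x c \<and> adj y a \<and> adj y c)"
        "\<And>x y. x \<in> V \<Longrightarrow> y \<in> V \<Longrightarrow> adj x y \<Longrightarrow> \<not> (adj x b \<and> adj x c \<and> adj y b \<and> adj y c)"
    for a b c
  proof (rule obtained)
    show "V = (V - {a, b, c}) \<union> {a, b, c}" using t by auto
    show "triple_ext adj (V - {a, b, c}) a b c"
    proof
      show "finite (V - {a, b, c})" using assms(1) by simp
      fix x assume x: "x \<in> V - {a, b, c}"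
      then show "\<not> (adj x a \<and> adj x b \<and> adj x c)" using lim by blast
      fix y assume y: "y \<in> V - {a, b, c}"
      from x y have "x \<in> V" "y \<in> V" by auto
      note * = cmn[OF this]
      show "\<not> (adj x y \<and> adj x a \<and> adj x b \<and> adj y a \<and> adj y b) \<and>
        \<not> (adj x y \<and> adj x a \<and> adj x c \<and> adj y a \<and> adj y c) \<and>
        \<not> (adj x y \<and> adj x b \<and> adj x c \<and> adj y b \<and> adj y c)"
        using * by blast
    qed (use t in auto)
  qed
  show thesis
  proof (cases "\<exists>a\<in>V. \<exists>b\<in>V. \<exists>c\<in>V. adj a b \<and> adj a c \<and> adj b c")
    case True
    then obtain a b c where abc: "a \<in> V" "b \<in> V" "c \<in> V" "adj a b" "adj a c" "adj b c" by blast
    have K: "\<not> (adj x u \<and> adj x v \<and> adj y u \<and> adj y v)"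
      if "x \<in> V" "y \<in> V" "adj x y" "u \<in> V" "v \<in> V" "adj u v" for x y u v
      using K4_freeD[OF assms(2) that(1,2,4,5,3)] that(6) by blast
    show ?thesis
    proof (rule ext[OF abc(1-3)])
      show "a \<noteq> b" "a \<noteq> c" "b \<noteq> c" using abc(4-6) adj_irrefl by blast+
      show "\<not> (adj x a \<and> adj x b \<and> adj x c)" if "x \<in> V" for x
        using K4_freeD[OF assms(2) that abc(1-3)] abc(4-6) by blast
    qed (rule K; (assumption | rule abc))+
  next
    case False
    then have tf: "\<not> (adj a b \<and> adj a c \<and> adj b c)" if "a \<in> V" "b \<in> V" "c \<in> V" for a b c
      using that by blast
    \<comment> \<open>In a triangle-free graph only \<open>lim\<close> can fail, when some vertex
      sees three independent ones. An edge \<open>a b\<close> in the triple excludes this; if there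
      are no edges, any pair will do.\<close>
    have "\<exists>a b. a \<in> V \<and> b \<in> V \<and> a \<noteq> b \<and> (adj a b \<or> (\<forall>x\<in>V. \<forall>y\<in>V. \<not> adj x y))"
    proof (cases "\<exists>x\<in>V. \<exists>y\<in>V. adj x y")
      case True
      then obtain x y where "x \<in> V" "y \<in> V" "adj x y" by blast
      moreover from this have "x \<noteq> y" using adj_irrefl by blast
      ultimately show ?thesis by blast
    next
      case False
      have "\<not> card V \<le> 1" using assms(3) by simp
      then obtain a b where "a \<in> V" "b \<in> V" "a \<noteq> b"
        using card_le_Suc0_iff_eq[OF assms(1)] by auto
      then show ?thesis using False by blast
    qed
    then obtain a b where ab: "a \<in> V" "b \<in> V" "a \<noteq> b" "adj a b \<or> (\<forall>x\<in>V. \<forall>y\<in>V. \<not> adj x y)"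
      by blast
    have "\<not> V \<subseteq> {a, b}"
    proof
      assume "V \<subseteq> {a, b}"
      then have "card V \<le> card {a, b}" by (intro card_mono) auto
      then show False using assms(3) ab(3) by simp
    qed
    then obtain c where c: "c \<in> V" "c \<noteq> a" "c \<noteq> b" by blast
    show ?thesis
    proof (rule ext[OF ab(1,2) c(1) ab(3) c(2)[symmetric] c(3)[symmetric]])
      show "\<not> (adj x a \<and> adj x b \<and> adj x c)" if "x \<in> V" for x
        using tf[OF that ab(1,2)] ab that by blast
    qed (use tf ab c in blast)+
  qed
qed

lemma triple_induct [consumes 2, case_names small ext]:
  assumes "finite V" "K4_free V"
    and "\<And>V. finite V \<Longrightarrow> card V < 3 \<Longrightarrow> P V"
    and "\<And>V t1 t2 t3. triple_ext adj V t1 t2 t3 \<Longrightarrow> K4_free V \<Longrightarrow> P V \<Longrightarrow> P (V \<union> {t1, t2, t3})"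
  shows "P V"
  using assms(1,2)
proof (induction "card V" arbitrary: V rule: less_induct)
  case less
  show ?case
  proof (cases "card V < 3")
    case False
    then obtain W t1 t2 t3 where W: "V = W \<union> {t1, t2, t3}" "triple_ext adj W t1 t2 t3"
      using triple_exists less.prems by (metis not_less)
    interpret triple_ext adj W t1 t2 t3 by (rule W(2))
    have "K4_free W" using less.prems(2) W(1) K4_free_subset by blast
    moreover have "P W"
      using less.hyps[of W] finV \<open>K4_free W\<close> card_ext W(1) by simp
    ultimately show ?thesis using assms(4) W by blast
  qed (use assms(3) less.prems in blast)
qed

end

subsection \<open>Comparison with the Turan graph\<close>

text \<open>A single adjacency on all natural numbers has the Turan graphs of every order as its
  initial segments, so the counts for different \<open>n\<close> refer to the same relation.\<close>

interpretation turan: sgraph "\<lambda>x y :: nat. x mod 3 \<noteq> y mod 3"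
  by unfold_locales auto

text \<open>Three consecutive numbers represent each residue modulo 3 once, so going from
  \<open>n\<close> to \<open>n + 3\<close> vertices adds a transversal. The counts of the Turan
  graph therefore satisfy with equality the recurrences that bound those of other graphs.\<close>

lemma perfect_ext_turan: "perfect_ext (\<lambda>x y. x mod 3 \<noteq> y mod 3) {..<n} n (n + 1) (n + 2)" for n :: nat
proof -
  define a b c where abc: "a = n mod 3" "b = (n + 1) mod 3" "c = (n + 2) mod 3"
  have "a < 3" unfolding abc by simp
  moreover have "b = (if a = 2 then 0 else a + 1)" "c = (if a = 2 then 1 else if a = 1 then 0 else a + 2)"
    unfolding abc by (simp_all add: mod_Suc numeral_2_eq_2)
  ultimately have abc': "a = 0 \<and> b = 1 \<and> c = 2 \<or> a = 1 \<and> b = 2 \<and> c = 0 \<or> a = 2 \<and> b = 0 \<and> c = 1"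
    by (auto split: if_splits)
  then have ne: "a \<noteq> b" "a \<noteq> c" "b \<noteq> c"
    by auto
  have cases: "x mod 3 = a \<or> x mod 3 = b \<or> x mod 3 = c" for x :: nat
  proof -
    have "x mod 3 < 3" by simp
    then have "x mod 3 = 0 \<or> x mod 3 = 1 \<or> x mod 3 = 2" by linarith
    then show ?thesis using abc' by (elim disjE) simp_all
  qed
  show ?thesis
  proof (unfold_locales, unfold abc[symmetric])
    fix x y :: nat
    define p q where "p = x mod 3" and "q = y mod 3"
    then have pq: "p = a \<or> p = b \<or> p = c" "q = a \<or> q = b \<or> q = c"
      using cases by auto
    show "x mod 3 \<noteq> y mod 3 \<longleftrightarrow> \<not> ((x mod 3 \<noteq> a \<longleftrightarrow> y mod 3 \<noteq> a) \<and>
      (x mod 3 \<noteq> b \<longleftrightarrow> y mod 3 \<noteq> b) \<and> (x mod 3 \<noteq> c \<longleftrightarrow> y mod 3 \<noteq> c))"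
      unfolding p_def[symmetric] q_def[symmetric] using pq ne by (elim disjE) simp_all
    show "x mod 3 \<noteq> a \<and> x mod 3 \<noteq> b \<or> x mod 3 \<noteq> a \<and> x mod 3 \<noteq> c \<or> x mod 3 \<noteq> b \<and> x mod 3 \<noteq> c"
      unfolding p_def[symmetric] using pq(1) ne by (elim disjE) simp_all
    show "\<not> (x mod 3 \<noteq> a \<and> x mod 3 \<noteq> b \<and> x mod 3 \<noteq> c)"
      unfolding p_def[symmetric] using pq(1) by (elim disjE) simp_all
    show "\<not> (x mod 3 \<noteq> y mod 3 \<and> x mod 3 \<noteq> a \<and> x mod 3 \<noteq> b \<and> y mod 3 \<noteq> a \<and> y mod 3 \<noteq> b) \<and>
      \<not> (x mod 3 \<noteq> y mod 3 \<and> x mod 3 \<noteq> a \<and> x mod 3 \<noteq> c \<and> y mod 3 \<noteq> a \<and> y mod 3 \<noteq> c) \<and>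
      \<not> (x mod 3 \<noteq> y mod 3 \<and> x mod 3 \<noteq> b \<and> x mod 3 \<noteq> c \<and> y mod 3 \<noteq> b \<and> y mod 3 \<noteq> c)"
      unfolding p_def[symmetric] q_def[symmetric] using pq ne by (elim disjE) simp_all
  qed (use ne in auto)
qed

lemma turan_lessThan: "{..<n + 3} = {..<n} \<union> {n, n + 1, n + 2 :: nat}"
  by auto

lemmas turan_rec = perfect_ext.counts_ext[OF perfect_ext_turan, folded turan_lessThan, simplified card_lessThan]

lemma turan_arcs_small: "n < 3 \<Longrightarrow> turan.arcs {..<n} = int n * (int n - 1)"
proof -
  assume "n < 3"
  then consider "n = 0" | "n = 1" | "n = 2" by linarith
  then show ?thesis
    by cases (auto simp: turan.arcs_def dsum2_def lessThan_Suc numeral_2_eq_2 insert_Diff_if)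
qed

section \<open>Turan bounds for the smaller counts\<close>

context sgraph
begin

lemma arcs_nonneg: "arcs V \<ge> 0"
  unfolding arcs_def dsum2_def by (intro sum_nonneg) simp

lemma small_counts:
  assumes "finite V" "card V < 3"
  shows "triangles V = 0" "paths3 V = 0" "paths4 V = 0" "paths5 V = 0"
  using assms unfolding triangles_def paths3_def paths4_def paths5_def
  by (simp_all add: dsum3_small dsum4_small dsum5_small)

lemma arcs_le_complete:
  assumes "finite V"
  shows "arcs V \<le> int (card V) * (int (card V) - 1)"
proof -
  have "arcs V \<le> dsum2 V (\<lambda>_ _. 1)"
    unfolding arcs_def by (rule dsum2_mono) simp
  then show ?thesis using assms by (simp add: dsum2_const)
qed

text \<open>Turan's theorem for K_4. A triple adds at most as many arcs as it does in the Turan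
  graph, and below three vertices the Turan graph is complete.\<close>

lemma arcs_le_turan: "finite V \<Longrightarrow> K4_free V \<Longrightarrow> arcs V \<le> turan.arcs {..<card V}"
proof (induction V rule: triple_induct)
  case (small V)
  then show ?case using arcs_le_complete turan_arcs_small by simp
next
  case (ext V t1 t2 t3)
  interpret triple_ext adj V t1 t2 t3 by (rule ext(1))
  show ?case
    using arcs_ext_le ext(3) unfolding ext_arcs_eval card_ext turan_rec by simp
qed

lemma triangles_le_turan: "finite V \<Longrightarrow> K4_free V \<Longrightarrow> triangles V \<le> turan.triangles {..<card V}"
proof (induction V rule: triple_induct)
  case (small V)
  then show ?case by (simp add: small_counts turan.small_counts)
next
  case (ext V t1 t2 t3)
  interpret triple_ext adj V t1 t2 t3 by (rule ext(1))
  show ?case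
    using triangles_ext_le ext(3) arcs_le_turan[OF finV ext(2)]
    unfolding ext_triangles_eval card_ext turan_rec by simp
qed

lemma paths3_le_turan: "finite V \<Longrightarrow> K4_free V \<Longrightarrow> paths3 V \<le> turan.paths3 {..<card V}"
proof (induction V rule: triple_induct)
  case (small V)
  then show ?case by (simp add: small_counts turan.small_counts)
next
  case (ext V t1 t2 t3)
  interpret triple_ext adj V t1 t2 t3 by (rule ext(1))
  show ?case
    using paths3_ext_le ext(3) arcs_le_turan[OF finV ext(2)]
    unfolding ext_paths3_eval card_ext turan_rec by simp
qed

text \<open>The increment is monotone in \<open>paths3 V\<close> and \<open>arcs V\<close>, so the
  bounds already proved for these carry the induction.\<close>

lemma paths4_le_turan: "finite V \<Longrightarrow> K4_free V \<Longrightarrow> paths4 V \<le> turan.paths4 {..<card V}"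
proof (induction V rule: triple_induct)
  case (small V)
  then show ?case by (simp add: small_counts turan.small_counts)
next
  case (ext V t1 t2 t3)
  interpret triple_ext adj V t1 t2 t3 by (rule ext(1))
  have "(4 * m + 2) * arcs V \<le> (4 * m + 2) * turan.arcs {..<card V}"
    using arcs_le_turan[OF finV ext(2)] by (intro mult_left_mono) auto
  then show ?case
    using paths4_ext_le ext_paths4_le ext(3) paths3_le_turan[OF finV ext(2)]
    unfolding card_ext turan_rec by linarith
qed

text \<open>Uniqueness in Turan's theorem is needed only in this form: equality for the edges forces
  equality in every count. The last conjunct carries the structure through the induction.\<close>

lemma turan_extremal:
  assumes "finite V" "K4_free V" "arcs V = turan.arcs {..<card V}"
  shows "triangles V = turan.triangles {..<card V} \<and> paths3 V = turan.paths3 {..<card V} \<and>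
    paths4 V = turan.paths4 {..<card V} \<and> paths5 V = turan.paths5 {..<card V} \<and>
    (\<forall>x\<in>V. \<forall>y\<in>V. x \<noteq> y \<longrightarrow> \<not> adj x y \<longrightarrow>
      (\<exists>z\<in>V. \<exists>w\<in>V. adj z w \<and> adj x z \<and> adj x w \<and> adj y z \<and> adj y w))"
  using assms
proof (induction V rule: triple_induct)
  case (small V)
  \<comment> \<open>On at most two vertices the Turan graph is complete, so equality of arcs makes
    \<open>V\<close> complete and the last conjunct vacuous.\<close>
  have "adj x y" if "x \<in> V" "y \<in> V" "x \<noteq> y" for x y
  proof (rule ccontr)
    assume "\<not> adj x y"
    have "card {x, y} \<le> card V" using that small(1) by (intro card_mono) auto
    then have "card V = 2" using small(2) that by simp
    then have "V = {x, y}" using that small(1) by (intro card_subset_eq[symmetric]) auto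
    then have "arcs V = 0"
      using that \<open>\<not> adj x y\<close> adj_sym[of x y] by (simp add: arcs_def dsum2_def insert_Diff_if)
    then show False using small(3) turan_arcs_small[of 2] \<open>card V = 2\<close> by simp
  qed
  then show ?case using small by (auto simp: small_counts turan.small_counts)
next
  case (ext V t1 t2 t3)
  interpret triple_ext adj V t1 t2 t3 by (rule ext(1))
  have two: "(\<Sum>t\<in>T. e x t) \<le> 2" "(\<Sum>t\<in>T. e t x) \<le> 2" if "x \<in> V" for x
    using fill_p2_1[OF that] fill_p2_0[OF that] .
  have tot: "arcs V + (\<Sum>x\<in>V. \<Sum>t\<in>T. e x t) + (\<Sum>x\<in>V. \<Sum>t\<in>T. e t x) + dsum2 T (\<lambda>x y. e x y)
      = turan.arcs {..<card V} + 4 * m + 6"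
    using ext(4) unfolding card_ext turan_rec arcs_def Un_rules by simp
  have le: "arcs V \<le> turan.arcs {..<card V}" by (rule arcs_le_turan[OF finV ext(2)])
  have T6: "dsum2 T (\<lambda>x y. e x y) \<le> 6" by (rule fill_p2_01)
  have s: "(\<Sum>x\<in>V. \<Sum>t\<in>T. e x t) \<le> 2 * m" "(\<Sum>x\<in>V. \<Sum>t\<in>T. e t x) \<le> 2 * m"
    using sum_mono[of V "\<lambda>x. \<Sum>t\<in>T. e x t" "\<lambda>_. 2"] sum_mono[of V "\<lambda>x. \<Sum>t\<in>T. e t x" "\<lambda>_. 2"] two
    by auto
  \<comment> \<open>Each of the four summands of \<open>tot\<close> is at most its value in the
    Turan graph, so equality of the totals forces equality in each.\<close>
  have eqV: "arcs V = turan.arcs {..<card V}" and eqT: "dsum2 T (\<lambda>x y. e x y) = 6"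
    and eqS: "(\<Sum>x\<in>V. \<Sum>t\<in>T. e x t) = 2 * m"
    using tot le T6 s by linarith+
  have IH: "triangles V = turan.triangles {..<card V}" "paths3 V = turan.paths3 {..<card V}"
      "paths4 V = turan.paths4 {..<card V}" "paths5 V = turan.paths5 {..<card V}"
    and str: "\<And>x y. x \<in> V \<Longrightarrow> y \<in> V \<Longrightarrow> x \<noteq> y \<Longrightarrow> \<not> adj x y \<Longrightarrow>
      \<exists>z\<in>V. \<exists>w\<in>V. adj z w \<and> adj x z \<and> adj x w \<and> adj y z \<and> adj y w"
    using ext(3)[OF eqV] by simp_all
  have tri: "adj t1 t2" "adj t1 t3" "adj t2 t3"
    using eqT by (cases "adj t1 t2"; cases "adj t1 t3"; cases "adj t2 t3"; simp add: T_sums T_sym)+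
  have "(\<Sum>x\<in>V. 2 - (\<Sum>t\<in>T. e x t)) = 0"
    unfolding sum_subtractf eqS by simp
  moreover have "0 \<le> 2 - (\<Sum>t\<in>T. e x t)" if "x \<in> V" for x
    using two(1)[OF that] by linarith
  ultimately have "\<forall>x\<in>V. 2 - (\<Sum>t\<in>T. e x t) = 0"
    using sum_nonneg_eq_0_iff[OF finV, of "\<lambda>x. 2 - (\<Sum>t\<in>T. e x t)"] by blast
  then have eq2: "e x t1 + e x t2 + e x t3 = 2" if "x \<in> V" for x
    using that unfolding T_sums by auto
  have full: "adj x t1 \<and> adj x t2 \<and> \<not> adj x t3 \<or> adj x t1 \<and> \<not> adj x t2 \<and> adj x t3 \<or>
      \<not> adj x t1 \<and> adj x t2 \<and> adj x t3" if "x \<in> V" for x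
    using eq2[OF that] by (cases "adj x t1"; cases "adj x t2"; cases "adj x t3"; simp)
  let ?S = "\<lambda>x y. (adj x t1 \<longleftrightarrow> adj y t1) \<and> (adj x t2 \<longleftrightarrow> adj y t2) \<and> (adj x t3 \<longleftrightarrow> adj y t3)"
  have ndS: "\<not> ?S x y" if "x \<in> V" "y \<in> V" "adj x y" for x y
    using full[OF that(1)] full[OF that(2)] cmn[OF that(1,2)] that(3) by (elim disjE) simp_all
  \<comment> \<open>Both \<open>x\<close> and \<open>y\<close> are adjacent to \<open>z\<close> and
    \<open>w\<close>, which are adjacent to each other and hence miss different vertices of
    \<open>T\<close>. So \<open>x\<close> and \<open>y\<close> must both miss the third one.\<close>
  have S: "?S x y" if xy: "x \<in> V" "y \<in> V" "\<not> adj x y" for x y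
  proof (cases "x = y")
    case False
    then obtain z w where zw: "z \<in> V" "w \<in> V" "adj z w" "adj x z" "adj x w" "adj y z" "adj y w"
      using str[OF xy(1,2) False xy(3)] by blast
    show ?thesis
      using full[OF xy(1)] full[OF xy(2)] full[OF zw(1)] full[OF zw(2)]
        ndS[OF xy(1) zw(1,4)] ndS[OF xy(1) zw(2,5)] ndS[OF xy(2) zw(1,6)] ndS[OF xy(2) zw(2,7)]
        ndS[OF zw(1-3)] by (elim disjE) simp_all
  qed simp
  interpret perfect_ext adj V t1 t2 t3
  proof
    show "adj t1 t2" "adj t1 t3" "adj t2 t3" by (rule tri)+
    fix x assume x: "x \<in> V"
    show "adj x t1 \<and> adj x t2 \<or> adj x t1 \<and> adj x t3 \<or> adj x t2 \<and> adj x t3"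
      using full[OF x] by blast
    fix y assume y: "y \<in> V"
    show "adj x y \<longleftrightarrow> \<not> ?S x y" using S[OF x y] ndS[OF x y] by blast
  qed
  \<comment> \<open>A vertex of \<open>V\<close> not adjacent to \<open>y \<in> T\<close> is
    adjacent to the other two vertices of \<open>T\<close>, and these serve as \<open>z\<close> and
    \<open>w\<close>.\<close>
  have R: "\<exists>z\<in>V \<union> T. \<exists>w\<in>V \<union> T. adj z w \<and> adj x z \<and> adj x w \<and> adj y z \<and> adj y w"
    if xV: "x \<in> V" and y: "y \<in> V \<union> T" and "x \<noteq> y" "\<not> adj x y" for x y
  proof (cases "y \<in> V")
    case True
    then show ?thesis using str[OF xV True that(3,4)] by blast
  next
    case False
    then consider "y = t1" | "y = t2" | "y = t3" using y by blast
    then show ?thesis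
    proof cases
      case 1
      then show ?thesis using full[OF xV] tri that by blast
    next
      case 2
      then show ?thesis using full[OF xV] tri that adj_sym[of t1 t2] by blast
    next
      case 3
      then show ?thesis using full[OF xV] tri that adj_sym[of t1 t3] adj_sym[of t2 t3] by blast
    qed
  qed
  have R': "\<exists>z\<in>V \<union> T. \<exists>w\<in>V \<union> T. adj z w \<and> adj x z \<and> adj x w \<and> adj y z \<and> adj y w"
    if "x \<in> V \<union> T" "y \<in> V \<union> T" "x \<noteq> y" "\<not> adj x y" for x y
  proof (cases "x \<in> V \<or> y \<in> V")
    case True
    then show ?thesis
    proof
      assume "x \<in> V"
      then show ?thesis using R that by blast
    next
      assume "y \<in> V"
      then have "\<exists>z\<in>V \<union> T. \<exists>w\<in>V \<union> T. adj z w \<and> adj y z \<and> adj y w \<and> adj x z \<and> adj x w"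
        using R[of y x] that adj_sym[of x y] by simp
      then show ?thesis by blast
    qed
  next
    case False
    then have "x \<in> T" "y \<in> T" using that by auto
    then show ?thesis using that(3,4) tri adj_sym[of t1 t2] adj_sym[of t1 t3] adj_sym[of t2 t3] by auto
  qed
  show ?case
    unfolding card_ext turan_rec counts_ext IH eqV using R' by (intro conjI refl ballI impI)
qed

end

section \<open>Paths through a single vertex\<close>

context sgraph
begin

lemma paths5_insert:
  assumes "finite V" "v \<notin> V"
  shows "paths5 (V \<union> {v}) = paths5 V
    + dsum4 V (\<lambda>x y z w. e v x * e x y * e y z * e z w)
    + dsum4 V (\<lambda>x y z w. e x v * e v y * e y z * e z w)
    + dsum4 V (\<lambda>x y z w. e x y * e y v * e v z * e z w)
    + dsum4 V (\<lambda>x y z w. e x y * e y z * e z v * e v w)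
    + dsum4 V (\<lambda>x y z w. e x y * e y z * e z w * e w v)"
  unfolding paths5_def using assms
  by (subst dsum5_Un) (simp_all add: dsum2_small dsum3_small dsum4_small dsum5_small dsum_defs)

lemma dsum4_degree:
  assumes "finite V" "card V \<ge> 3"
  shows "dsum4 V (\<lambda>x y z w. e v x) \<le> deg V v * int (card V) ^ 3"
    "dsum4 V (\<lambda>x y z w. e v y) \<le> deg V v * int (card V) ^ 3"
    "dsum4 V (\<lambda>x y z w. e v w) \<le> deg V v * int (card V) ^ 3"
proof -
  let ?n = "int (card V)"
  have d0: "deg V v \<ge> 0" unfolding deg_def by (intro sum_nonneg) simp
  have 1: "dsum4 V (\<lambda>x y z w. e v x) = (?n - 3) * ((?n - 2) * ((?n - 1) * deg V v))"
    using assms(1) by (simp add: dsum4_free_last dsum3_free_last dsum2_free_last deg_def)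
  have 2: "dsum4 V (\<lambda>x y z w. e v y) = dsum4 V (\<lambda>x y z w. e v x)"
    using dsum4_swap12[OF assms(1), of "\<lambda>x y z w. e v x"] .
  have 3: "dsum4 V (\<lambda>x y z w. e v w) = (?n - 3) * ((?n - 2) * ((?n - 1) * deg V v))"
    using assms(1) by (simp add: dsum4_free_first dsum3_free_first dsum2_free_first deg_def)
  have "(?n - 3) * ((?n - 2) * ((?n - 1) * deg V v)) \<le> ?n * (?n * (?n * deg V v))"
    using assms(2) d0 by (intro mult_mono mult_nonneg_nonneg) auto
  then have "(?n - 3) * ((?n - 2) * ((?n - 1) * deg V v)) \<le> deg V v * ?n ^ 3"
    by (simp add: power3_eq_cube algebra_simps)
  then show "dsum4 V (\<lambda>x y z w. e v x) \<le> deg V v * ?n ^ 3"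
    "dsum4 V (\<lambda>x y z w. e v y) \<le> deg V v * ?n ^ 3" "dsum4 V (\<lambda>x y z w. e v w) \<le> deg V v * ?n ^ 3"
    using 1 2 3 by simp_all
qed

text \<open>Wherever \<open>v\<close> stands on the path, only one edge at \<open>v\<close> is
  retained from the summand. Each of the five positions then leaves one neighbour of
  \<open>v\<close> and three arbitrary vertices to choose.\<close>

lemma paths5_insert_le:
  assumes "finite V" "v \<notin> V" "card V \<ge> 3"
  shows "paths5 (V \<union> {v}) \<le> paths5 V + 5 * (deg V v * int (card V) ^ 3)"
proof -
  note d = dsum4_degree[OF assms(1,3), of v]
  have "dsum4 V (\<lambda>x y z w. e v x * e x y * e y z * e z w) \<le> dsum4 V (\<lambda>x y z w. e v x)"
    "dsum4 V (\<lambda>x y z w. e x v * e v y * e y z * e z w) \<le> dsum4 V (\<lambda>x y z w. e v y)"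
    "dsum4 V (\<lambda>x y z w. e x y * e y v * e v z * e z w) \<le> dsum4 V (\<lambda>x y z w. e v y)"
    "dsum4 V (\<lambda>x y z w. e x y * e y z * e z v * e v w) \<le> dsum4 V (\<lambda>x y z w. e v w)"
    "dsum4 V (\<lambda>x y z w. e x y * e y z * e z w * e w v) \<le> dsum4 V (\<lambda>x y z w. e v w)"
    by (intro dsum4_mono; simp add: adj_sym split: split_of_bool)+
  then show ?thesis
    using d unfolding paths5_insert[OF assms(1,2)] by linarith
qed

end

text \<open>Tuples alternating between \<open>A\<close> and \<open>B\<close> have at least
  \<open>k\<close>, \<open>k\<close>, \<open>k - 1\<close> and \<open>k - 1\<close> choices for
  their successive entries; all other tuples contribute nonnegatively.\<close>

lemma dsum4_bipartite_ge:
  assumes "finite V" "A \<subseteq> V" "B \<subseteq> V" "A \<inter> B = {}" "int (card A) \<ge> k" "int (card B) \<ge> k" "k \<ge> 1"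
    and f: "\<And>x y z w. f x y z w \<ge> 0"
    and f1: "\<And>x y z w. x \<in> A \<Longrightarrow> y \<in> B \<Longrightarrow> z \<in> A \<Longrightarrow> w \<in> B \<Longrightarrow> f x y z w = 1"
  shows "dsum4 V f \<ge> k * (k * ((k - 1) * (k - 1)))"
proof -
  have fin: "finite A" "finite B" using assms finite_subset by auto
  have c1: "int (card (A - {x})) \<ge> k - 1" for x
    using assms(5) fin by (cases "x \<in> A") (simp_all add: int_card_Diff del: card_Diff_insert)
  have c2: "int (card (B - {x})) \<ge> k - 1" for x
    using assms(6) fin by (cases "x \<in> B") (simp_all add: int_card_Diff del: card_Diff_insert)
  have 4: "k - 1 \<le> sum (f x y z) (V - {x} - {y} - {z})" if "x \<in> A" "y \<in> B" "z \<in> A - {x}" for x y z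
  proof -
    have "k - 1 \<le> (\<Sum>w\<in>B - {y}. f x y z w)" using f1[of x y z] that c2[of y] by simp
    also have "\<dots> \<le> sum (f x y z) (V - {x} - {y} - {z})"
      using assms that f by (intro sum_mono2) auto
    finally show ?thesis .
  qed
  have 3: "(k - 1) * (k - 1) \<le> dsum2 (V - {x} - {y}) (f x y)" if "x \<in> A" "y \<in> B" for x y
  proof -
    have "(k - 1) * (k - 1) \<le> int (card (A - {x})) * (k - 1)"
      using assms(7) c1 by (intro mult_right_mono) auto
    also have "\<dots> \<le> (\<Sum>z\<in>A - {x}. sum (f x y z) (V - {x} - {y} - {z}))"
      using sum_mono[of "A - {x}" "\<lambda>_. k - 1", OF 4[OF that]] by simp
    also have "\<dots> \<le> dsum2 (V - {x} - {y}) (f x y)"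
      unfolding dsum2_def using assms that f by (intro sum_mono2 sum_nonneg) auto
    finally show ?thesis .
  qed
  have k2: "0 \<le> (k - 1) * (k - 1)" by simp
  have 2: "k * ((k - 1) * (k - 1)) \<le> dsum3 (V - {x}) (f x)" if "x \<in> A" for x
  proof -
    have "k * ((k - 1) * (k - 1)) \<le> int (card B) * ((k - 1) * (k - 1))"
      using k2 assms(6) by (intro mult_right_mono) auto
    also have "\<dots> \<le> (\<Sum>y\<in>B. dsum2 (V - {x} - {y}) (f x y))"
      using sum_mono[of B "\<lambda>_. (k - 1) * (k - 1)", OF 3[OF that]] by simp
    also have "\<dots> \<le> dsum3 (V - {x}) (f x)"
      unfolding dsum3_def dsum2_def using assms that f by (intro sum_mono2 sum_nonneg) auto
    finally show ?thesis .
  qed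
  have "k * (k * ((k - 1) * (k - 1))) \<le> int (card A) * (k * ((k - 1) * (k - 1)))"
    using k2 assms(5,7) by (intro mult_right_mono) auto
  also have "\<dots> \<le> (\<Sum>x\<in>A. dsum3 (V - {x}) (f x))"
    using sum_mono[of A "\<lambda>_. k * ((k - 1) * (k - 1))", OF 2] by simp
  also have "\<dots> \<le> dsum4 V f"
    unfolding dsum4_def dsum3_def dsum2_def using assms f by (intro sum_mono2 sum_nonneg) auto
  finally show ?thesis .
qed

lemma card_residue_class_ge: "i < 3 \<Longrightarrow> int (card {v. v < n \<and> v mod 3 = i}) \<ge> int (n div 3)"
proof -
  assume "i < 3"
  moreover have "\<lfloor>real n / 3\<rfloor> \<le> \<lceil>real n / 3\<rceil>" by (rule floor_le_ceiling)
  ultimately have "\<lfloor>real n / 3\<rfloor> \<le> int (card {v. v < n \<and> v mod 3 = i})"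
    using turan_class_size[of i 3 n] by (auto simp: turan_class_def)
  then show ?thesis using floor_divide_of_nat_eq[of n 3, where 'a=real] by simp
qed

text \<open>Paths that start at the new vertex and then alternate between the two other classes
  already number of order \<open>n ^ 4\<close>. The cubic term matches
  \<open>paths5_insert_le\<close> for degree 7, as \<open>35 = 5 * 7\<close>.\<close>

lemma turan_paths5_growth:
  assumes "n \<ge> 9003"
  shows "turan.paths5 {..<Suc n} \<ge> turan.paths5 {..<n} + 35 * int n ^ 3 + 1"
proof -
  let ?e = "\<lambda>x y :: nat. of_bool (x mod 3 \<noteq> y mod 3) :: int"
  let ?V = "{..<n}" and ?k = "int (n div 3)"
  let ?C = "\<lambda>i. {v. v < n \<and> v mod 3 = i}"
  define i j where "i = (n + 1) mod 3" and "j = (n + 2) mod 3"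
  have ij: "i < 3" "j < 3" "i \<noteq> j" "n mod 3 \<noteq> i" "n mod 3 \<noteq> j"
    unfolding i_def j_def by presburger+
  have "dsum4 ?V (\<lambda>x y z w. ?e n x * ?e x y * ?e y z * ?e z w) \<ge> ?k * (?k * ((?k - 1) * (?k - 1)))"
    by (rule dsum4_bipartite_ge[of _ "?C i" "?C j"]) (use ij assms card_residue_class_ge in auto)
  moreover have "turan.paths5 ({..<n} \<union> {n}) \<ge> turan.paths5 {..<n}
      + dsum4 ?V (\<lambda>x y z w. ?e n x * ?e x y * ?e y z * ?e z w)"
  proof -
    have nn: "dsum4 V f \<ge> 0" if "\<And>x y z w. f x y z w \<ge> 0" for V :: "nat set" and f
      unfolding dsum4_def dsum3_def dsum2_def by (intro sum_nonneg that)
    show ?thesis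
      by (subst turan.paths5_insert) (auto intro!: add_nonneg_nonneg nn)
  qed
  moreover have "{..<n} \<union> {n} = {..<Suc n}" by auto
  moreover have "?k * (?k * ((?k - 1) * (?k - 1))) \<ge> 35 * int n ^ 3 + 1"
  proof -
    \<comment> \<open>The threshold is \<open>9003 = 3 * 3001\<close>. By
      \<open>int n \<le> 4 * j\<close> the cubic term is at most \<open>35 * 64 = 2240\<close> times
      \<open>j ^ 3\<close>, and \<open>j \<ge> 3000\<close> leaves room for the added 1.\<close>
    have k: "?k \<ge> 3001" using assms by linarith
    define j where "j = ?k - 1"
    have "int n \<le> 3 * ?k + 2" by linarith
    then have "int n \<le> 4 * j" "j \<ge> 3000" using k unfolding j_def by simp_all
    then have "int n ^ 3 \<le> (4 * j) ^ 3" by (intro power_mono) auto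
    then have "35 * int n ^ 3 + 1 \<le> 2240 * j ^ 3 + 1" by (simp add: power_mult_distrib)
    also have "\<dots> \<le> 3000 * j ^ 3"
    proof -
      have "1 \<le> j ^ 3" using \<open>j \<ge> 3000\<close> by simp
      then show ?thesis by simp
    qed
    also have "\<dots> \<le> j * j ^ 3" using \<open>j \<ge> 3000\<close> by (intro mult_right_mono) auto
    also have "\<dots> = j * (j * (j * j))" by (simp add: power3_eq_cube)
    also have "\<dots> \<le> ?k * (?k * (j * j))"
      using \<open>j \<ge> 3000\<close> unfolding j_def by (intro mult_mono mult_nonneg_nonneg) auto
    finally show ?thesis unfolding j_def .
  qed
  ultimately show ?thesis by simp
qed

lemma dsum5_le_card:
  assumes "finite V" "int (card V) \<le> N" "\<And>x y z w v. f x y z w v \<le> 1"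
  shows "dsum5 V f \<le> N ^ 5"
proof -
  have s: "sum g A \<le> N * c" if "A \<subseteq> V" "\<And>x. x \<in> A \<Longrightarrow> g x \<le> c" "c \<ge> 0" for A c and g :: "'a \<Rightarrow> int"
  proof -
    have "sum g A \<le> int (card A) * c" using sum_bounded_above[of A g c] that by simp
    also have "\<dots> \<le> N * c"
      using that card_mono[OF assms(1) that(1)] assms(2) by (intro mult_right_mono) auto
    finally show ?thesis .
  qed
  have N: "N \<ge> 0" using assms(2) by simp
  have "dsum5 V f \<le> N * (N * (N * (N * (N * 1))))"
    unfolding dsum5_def dsum4_def dsum3_def dsum2_def
    by (intro s assms(3) mult_nonneg_nonneg N; auto)
  then show ?thesis by (simp add: eval_nat_numeral)
qed

section \<open>The progressive induction\<close>

context sgraph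
begin

lemma paths5_nonneg: "paths5 V \<ge> 0"
  unfolding paths5_def dsum5_def dsum4_def dsum3_def dsum2_def by (intro sum_nonneg) simp

text \<open>The degree threshold 7 fits both cases. A vertex of degree at most 7 is removed alone,
  and \<open>9010\<close> leaves enough vertices for \<open>turan_paths5_growth\<close>. Otherwise
  all degrees are at least 8, and as \<open>T\<close> contains at most two neighbours of a vertex of
  \<open>W\<close>, the minimum degree in \<open>W\<close> is at least 6.\<close>

lemma progressive_step:
  assumes "finite V" "K4_free V" "card V \<ge> 9010"
  shows "paths5 V \<le> turan.paths5 {..<card V} \<or>
    (\<exists>W\<subseteq>V. card W < card V \<and> card V \<le> card W + 3 \<and>
      paths5 V - turan.paths5 {..<card V} + 1 \<le> paths5 W - turan.paths5 {..<card W})"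
proof (cases "\<exists>v\<in>V. deg V v \<le> 7")
  case True
  then obtain v where v: "v \<in> V" "deg V v \<le> 7" by blast
  then obtain W where W: "V = W \<union> {v}" "v \<notin> W"
    using mk_disjoint_insert[of v V] by auto
  have fin: "finite W" using assms(1) W(1) by simp
  have c: "card V = Suc (card W)" using fin W by simp
  have "deg W v \<le> deg V v"
    unfolding deg_def using assms(1) W(1) by (intro sum_mono2) auto
  then have "deg W v * int (card W) ^ 3 \<le> 7 * int (card W) ^ 3"
    using v(2) by (intro mult_right_mono) auto
  moreover have "card W \<ge> 3" using c assms(3) by simp
  ultimately have "paths5 V \<le> paths5 W + 35 * int (card W) ^ 3"
    using paths5_insert_le[OF fin W(2)] unfolding W(1) by linarith
  moreover have "turan.paths5 {..<card V} \<ge> turan.paths5 {..<card W} + 35 * int (card W) ^ 3 + 1"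
    using turan_paths5_growth[of "card W"] c assms(3) by simp
  ultimately have "paths5 V - turan.paths5 {..<card V} + 1 \<le> paths5 W - turan.paths5 {..<card W}"
    by linarith
  moreover have "W \<subseteq> V" "card W < card V" "card V \<le> card W + 3" using W(1) c by auto
  ultimately show ?thesis by blast
next
  case False
  have "card V \<ge> 3" using assms(3) by simp
  then obtain W t1 t2 t3 where W: "V = W \<union> {t1, t2, t3}" "triple_ext adj W t1 t2 t3"
    by (rule triple_exists[OF assms(1,2)])
  interpret triple_ext adj W t1 t2 t3 by (rule W(2))
  have K: "K4_free W" using K4_free_subset[OF assms(2)] W(1) by blast
  have c: "card V = card W + 3" using card_ext W(1) by simp
  have deg: "deg W x \<ge> 6" if "x \<in> W" for x
  proof -
    have "deg V x = deg W x + (\<Sum>t\<in>T. e x t)"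
      unfolding deg_def W(1) by (rule sum_Un_int[OF finV finT disjT])
    moreover have "deg V x \<ge> 8" using False that W(1) by force
    ultimately show ?thesis using fill_p2_1[OF that] by linarith
  qed
  let ?a = "arcs W" and ?a' = "turan.arcs {..<card W}"
  have le: "paths5 V \<le> paths5 W + paths4 W + (4 * m - 14) * paths3 W
    + ?a * (2 * ?a + 12 * m - 10) + 4 * triangles W + 2 * m * (m - 1) * (m - 2) + 6 * m * (m - 1)"
    using paths5_ext_le ext_paths5_le[OF deg] W(1) by simp
  have rec: "turan.paths5 {..<card V} = turan.paths5 {..<card W} + turan.paths4 {..<card W}
    + (4 * m - 14) * turan.paths3 {..<card W} + ?a' * (2 * ?a' + 12 * m - 10)
    + 4 * turan.triangles {..<card W} + 2 * m * (m - 1) * (m - 2) + 6 * m * (m - 1)"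
    unfolding c turan_rec ..
  have m: "m \<ge> 9007" using assms(3) c by simp
  have p3: "(4 * m - 14) * paths3 W \<le> (4 * m - 14) * turan.paths3 {..<card W}"
    using m paths3_le_turan[OF finV K] by (intro mult_left_mono) auto
  note bounds = p3 paths4_le_turan[OF finV K] triangles_le_turan[OF finV K]
  show ?thesis
  \<comment> \<open>The drop by 1 is taken from the number of arcs alone. If that agrees with the
    Turan graph, \<open>turan_extremal\<close> gives \<open>W\<close> excess 0 and the first
    alternative holds.\<close>
  proof (cases "?a = ?a'")
    case True
    then have "paths5 W = turan.paths5 {..<card W}"
      using turan_extremal[OF finV K] by blast
    then have "paths5 V \<le> turan.paths5 {..<card V}"
      using le bounds unfolding rec True by linarith
    then show ?thesis ..
  next
    case False
    then have a: "?a + 1 \<le> ?a'" using arcs_le_turan[OF finV K] by simp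
    have a0: "?a \<ge> 0" by (rule arcs_nonneg)
    \<comment> \<open>One missing arc costs the whole second factor, which is at least 1.\<close>
    have "?a * (2 * ?a + 12 * m - 10) + 1 \<le> (?a + 1) * (2 * ?a + 12 * m - 10)"
      using a0 m by (simp add: distrib_right)
    also have "\<dots> \<le> ?a' * (2 * ?a' + 12 * m - 10)"
      using a a0 m by (intro mult_mono) auto
    finally have "paths5 V - turan.paths5 {..<card V} + 1 \<le> paths5 W - turan.paths5 {..<card W}"
      using le bounds unfolding rec by linarith
    moreover have "W \<subseteq> V" "card W < card V" "card V \<le> card W + 3" using W(1) c by auto
    ultimately show ?thesis by blast
  qed
qed

text \<open>Three times the excess plus the number of vertices does not decrease in passing from
  \<open>V\<close> to the \<open>W\<close> of \<open>progressive_step\<close>: the excess rises by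
  at least 1 while at most three vertices go. Below \<open>9010\<close> vertices the excess is at
  most \<open>9010 ^ 5\<close>, a bound for the number of all 5-tuples; hence the constant.\<close>

lemma excess_bound:
  assumes "finite V" "K4_free V" "paths5 V > turan.paths5 {..<card V}"
  shows "3 * (paths5 V - turan.paths5 {..<card V}) + int (card V) \<le> 3 * 9010 ^ 5 + 9010"
  using assms
proof (induction "card V" arbitrary: V rule: less_induct)
  case less
  show ?case
  proof (cases "card V \<ge> 9010")
    case True
    then obtain W where W: "W \<subseteq> V" "card W < card V" "card V \<le> card W + 3"
      "paths5 V - turan.paths5 {..<card V} + 1 \<le> paths5 W - turan.paths5 {..<card W}"
      using progressive_step[OF less.prems(1,2)] less.prems(3) by auto
    have "3 * (paths5 W - turan.paths5 {..<card W}) + int (card W) \<le> 3 * 9010 ^ 5 + 9010"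
      using less.hyps[OF W(2)] less.prems W finite_subset K4_free_subset by auto
    moreover have "int (card V) \<le> int (card W) + 3" using W(3) by linarith
    ultimately show ?thesis using W(4) by simp
  next
    case False
    have "paths5 V \<le> 9010 ^ 5"
      unfolding paths5_def using less.prems(1) False by (intro dsum5_le_card) auto
    moreover have "int (card V) \<le> 9010" using False by simp
    ultimately show ?thesis using turan.paths5_nonneg[of "{..<card V}"] by simp
  qed
qed

lemma paths5_le_turan:
  assumes "finite V" "K4_free V" "int (card V) > 3 * 9010 ^ 5 + 9010"
  shows "paths5 V \<le> turan.paths5 {..<card V}"
proof (rule ccontr)
  assume "\<not> ?thesis"
  then show False using excess_bound[OF assms(1,2)] assms(3) by simp
qed

end

subsection \<open>Copies of the path as ordered tuples\<close>

lemma simple_graph_sgraph: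
  assumes "simple_graph G"
  shows "sgraph (\<lambda>x y. {x, y} \<in> edges G)"
proof
  show "{x, y} \<in> edges G \<longleftrightarrow> {y, x} \<in> edges G" for x y by (simp add: insert_commute)
  show "{x, x} \<notin> edges G" for x using assms by (auto simp: simple_graph_def)
qed

definition paths5_set :: "'a ugraph \<Rightarrow> ('a \<times> 'a \<times> 'a \<times> 'a \<times> 'a) set" where
  "paths5_set G = {(x, y, z, w, v). {x, y, z, w, v} \<subseteq> verts G \<and> distinct [x, y, z, w, v] \<and>
     {x, y} \<in> edges G \<and> {y, z} \<in> edges G \<and> {z, w} \<in> edges G \<and> {w, v} \<in> edges G}"

lemma card_paths5_set:
  assumes "simple_graph G"
  shows "int (card (paths5_set G)) = sgraph.paths5 (\<lambda>x y. {x, y} \<in> edges G) (verts G)"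
proof -
  interpret sgraph "\<lambda>x y. {x, y} \<in> edges G" by (rule simple_graph_sgraph[OF assms])
  let ?V = "verts G"
  let ?S = "SIGMA x:?V. SIGMA y:?V - {x}. SIGMA z:?V - {x} - {y}.
    SIGMA w:?V - {x} - {y} - {z}. ?V - {x} - {y} - {z} - {w}"
  have fin: "finite ?V" using assms by (simp add: simple_graph_def)
  have "paths5 ?V = (\<Sum>(x, y, z, w, v)\<in>?S. e x y * e y z * e z w * e w v)"
    unfolding paths5_def dsum5_def dsum4_def dsum3_def dsum2_def using fin
    by (simp add: sum.Sigma[symmetric])
  also have "\<dots> = (\<Sum>p\<in>?S. of_bool (p \<in> paths5_set G))"
    by (intro sum.cong refl) (auto simp: paths5_set_def)
  also have "\<dots> = int (card (?S \<inter> {p. p \<in> paths5_set G}))"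
    using fin by (subst sum_of_bool_eq) auto
  also have "?S \<inter> {p. p \<in> paths5_set G} = paths5_set G"
    by (auto simp: paths5_set_def)
  finally show ?thesis by simp
qed

fun path_copy :: "'a \<times> 'a \<times> 'a \<times> 'a \<times> 'a \<Rightarrow> 'a ugraph" where
  "path_copy (x, y, z, w, v) = \<lparr>verts = {x, y, z, w, v}, edges = {{x, y}, {y, z}, {z, w}, {w, v}}\<rparr>"

lemma path_graph_5: "path_graph 5 = path_copy (0, 1, 2, 3, 4)"
proof -
  have "{i. Suc i < 5} = {0, 1, 2, 3}" by auto
  then have "{{i, Suc i} | i. Suc i < 5} = (\<lambda>i. {i, Suc i}) ` {0, 1, 2, 3}" by blast
  moreover have "{..<5} = {0, 1, 2, 3, 4 :: nat}" by auto
  ultimately show ?thesis by (simp add: path_graph_def eval_nat_numeral)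
qed

text \<open>The edge set is accessed through neighbourhoods, which spares later arguments the
  comparison of sets of doubletons.\<close>

lemma path_copy_nbrs:
  assumes "distinct [x, y, z, w, v]"
  shows "{x, t} \<in> {{x, y}, {y, z}, {z, w}, {w, v}} \<longleftrightarrow> t = y"
    "{y, t} \<in> {{x, y}, {y, z}, {z, w}, {w, v}} \<longleftrightarrow> t = x \<or> t = z"
    "{z, t} \<in> {{x, y}, {y, z}, {z, w}, {w, v}} \<longleftrightarrow> t = y \<or> t = w"
    "{w, t} \<in> {{x, y}, {y, z}, {z, w}, {w, v}} \<longleftrightarrow> t = z \<or> t = v"
    "{v, t} \<in> {{x, y}, {y, z}, {z, w}, {w, v}} \<longleftrightarrow> t = w"
  using assms by (auto simp: doubleton_eq_iff)

text \<open>The end \<open>a\<close> of one path has the single neighbour \<open>b\<close>, so it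
  cannot be an inner vertex of the other, whose two neighbours would coincide. From an end onwards,
  each next vertex is the neighbour not yet visited, so only the two directions remain.\<close>

lemma path_copy_eq_iff:
  assumes d: "distinct [x, y, z, w, v]" and d': "distinct [a, b, c, d, u]"
  shows "path_copy (a, b, c, d, u) = path_copy (x, y, z, w, v) \<longleftrightarrow>
    (a, b, c, d, u) = (x, y, z, w, v) \<or> (a, b, c, d, u) = (v, w, z, y, x)"
proof
  assume eq: "path_copy (a, b, c, d, u) = path_copy (x, y, z, w, v)"
  define F where "F = {{x, y}, {y, z}, {z, w}, {w, v}}"
  have E: "{{a, b}, {b, c}, {c, d}, {d, u}} = F" and V: "a \<in> {x, y, z, w, v}"
    using eq unfolding F_def by auto
  note n = path_copy_nbrs[OF d, folded F_def]
  note n' = path_copy_nbrs[OF d', unfolded E]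
  from V consider "a = x" | "a = y" | "a = z" | "a = w" | "a = v" by blast
  then show "(a, b, c, d, u) = (x, y, z, w, v) \<or> (a, b, c, d, u) = (v, w, z, y, x)"
  proof cases
    case 1
    then have "b = y" using n(1)[of b] n'(1)[of b] by simp
    then have "c = z" using n(2)[of z] n'(2)[of z] 1 d by auto
    then have "d = w" using n(3)[of w] n'(3)[of w] \<open>b = y\<close> d by auto
    then have "u = v" using n(4)[of v] n'(4)[of v] \<open>c = z\<close> d by auto
    then show ?thesis using 1 \<open>b = y\<close> \<open>c = z\<close> \<open>d = w\<close> by simp
  next
    case 5
    then have "b = w" using n(5)[of b] n'(1)[of b] by simp
    then have "c = z" using n(4)[of z] n'(2)[of z] 5 d by auto
    then have "d = y" using n(3)[of y] n'(3)[of y] \<open>b = w\<close> d by auto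
    then have "u = x" using n(2)[of x] n'(4)[of x] \<open>c = z\<close> d by auto
    then show ?thesis using 5 \<open>b = w\<close> \<open>c = z\<close> \<open>d = y\<close> by simp
  next
    case 2
    then have "x = b" "z = b" using n(2)[of x] n'(1)[of x] n(2)[of z] n'(1)[of z] by simp_all
    then show ?thesis using d by simp
  next
    case 3
    then have "y = b" "w = b" using n(3)[of y] n'(1)[of y] n(3)[of w] n'(1)[of w] by simp_all
    then show ?thesis using d by simp
  next
    case 4
    then have "z = b" "v = b" using n(4)[of z] n'(1)[of z] n(4)[of v] n'(1)[of v] by simp_all
    then show ?thesis using d by simp
  qed
qed (auto simp: insert_commute)

lemma path_copy_isomorphic:
  assumes "distinct [x, y, z, w, v]"
  shows "isomorphic (path_copy (x, y, z, w, v)) (path_graph 5)"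
proof -
  let ?f = "\<lambda>u. if u = x then 0 else if u = y then 1 else if u = z then 2 else if u = w then 3 else 4 :: nat"
  have bij: "bij_betw ?f {x, y, z, w, v} {0, 1, 2, 3, 4}"
    using assms by (auto simp: bij_betw_def inj_on_def)
  have d: "distinct [0, 1, 2, 3, 4 :: nat]" by simp
  define F where "F = {{x, y}, {y, z}, {z, w}, {w, v}}"
  define F' :: "nat set set" where "F' = {{0, 1}, {1, 2}, {2, 3}, {3, 4}}"
  note n = path_copy_nbrs[OF assms, folded F_def] path_copy_nbrs[OF d, folded F'_def]
  have "{s, t} \<in> F \<longleftrightarrow> {?f s, ?f t} \<in> F'"
    if st: "s \<in> {x, y, z, w, v}" "t \<in> {x, y, z, w, v}" for s t
  proof -
    have f: "?f x = 0" "?f y = 1" "?f z = 2" "?f w = 3" "?f v = 4" using assms by auto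
    from st(1) consider "s = x" | "s = y" | "s = z" | "s = w" | "s = v" by blast
    then show ?thesis
    proof cases
      case 1
      show ?thesis unfolding 1 f n using assms st(2) by auto
    next
      case 2
      show ?thesis unfolding 2 f n using assms st(2) by auto
    next
      case 3
      show ?thesis unfolding 3 f n using assms st(2) by auto
    next
      case 4
      show ?thesis unfolding 4 f n using assms st(2) by auto
    next
      case 5
      show ?thesis unfolding 5 f n using assms st(2) by auto
    qed
  qed
  then show ?thesis
    unfolding isomorphic_def path_graph_5 path_copy.simps ugraph.simps F_def[symmetric] F'_def[symmetric]
    by (intro exI[of _ ?f] conjI bij) blast
qed

text \<open>The inverse of an isomorphism lists the vertices of a copy along the path. Since every
  edge of a subgraph is a pair of its vertices, this list determines the edge set as well.\<close>

lemma copies_path_graph_5: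
  assumes "simple_graph G"
  shows "copies (path_graph 5) G = path_copy ` paths5_set G"
proof (intro equalityI subsetI)
  fix S assume "S \<in> path_copy ` paths5_set G"
  then obtain p where "p \<in> paths5_set G" "S = path_copy p" by blast
  moreover obtain x y z w v where "p = (x, y, z, w, v)" by (rule prod_cases5)
  ultimately have p: "(x, y, z, w, v) \<in> paths5_set G" and S: "S = path_copy (x, y, z, w, v)"
    by simp_all
  then have "distinct [x, y, z, w, v]" by (simp add: paths5_set_def)
  then have "isomorphic S (path_graph 5)"
    unfolding S by (rule path_copy_isomorphic)
  moreover have "subgraph S G"
    using p unfolding S path_copy.simps subgraph_def simple_graph_def paths5_set_def by simp
  ultimately show "S \<in> copies (path_graph 5) G" by (simp add: copies_def)
next
  fix S assume "S \<in> copies (path_graph 5) G"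
  then have sub: "subgraph S G" and "isomorphic S (path_graph 5)"
    by (auto simp: copies_def)
  then obtain f where f0: "bij_betw f (verts S) (verts (path_graph 5)) \<and>
      (\<forall>u\<in>verts S. \<forall>v\<in>verts S. {u, v} \<in> edges S \<longleftrightarrow> {f u, f v} \<in> edges (path_graph 5))"
    unfolding isomorphic_def by blast
  define F :: "nat set set" where "F = {{0, 1}, {1, 2}, {2, 3}, {3, 4}}"
  have bij: "bij_betw f (verts S) {0, 1, 2, 3, 4}"
    and f: "\<And>u v. u \<in> verts S \<Longrightarrow> v \<in> verts S \<Longrightarrow> {u, v} \<in> edges S \<longleftrightarrow> {f u, f v} \<in> F"
    using f0 unfolding path_graph_5 path_copy.simps ugraph.simps F_def[symmetric] by blast+
  define g where "g = inv_into (verts S) f"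
  have bg: "bij_betw g {0, 1, 2, 3, 4} (verts S)"
    unfolding g_def by (rule bij_betw_inv_into[OF bij])
  have V: "verts S = {g 0, g 1, g 2, g 3, g 4}"
    using bij_betw_imp_surj_on[OF bg] by auto
  have fg: "f (g i) = i" if "i \<in> {0, 1, 2, 3, 4}" for i
    unfolding g_def using bij that by (rule bij_betw_inv_into_right)
  have dist: "distinct [g 0, g 1, g 2, g 3, g 4]"
    using bij_betw_imp_inj_on[OF bg] by (auto simp: inj_on_def)
  have gV: "g i \<in> verts S" if "i \<in> {0, 1, 2, 3, 4}" for i
    using bij_betw_imp_surj_on[OF bg] that by blast
  have E: "{g i, g j} \<in> edges S \<longleftrightarrow> {i, j} \<in> F" if ij: "i \<in> {0, 1, 2, 3, 4}" "j \<in> {0, 1, 2, 3, 4}" for i j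
    using f[OF gV[OF ij(1)] gV[OF ij(2)]] unfolding fg[OF ij(1)] fg[OF ij(2)] .
  have edges: "edges S = {{g 0, g 1}, {g 1, g 2}, {g 2, g 3}, {g 3, g 4}}"
  proof (intro equalityI subsetI)
    fix a assume a: "a \<in> edges S"
    then have "a \<subseteq> verts S" "card a = 2"
      using sub by (auto simp: subgraph_def simple_graph_def)
    then obtain s t where st: "a = {s, t}" "s \<in> verts S" "t \<in> verts S"
      by (auto simp: card_2_iff)
    obtain i j where ij: "s = g i" "t = g j" "i \<in> {0, 1, 2, 3, 4}" "j \<in> {0, 1, 2, 3, 4}"
      using st(2,3) V by blast
    then have "{i, j} \<in> F"
      using E[OF ij(3,4)] a st(1) by simp
    then show "a \<in> {{g 0, g 1}, {g 1, g 2}, {g 2, g 3}, {g 3, g 4}}"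
      unfolding st(1) ij(1,2) F_def by (auto simp: doubleton_eq_iff)
  next
    fix a assume "a \<in> {{g 0, g 1}, {g 1, g 2}, {g 2, g 3}, {g 3, g 4}}"
    then show "a \<in> edges S"
      using E[of 0 1] E[of 1 2] E[of 2 3] E[of 3 4] unfolding F_def by auto
  qed
  have "S = path_copy (g 0, g 1, g 2, g 3, g 4)"
    using V edges by (cases S) simp
  moreover have "(g 0, g 1, g 2, g 3, g 4) \<in> paths5_set G"
    using sub dist V edges unfolding paths5_set_def subgraph_def by auto
  ultimately show "S \<in> path_copy ` paths5_set G" by blast
qed

declare path_copy.simps [simp del]

text \<open>Each copy comes from exactly two tuples, one for each direction; they differ because the
  ends do.\<close>

lemma num_copies_path_graph_5:
  assumes "simple_graph G"
  shows "2 * num_copies (path_graph 5) G = card (paths5_set G)"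
proof -
  have "finite (verts G)" using assms by (simp add: simple_graph_def)
  then have "finite (verts G \<times> verts G \<times> verts G \<times> verts G \<times> verts G)" by simp
  then have fin: "finite (paths5_set G)"
    by (rule finite_subset[rotated]) (auto simp: paths5_set_def)
  have fibre: "card {q \<in> paths5_set G. path_copy q = S} = 2" if im: "S \<in> path_copy ` paths5_set G" for S
  proof -
    obtain p where "p \<in> paths5_set G" "S = path_copy p" using im by blast
    moreover obtain x y z w v where "p = (x, y, z, w, v)" by (rule prod_cases5)
    ultimately have p: "(x, y, z, w, v) \<in> paths5_set G" and S: "S = path_copy (x, y, z, w, v)"
      by simp_all
    then have d: "distinct [x, y, z, w, v]" by (simp add: paths5_set_def)
    have r: "(v, w, z, y, x) \<in> paths5_set G"
      using p by (auto simp: paths5_set_def insert_commute)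
    have "{q \<in> paths5_set G. path_copy q = S} = {(x, y, z, w, v), (v, w, z, y, x)}"
    proof (intro equalityI subsetI)
      fix q assume q: "q \<in> {q \<in> paths5_set G. path_copy q = S}"
      obtain a b c d' u where "q = (a, b, c, d', u)" by (rule prod_cases5)
      then show "q \<in> {(x, y, z, w, v), (v, w, z, y, x)}"
        using q path_copy_eq_iff[OF d, of a b c d' u] unfolding S by (simp add: paths5_set_def)
    next
      fix q assume "q \<in> {(x, y, z, w, v), (v, w, z, y, x)}"
      then show "q \<in> {q \<in> paths5_set G. path_copy q = S}"
        using p r path_copy_eq_iff[OF d, of v w z y x] d unfolding S by auto
    qed
    then show ?thesis using d by simp
  qed
  have "card (paths5_set G) = (\<Sum>S\<in>path_copy ` paths5_set G. card {q \<in> paths5_set G. path_copy q = S})"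
    using sum.image_gen[OF fin, of "\<lambda>_. 1 :: nat" path_copy] by simp
  also have "\<dots> = 2 * card (path_copy ` paths5_set G)"
    using fibre by simp
  finally show ?thesis
    by (simp add: num_copies_def copies_path_graph_5[OF assms])
qed

section \<open>Absence of K_4 and the graphs concerned\<close>

lemma complete_graph_edges: "{i, j} \<in> edges (complete_graph r) \<longleftrightarrow> i < r \<and> j < r \<and> i \<noteq> j"
  by (auto simp: complete_graph_def doubleton_eq_iff)

lemma graph_free_K4_iff:
  assumes "simple_graph G"
  shows "graph_free (complete_graph 4) G \<longleftrightarrow> sgraph.K4_free (\<lambda>x y. {x, y} \<in> edges G) (verts G)"
proof -
  interpret sgraph "\<lambda>x y. {x, y} \<in> edges G" by (rule simple_graph_sgraph[OF assms])
  have irr: "x \<noteq> y" if "{x, y} \<in> edges G" for x y using adj_irrefl that by blast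
  have K4: "i < 4 \<longleftrightarrow> i \<in> {0, 1, 2, 3}" for i :: nat by auto
  show ?thesis
  proof
    assume free: "graph_free (complete_graph 4) G"
    show "K4_free (verts G)"
      unfolding K4_free_def
    proof (intro ballI notI)
      fix a b c d assume V: "a \<in> verts G" "b \<in> verts G" "c \<in> verts G" "d \<in> verts G"
        and E: "{a, b} \<in> edges G \<and> {a, c} \<in> edges G \<and> {a, d} \<in> edges G \<and>
          {b, c} \<in> edges G \<and> {b, d} \<in> edges G \<and> {c, d} \<in> edges G"
      have ne: "a \<noteq> b" "a \<noteq> c" "a \<noteq> d" "b \<noteq> c" "b \<noteq> d" "c \<noteq> d" using E irr by blast+
      define Q where "Q = {a, b, c, d}"
      define S where "S = \<lparr>verts = Q, edges = {k. k \<subseteq> Q \<and> card k = 2}\<rparr>"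
      define f where "f = (\<lambda>u. if u = a then 0 else if u = b then 1 else if u = c then 2 else 3 :: nat)"
      have EG: "{s, t} \<in> edges G" if "s \<in> Q" "t \<in> Q" "s \<noteq> t" for s t
        using E that unfolding Q_def by (auto simp: insert_commute)
      have "edges S \<subseteq> edges G"
      proof
        fix k assume "k \<in> edges S"
        then have k: "k \<subseteq> Q" "card k = 2" by (simp_all add: S_def)
        then obtain s t where "k = {s, t}" "s \<noteq> t" by (auto simp: card_2_iff)
        then show "k \<in> edges G" using EG k(1) by simp
      qed
      moreover have "finite Q" "Q \<subseteq> verts G" using V by (simp_all add: Q_def)
      ultimately have "subgraph S G"
        unfolding subgraph_def simple_graph_def by (simp add: S_def)
      moreover have bij: "bij_betw f Q {..<4}"
        using ne unfolding Q_def f_def by (auto simp: bij_betw_def inj_on_def K4)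
      have "isomorphic S (complete_graph 4)"
        unfolding isomorphic_def
      proof (intro exI conjI ballI)
        show "bij_betw f (verts S) (verts (complete_graph 4))"
          using bij by (simp add: S_def complete_graph_def)
        fix s t assume st: "s \<in> verts S" "t \<in> verts S"
        have "{s, t} \<in> edges S \<longleftrightarrow> s \<noteq> t"
          using st by (cases "s = t") (simp_all add: S_def)
        also have "\<dots> \<longleftrightarrow> f s \<noteq> f t"
          using inj_on_eq_iff[OF bij_betw_imp_inj_on[OF bij], of s t] st by (simp add: S_def)
        also have "\<dots> \<longleftrightarrow> {f s, f t} \<in> edges (complete_graph 4)"
          unfolding complete_graph_edges using bij_betwE[OF bij] st by (simp add: S_def)
        finally show "{s, t} \<in> edges S \<longleftrightarrow> {f s, f t} \<in> edges (complete_graph 4)" .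
      qed
      ultimately show False using free unfolding graph_free_def copies_def by blast
    qed
  next
    assume free: "K4_free (verts G)"
    show "graph_free (complete_graph 4) G"
      unfolding graph_free_def
    proof (rule ccontr)
      assume "copies (complete_graph 4) G \<noteq> {}"
      then obtain S where S: "subgraph S G" "isomorphic S (complete_graph 4)"
        unfolding copies_def by blast
      then obtain f where f: "bij_betw f (verts S) (verts (complete_graph 4))"
        "\<forall>u\<in>verts S. \<forall>v\<in>verts S. {u, v} \<in> edges S \<longleftrightarrow> {f u, f v} \<in> edges (complete_graph 4)"
        unfolding isomorphic_def by blast
      have "\<exists>u\<in>verts S. f u = i" if "i < 4" for i
      proof -
        have "i \<in> f ` verts S"
          using bij_betw_imp_surj_on[OF f(1)] that by (simp add: complete_graph_def)
        then show ?thesis by blast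
      qed
      then obtain g where g: "\<And>i. i < 4 \<Longrightarrow> g i \<in> verts S \<and> f (g i) = i" by metis
      have E: "{g i, g j} \<in> edges G" if "i < 4" "j < 4" "i \<noteq> j" for i j
      proof -
        have "{i, j} \<in> edges (complete_graph 4)" using that by (simp add: complete_graph_edges)
        then have "{g i, g j} \<in> edges S" using f(2) g that by simp
        then show ?thesis using S(1) by (auto simp: subgraph_def)
      qed
      have V: "g i \<in> verts G" if "i < 4" for i using g[OF that] S(1) by (auto simp: subgraph_def)
      show False
        by (rule K4_freeD[OF free V[of 0] V[of 1] V[of 2] V[of 3]]) (simp_all add: E)
    qed
  qed
qed

lemma simple_turan_graph: "simple_graph (turan_graph 3 n)"
  by (auto simp: simple_graph_def turan_graph_def turan_class_def card_2_iff)

lemma turan_graph_edges: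
  assumes "x < n" "y < n"
  shows "{x, y} \<in> edges (turan_graph 3 n) \<longleftrightarrow> x mod 3 \<noteq> y mod 3"
proof
  assume "x mod 3 \<noteq> y mod 3"
  then show "{x, y} \<in> edges (turan_graph 3 n)"
    using assms unfolding turan_graph_def turan_class_def ugraph.simps
    by (intro CollectI exI[of _ x] exI[of _ y] exI[of _ "x mod 3"] exI[of _ "y mod 3"]) simp
qed (auto simp: turan_graph_def turan_class_def doubleton_eq_iff)

text \<open>The edges of \<open>turan_graph 3 n\<close> and the adjacency of \<open>turan\<close>
  agree only below \<open>n\<close>, which is where the sum ranges.\<close>

lemma paths5_turan_graph:
  "sgraph.paths5 (\<lambda>x y. {x, y} \<in> edges (turan_graph 3 n)) {..<n} = turan.paths5 {..<n}"
proof -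
  interpret G: sgraph "\<lambda>x y. {x, y} \<in> edges (turan_graph 3 n)"
    by (rule simple_graph_sgraph[OF simple_turan_graph])
  show ?thesis
    unfolding G.paths5_def turan.paths5_def
    by (intro antisym dsum5_mono) (simp_all add: turan_graph_edges)
qed

lemma turan_graph_K4_free: "graph_free (complete_graph 4) (turan_graph 3 n)"
proof -
  interpret G: sgraph "\<lambda>x y. {x, y} \<in> edges (turan_graph 3 n)"
    by (rule simple_graph_sgraph[OF simple_turan_graph])
  have r: "x mod 3 = 0 \<or> x mod 3 = 1 \<or> x mod 3 = 2" for x :: nat
  proof -
    have "x mod 3 < 3" by simp
    then show ?thesis by linarith
  qed
  have "G.K4_free {..<n}"
    unfolding G.K4_free_def
  proof (intro ballI notI)
    fix a b c d assume "a \<in> {..<n}" "b \<in> {..<n}" "c \<in> {..<n}" "d \<in> {..<n}"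
      "{a, b} \<in> edges (turan_graph 3 n) \<and> {a, c} \<in> edges (turan_graph 3 n) \<and>
       {a, d} \<in> edges (turan_graph 3 n) \<and> {b, c} \<in> edges (turan_graph 3 n) \<and>
       {b, d} \<in> edges (turan_graph 3 n) \<and> {c, d} \<in> edges (turan_graph 3 n)"
    then have "a mod 3 \<noteq> b mod 3" "a mod 3 \<noteq> c mod 3" "a mod 3 \<noteq> d mod 3" "b mod 3 \<noteq> c mod 3"
      "b mod 3 \<noteq> d mod 3" "c mod 3 \<noteq> d mod 3"
      by (simp_all add: turan_graph_edges)
    then show False using r[of a] r[of b] r[of c] r[of d] by (elim disjE) simp_all
  qed
  moreover have "verts (turan_graph 3 n) = {..<n}" by (simp add: turan_graph_def)
  ultimately show ?thesis using graph_free_K4_iff[OF simple_turan_graph] by simp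
qed

text \<open>A path has not even a triangle: three numbers cannot be pairwise consecutive.\<close>

lemma path_graph_K4_free: "graph_free (complete_graph 4) (path_graph r)"
proof -
  have simple: "simple_graph (path_graph r)"
    by (auto simp: simple_graph_def path_graph_def)
  interpret G: sgraph "\<lambda>x y. {x, y} \<in> edges (path_graph r)"
    by (rule simple_graph_sgraph[OF simple])
  have e: "y = Suc x \<or> x = Suc y" if "{x, y} \<in> edges (path_graph r)" for x y
    using that by (auto simp: path_graph_def doubleton_eq_iff)
  have "G.K4_free (verts (path_graph r))"
    unfolding G.K4_free_def
  proof (intro ballI notI, elim conjE)
    fix a b c d
    assume "{a, b} \<in> edges (path_graph r)" "{a, c} \<in> edges (path_graph r)" "{b, c} \<in> edges (path_graph r)"
    then show False using e[of a b] e[of a c] e[of b c] by linarith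
  qed
  then show ?thesis using graph_free_K4_iff[OF simple] by simp
qed

theorem theorem4p1: "turan_good 4 (path_graph 5)"
  unfolding turan_good_def
proof (intro conjI exI[of _ "3 * 9010 ^ 5 + 9010 + 1"] allI impI)
  show "graph_free (complete_graph 4) (path_graph 5)" by (rule path_graph_K4_free)
  fix n :: nat assume n: "3 * 9010 ^ 5 + 9010 + 1 \<le> n"
  let ?T = "turan_graph 3 n"
  have T: "verts ?T = {..<n}" by (simp add: turan_graph_def)
  have "ex_number n (path_graph 5) (complete_graph 4) = num_copies (path_graph 5) ?T"
    unfolding ex_number_def
  proof (rule Max_eqI[OF finite_ex_number_set])
    show "num_copies (path_graph 5) ?T \<in> {num_copies (path_graph 5) G | G :: nat ugraph.
        simple_graph G \<and> card (verts G) = n \<and> graph_free (complete_graph 4) G}"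
      using simple_turan_graph turan_graph_K4_free T by auto
  next
    fix k assume "k \<in> {num_copies (path_graph 5) G | G :: nat ugraph.
        simple_graph G \<and> card (verts G) = n \<and> graph_free (complete_graph 4) G}"
    then obtain G :: "nat ugraph" where k: "k = num_copies (path_graph 5) G"
      and G: "simple_graph G" "card (verts G) = n" "graph_free (complete_graph 4) G" by blast
    interpret sgraph "\<lambda>x y. {x, y} \<in> edges G" by (rule simple_graph_sgraph[OF G(1)])
    \<comment> \<open>Ordered paths count every copy twice in both graphs, so the factor cancels at
      the end.\<close>
    have "int (2 * k) = paths5 (verts G)"
      unfolding k num_copies_path_graph_5[OF G(1)] by (rule card_paths5_set[OF G(1)])
    also have "\<dots> \<le> turan.paths5 {..<card (verts G)}"
    proof (rule paths5_le_turan)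
      show "finite (verts G)" using G(1) by (simp add: simple_graph_def)
      show "K4_free (verts G)" using G(3) graph_free_K4_iff[OF G(1)] by simp
      show "int (card (verts G)) > 3 * 9010 ^ 5 + 9010" using n G(2) by simp
    qed
    also have "\<dots> = int (2 * num_copies (path_graph 5) ?T)"
      unfolding num_copies_path_graph_5[OF simple_turan_graph] card_paths5_set[OF simple_turan_graph]
        T paths5_turan_graph G(2) ..
    finally show "k \<le> num_copies (path_graph 5) ?T" by simp
  qed
  then show "ex_number n (path_graph 5) (complete_graph 4) = num_copies (path_graph 5) (turan_graph (4 - 1) n)"
    by simp
qed

end
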